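(* Let $\mathfrak g$ be a (possibly infinite-dimensional) Lie algebra over $\mathbb C$ equipped with a (possibly degenerate) symmetric invariant bilinear form $\langle\cdot,\cdot\rangle$, let $r$ be a positive integer and let $\ell$ be any complex number. Then there exists an $(r+1)$-toroidal vertex algebra structure on $V_{\widehat{L_{r+1}(\mathfrak g)}}(\ell,0)$, which is uniquely determined by the conditions that $\mathbf 1=1\otimes 1$ is the vacuum vector and that $$Y(a;x_0,\mathbf x)=a(x_0,\mathbf x)\quad\text{for } a\in\mathfrak g.$$
   Context: All variables are mutually commuting formal variables. $\mathbf{x}=(x_1,\dots,x_r)$, $\mathbf{x}^{\mathbf m}=x_1^{m_1}\cdots x_r^{m_r}$ for $\mathbf m\in\mathbb{Z}^r$, $\mathbf{z}\mathbf{y}=(z_1y_1,\dots,z_ry_r)$, and similarly $\mathbf t^{\mathbf m}=t_1^{m_1}\cdots t_r^{m_r}$. $\delta(x)=\sum_{n\in\mathbb{Z}}x^n$, and powers of binomials such as $(x_0-y_0)^n$ are expanded in nonnegative powers of the second variable. $V[[x_1^{\pm1},\dots,x_r^{\pm1}]]((x_0))$ is the space of Laurent series in $x_0$ (finitely many negative powers) with coefficients in $V[[x_1^{\pm1},\dots,x_r^{\pm1}]]$. An $(r+1)$-toroidal vertex algebra is a vector space $V$ with a linear map $Y(\cdot;x_0,\mathbf{x}):V\to \mathrm{Hom}(V,V[[x_1^{\pm1},\dots,x_r^{\pm1}]]((x_0)))$ and a vector $\mathbf 1\in V$ (vacuum) such that $Y(\mathbf 1;x_0,\mathbf{x})v=v$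 and $Y(v;x_0,\mathbf{x})\mathbf 1\in V[[x_0,x_1^{\pm1},\dots,x_r^{\pm1}]]$ for $v\in V$, and for $u,v\in V$ $$z_0^{-1}\delta\Big(\frac{x_0-y_0}{z_0}\Big)Y(u;x_0,\mathbf{z}\mathbf{y})Y(v;y_0,\mathbf{y})-z_0^{-1}\delta\Big(\frac{y_0-x_0}{-z_0}\Big)Y(v;y_0,\mathbf{y})Y(u;x_0,\mathbf{z}\mathbf{y})=y_0^{-1}\delta\Big(\frac{x_0-z_0}{y_0}\Big)Y(Y(u;z_0,\mathbf{z})v;y_0,\mathbf{y}).$$ $\widehat{L_{r+1}(\mathfrak g)}=\big(\mathfrak g\otimes\mathbb C[t_0^{\pm1},t_1^{\pm1},\dots,t_r^{\pm1}]\big)\oplus\mathbb C\mathbf k$ is the Lie algebra with $\mathbf k$ central and $$[a\otimes t_0^{m_0}\mathbf t^{\mathbf m},b\otimes t_0^{n_0}\mathbf t^{\mathbf n}]=[a,b]\otimes t_0^{m_0+n_0}\mathbf t^{\mathbf m+\mathbf n}+m_0\langle a,b\rangle\delta_{m_0+n_0,0}\delta_{\mathbf m+\mathbf n,0}\mathbf k.$$ For $a\in\mathfrak g$, $a(x_0,\mathbf x)=\sum_{n_0\in\mathbb Z}\sum_{\mathbf n\in\mathbb Z^r}(a\otimes t_0^{n_0}\mathbf t^{\mathbf n})x_0^{-n_0-1}\mathbf x^{-\mathbf n}$. Let $\widehat{L_{r+1}(\mathfrak g)}_+=\mathfrak g\otimes\mathbb C[t_0,t_1^{\pm1},\dots,t_r^{\pm1}]$.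 Let $(\mathfrak g+\mathbb C)_\ell$ denote the $(\widehat{L_{r+1}(\mathfrak g)}_++\mathbb C\mathbf k)$-module with underlying space $\mathfrak g\oplus\mathbb C$ on which $\mathbf k$ acts as the scalar $\ell$ and, for $a,b\in\mathfrak g$, $k\ge0$, $\mathbf m\in\mathbb Z^r$: $(a\otimes t_0^k\mathbf t^{\mathbf m})\cdot1=0$, and $(a\otimes t_0^k\mathbf t^{\mathbf m})\cdot b$ equals $[a,b]$ if $k=0$, $\langle a,b\rangle\ell\in\mathbb C$ if $k=1$, and $0$ if $k\ge2$. Then $$V_{\widehat{L_{r+1}(\mathfrak g)}}(\ell,0)=U\big(\widehat{L_{r+1}(\mathfrak g)}\big)\otimes_{U(\widehat{L_{r+1}(\mathfrak g)}_++\mathbb C\mathbf k)}(\mathfrak g+\mathbb C)_\ell,$$ and $\mathfrak g$ is identified with the subspace $1\otimes\mathfrak g$ via $a\mapsto1\otimes a$. In the claim, $a(x_0,\mathbf x)$ acts on this induced module. *)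

theory Defs
  imports
    Complex_Main
    "HOL-Analysis.Finite_Cartesian_Product"
    "HOL-Analysis.Product_Vector"
    "HOL-Library.Poly_Mapping"
    "HOL-Algebra.QuotRing"
    "HOL-Algebra.Module"
    "HOL-Algebra.Free_Abelian_Groups"
    "HOL-Algebra.Algebraic_Closure_Type"
begin

section \<open>Lie algebras with an invariant form\<close>

locale complex_lie_algebra = vector_space scale
  for scale :: "complex \<Rightarrow> 'g::ab_group_add \<Rightarrow> 'g" +
  fixes bracket :: "'g \<Rightarrow> 'g \<Rightarrow> 'g"
  assumes bracket_linear_right: "Vector_Spaces.linear scale scale (\<lambda>b. bracket a b)"
    and bracket_linear_left: "Vector_Spaces.linear scale scale (\<lambda>a. bracket a b)"
    and bracket_self: "bracket a a = 0"
    and jacobi_identity: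
      "bracket a (bracket b c) + bracket b (bracket c a) + bracket c (bracket a b) = 0"

locale complex_lie_algebra_form = complex_lie_algebra +
  fixes form :: "'a \<Rightarrow> 'a \<Rightarrow> complex"
  assumes form_linear_right: "Vector_Spaces.linear scale (*) (\<lambda>b. form a b)"
    and form_linear_left: "Vector_Spaces.linear scale (*) (\<lambda>a. form a b)"
    and form_symmetric: "form a b = form b a"
    and form_invariant: "form (bracket a b) c = form a (bracket b c)"


section \<open>Universal enveloping algebras\<close>

text \<open>
  The free associative unital algebra on a set \<^term>\<open>S\<close>: finite formal complex linear
  combinations of words in \<^term>\<open>S\<close>, multiplied by concatenation.
\<close>

definition free_algebra :: "'l set \<Rightarrow> ('l list \<Rightarrow>\<^sub>0 complex) ring" where
  "free_algebra S =
     \<lparr>carrier = {p. Poly_Mapping.keys p \<subseteq> lists S},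
      monoid.mult = (\<lambda>p q. \<Sum>v\<in>Poly_Mapping.keys p. \<Sum>w\<in>Poly_Mapping.keys q.
        Poly_Mapping.single (v @ w) (Poly_Mapping.lookup p v * Poly_Mapping.lookup q w)),
      one = Poly_Mapping.single [] 1,
      zero = 0,
      add = (+)\<rparr>"

abbreviation word :: "'l list \<Rightarrow> ('l list \<Rightarrow>\<^sub>0 complex)" where
  "word w \<equiv> Poly_Mapping.single w 1"

text \<open>
  \<^term>\<open>S\<close> is (the underlying set of) a Lie subalgebra of the Lie algebra given by
  \<open>scl\<close> and \<open>br\<close>. The first two families of relations make the free algebra on the set
  \<^term>\<open>S\<close> into the tensor algebra of the vector space \<^term>\<open>S\<close>.
\<close>

definition enveloping_relations ::
  "(complex \<Rightarrow> 'l \<Rightarrow> 'l) \<Rightarrow> ('l \<Rightarrow> 'l \<Rightarrow> 'l) \<Rightarrow> 'l::ab_group_add set \<Rightarrow> ('l list \<Rightarrow>\<^sub>0 complex) set"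
where
  "enveloping_relations scl br S =
     {word [x + y] - word [x] - word [y] | x y. x \<in> S \<and> y \<in> S}
   \<union> {word [scl c x] - Poly_Mapping.single [x] c | c x. x \<in> S}
   \<union> {word [x, y] - word [y, x] - word [br x y] | x y. x \<in> S \<and> y \<in> S}"

definition enveloping_ideal ::
  "(complex \<Rightarrow> 'l \<Rightarrow> 'l) \<Rightarrow> ('l \<Rightarrow> 'l \<Rightarrow> 'l) \<Rightarrow> 'l::ab_group_add set \<Rightarrow> ('l list \<Rightarrow>\<^sub>0 complex) set"
where
  "enveloping_ideal scl br S = Idl\<^bsub>free_algebra S\<^esub> (enveloping_relations scl br S)"

definition enveloping_algebra ::
  "(complex \<Rightarrow> 'l \<Rightarrow> 'l) \<Rightarrow> ('l \<Rightarrow> 'l \<Rightarrow> 'l) \<Rightarrow> 'l::ab_group_add set \<Rightarrow> ('l list \<Rightarrow>\<^sub>0 complex) set ring"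
where
  "enveloping_algebra scl br S = free_algebra S Quot enveloping_ideal scl br S"

definition enveloping_class ::
  "(complex \<Rightarrow> 'l \<Rightarrow> 'l) \<Rightarrow> ('l \<Rightarrow> 'l \<Rightarrow> 'l) \<Rightarrow> 'l::ab_group_add set
    \<Rightarrow> ('l list \<Rightarrow>\<^sub>0 complex) \<Rightarrow> ('l list \<Rightarrow>\<^sub>0 complex) set"
where
  "enveloping_class scl br S p = enveloping_ideal scl br S +>\<^bsub>free_algebra S\<^esub> p"

text \<open>The algebra homomorphism \<open>U(S) \<rightarrow> U(T)\<close> induced by an inclusion of Lie algebras
  \<^term>\<open>S \<subseteq> T\<close>; it depends on \<^term>\<open>S\<close> only through its argument.\<close>

definition enveloping_map ::
  "(complex \<Rightarrow> 'l \<Rightarrow> 'l) \<Rightarrow> ('l \<Rightarrow> 'l \<Rightarrow> 'l) \<Rightarrow> 'l::ab_group_add set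
    \<Rightarrow> ('l list \<Rightarrow>\<^sub>0 complex) set \<Rightarrow> ('l list \<Rightarrow>\<^sub>0 complex) set"
where
  "enveloping_map scl br T C = the_elem (enveloping_class scl br T ` C)"

text \<open>
  A Lie algebra action \<open>\<rho>\<close> on a vector space extends to the free algebra by
  \<open>[x\<^sub>1, \<dots>, x\<^sub>n] \<cdot> m = \<rho> x\<^sub>1 (\<dots> (\<rho> x\<^sub>n m))\<close>, and passes to the quotient by the
  enveloping ideal.
\<close>

definition word_action ::
  "(complex \<Rightarrow> 'n \<Rightarrow> 'n) \<Rightarrow> ('l \<Rightarrow> 'n \<Rightarrow> 'n) \<Rightarrow> ('l list \<Rightarrow>\<^sub>0 complex) \<Rightarrow> 'n \<Rightarrow> 'n::ab_group_add"
where
  "word_action scl \<rho> p m =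
     (\<Sum>w\<in>Poly_Mapping.keys p. scl (Poly_Mapping.lookup p w) (foldr \<rho> w m))"

definition enveloping_action ::
  "(complex \<Rightarrow> 'n \<Rightarrow> 'n) \<Rightarrow> ('l \<Rightarrow> 'n \<Rightarrow> 'n) \<Rightarrow> ('l list \<Rightarrow>\<^sub>0 complex) set \<Rightarrow> 'n \<Rightarrow> 'n::ab_group_add"
where
  "enveloping_action scl \<rho> C m = the_elem ((\<lambda>p. word_action scl \<rho> p m) ` C)"


section \<open>Extension of scalars\<close>

text \<open>
  For a ring homomorphism \<open>i : R \<rightarrow> A\<close> and a left \<open>R\<close>-module whose underlying group is the
  type \<open>'n\<close>, with action \<open>act\<close>, this is the tensor product of \<open>A\<close> and \<open>'n\<close> over \<open>R\<close>: the free
  abelian group on pairs modulo biadditivity and \<open>R\<close>-balancedness.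
\<close>

definition tensor_relations ::
  "('r, 'x) ring_scheme \<Rightarrow> ('a, 'y) ring_scheme \<Rightarrow> ('r \<Rightarrow> 'a) \<Rightarrow> ('r \<Rightarrow> 'n \<Rightarrow> 'n)
    \<Rightarrow> (('a \<times> 'n::ab_group_add) \<Rightarrow>\<^sub>0 int) set"
where
  "tensor_relations R A i act =
     {frag_of (u \<oplus>\<^bsub>A\<^esub> u', m) - frag_of (u, m) - frag_of (u', m) | u u' m.
        u \<in> carrier A \<and> u' \<in> carrier A}
   \<union> {frag_of (u, m + m') - frag_of (u, m) - frag_of (u, m') | u m m'. u \<in> carrier A}
   \<union> {frag_of (u \<otimes>\<^bsub>A\<^esub> i x, m) - frag_of (u, act x m) | u x m.
        u \<in> carrier A \<and> x \<in> carrier R}"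

definition tensor_subgroup ::
  "('r, 'x) ring_scheme \<Rightarrow> ('a, 'y) ring_scheme \<Rightarrow> ('r \<Rightarrow> 'a) \<Rightarrow> ('r \<Rightarrow> 'n \<Rightarrow> 'n)
    \<Rightarrow> (('a \<times> 'n::ab_group_add) \<Rightarrow>\<^sub>0 int) set"
where
  "tensor_subgroup R A i act =
     generate (free_Abelian_group (carrier A \<times> UNIV)) (tensor_relations R A i act)"

definition tensor_group ::
  "('r, 'x) ring_scheme \<Rightarrow> ('a, 'y) ring_scheme \<Rightarrow> ('r \<Rightarrow> 'a) \<Rightarrow> ('r \<Rightarrow> 'n \<Rightarrow> 'n)
    \<Rightarrow> (('a \<times> 'n::ab_group_add) \<Rightarrow>\<^sub>0 int) set monoid"
where
  "tensor_group R A i act =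
     free_Abelian_group (carrier A \<times> UNIV) Mod tensor_subgroup R A i act"

definition tensor_class ::
  "('r, 'x) ring_scheme \<Rightarrow> ('a, 'y) ring_scheme \<Rightarrow> ('r \<Rightarrow> 'a) \<Rightarrow> ('r \<Rightarrow> 'n \<Rightarrow> 'n)
    \<Rightarrow> (('a \<times> 'n::ab_group_add) \<Rightarrow>\<^sub>0 int) \<Rightarrow> (('a \<times> 'n) \<Rightarrow>\<^sub>0 int) set"
where
  "tensor_class R A i act f =
     tensor_subgroup R A i act #>\<^bsub>free_Abelian_group (carrier A \<times> UNIV)\<^esub> f"

text \<open>The left \<open>A\<close>-module structure, \<open>a \<cdot> (u \<otimes> m) = a u \<otimes> m\<close>.\<close>

definition tensor_left_action ::
  "('r, 'x) ring_scheme \<Rightarrow> ('a, 'y) ring_scheme \<Rightarrow> ('r \<Rightarrow> 'a) \<Rightarrow> ('r \<Rightarrow> 'n \<Rightarrow> 'n)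
    \<Rightarrow> 'a \<Rightarrow> (('a \<times> 'n::ab_group_add) \<Rightarrow>\<^sub>0 int) set \<Rightarrow> (('a \<times> 'n) \<Rightarrow>\<^sub>0 int) set"
where
  "tensor_left_action R A i act a C =
     the_elem ((\<lambda>f. tensor_class R A i act
       (frag_extend (\<lambda>(u, m). frag_of (a \<otimes>\<^bsub>A\<^esub> u, m)) f)) ` C)"


section \<open>The toroidal Lie algebra and the induced module\<close>

text \<open>
  The type variable \<open>'r\<close> is an index set with \<open>r = CARD('r)\<close> elements. The tensor product of
  \<open>\<gg>\<close> with the Laurent polynomials in \<open>t\<^sub>0, \<dots>, t\<^sub>r\<close> is realised as the space of finitely supported
  functions on the exponents \<open>(m\<^sub>0, m)\<close> with values in \<open>\<gg>\<close>; the second component of an element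
  of the type below is the coefficient of the central element \<open>k\<close>.
\<close>

type_synonym ('g, 'r) toroidal = "((int \<times> (int ^ 'r)) \<Rightarrow>\<^sub>0 'g) \<times> complex"

definition monomial :: "'g::zero \<Rightarrow> int \<Rightarrow> int ^ 'r \<Rightarrow> ('g, 'r) toroidal" where
  "monomial a m\<^sub>0 m = (Poly_Mapping.single (m\<^sub>0, m) a, 0)"

definition central :: "('g::zero, 'r) toroidal" where
  "central = (0, 1)"

text \<open>The subalgebra spanned by \<open>\<gg> \<otimes> \<complex>[t\<^sub>0, t\<^sub>1\<^sup>\<plusminus>\<^sup>1, \<dots>, t\<^sub>r\<^sup>\<plusminus>\<^sup>1]\<close> and \<open>k\<close>.\<close>

definition toroidal_plus :: "('g::zero, 'r) toroidal set" where
  "toroidal_plus = {(f, c). \<forall>i\<in>Poly_Mapping.keys f. fst i \<ge> 0}"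

type_synonym ('g, 'r) induced =
  "((('g, 'r) toroidal list \<Rightarrow>\<^sub>0 complex) set \<times> ('g \<times> complex) \<Rightarrow>\<^sub>0 int) set"

context
  fixes scale :: "complex \<Rightarrow> 'g::ab_group_add \<Rightarrow> 'g"
    and bracket :: "'g \<Rightarrow> 'g \<Rightarrow> 'g"
    and form :: "'g \<Rightarrow> 'g \<Rightarrow> complex"
begin

definition toroidal_scale :: "complex \<Rightarrow> ('g, 'r) toroidal \<Rightarrow> ('g, 'r) toroidal" where
  "toroidal_scale c x =
     (\<Sum>i\<in>Poly_Mapping.keys (fst x).
        Poly_Mapping.single i (scale c (Poly_Mapping.lookup (fst x) i)), c * snd x)"

definition toroidal_bracket ::
  "('g, 'r::finite) toroidal \<Rightarrow> ('g, 'r) toroidal \<Rightarrow> ('g, 'r) toroidal"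
where
  "toroidal_bracket x y =
     (\<Sum>i\<in>Poly_Mapping.keys (fst x). \<Sum>j\<in>Poly_Mapping.keys (fst y).
        Poly_Mapping.single (i + j)
          (bracket (Poly_Mapping.lookup (fst x) i) (Poly_Mapping.lookup (fst y) j)),
      \<Sum>i\<in>Poly_Mapping.keys (fst x). \<Sum>j\<in>Poly_Mapping.keys (fst y).
        if i + j = 0
        then of_int (fst i) * form (Poly_Mapping.lookup (fst x) i) (Poly_Mapping.lookup (fst y) j)
        else 0)"

text \<open>The module \<open>(\<gg> + \<complex>)\<^sub>\<ell>\<close>, where \<open>\<ell>\<close> is \<open>level\<close>: the vector \<open>(b, s)\<close> stands for \<open>b + s1\<close>.\<close>

definition base_scale :: "complex \<Rightarrow> 'g \<times> complex \<Rightarrow> 'g \<times> complex" where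
  "base_scale c v = (scale c (fst v), c * snd v)"

definition base_action :: "complex \<Rightarrow> ('g, 'r) toroidal \<Rightarrow> 'g \<times> complex \<Rightarrow> 'g \<times> complex" where
  "base_action level x v =
     (\<Sum>i\<in>Poly_Mapping.keys (fst x).
        if fst i = 0 then (bracket (Poly_Mapping.lookup (fst x) i) (fst v), 0)
        else if fst i = 1 then (0, form (Poly_Mapping.lookup (fst x) i) (fst v) * level)
        else 0)
     + base_scale (snd x * level) v"

lemma toroidal_bracket_monomial:
  assumes "complex_lie_algebra_form scale bracket form"
  shows "toroidal_bracket (monomial a m\<^sub>0 m) (monomial b n\<^sub>0 n) =
    monomial (bracket a b) (m\<^sub>0 + n\<^sub>0) (m + n)
    + (0, if m\<^sub>0 + n\<^sub>0 = 0 \<and> m + n = 0 then of_int m\<^sub>0 * form a b else 0)"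
proof -
  interpret complex_lie_algebra_form scale bracket form by fact
  have [simp]: "bracket 0 y = 0" "bracket y 0 = 0" "form 0 y = 0" "form y 0 = 0" for y
    using bracket_linear_left[unfolded linear_iff_module_hom, THEN module_hom.zero]
      bracket_linear_right[unfolded linear_iff_module_hom, THEN module_hom.zero]
      form_linear_left[unfolded linear_iff_module_hom, THEN module_hom.zero]
      form_linear_right[unfolded linear_iff_module_hom, THEN module_hom.zero]
    by auto
  show ?thesis
    by (cases "a = 0"; cases "b = 0")
      (auto simp: toroidal_bracket_def monomial_def zero_prod_def)
qed

lemma toroidal_bracket_central:
  "toroidal_bracket central x = 0" "toroidal_bracket x central = 0"
  by (auto simp: toroidal_bracket_def central_def zero_prod_def)

lemma base_action_monomial:
  assumes "complex_lie_algebra_form scale bracket form"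
  shows "base_action level (monomial a k m) (b, s) =
    (if k = 0 then (bracket a b, 0) else if k = 1 then (0, form a b * level) else 0)"
proof -
  interpret complex_lie_algebra_form scale bracket form by fact
  have [simp]: "bracket 0 y = 0" "form 0 y = 0" for y
    using bracket_linear_left[unfolded linear_iff_module_hom, THEN module_hom.zero]
      form_linear_left[unfolded linear_iff_module_hom, THEN module_hom.zero]
    by auto
  show ?thesis
    by (cases "a = 0") (auto simp: base_action_def base_scale_def monomial_def zero_prod_def)
qed

lemma base_action_central: "base_action level central v = base_scale level v"
  by (simp add: base_action_def base_scale_def central_def)

definition U_toroidal :: "('g, 'r::finite) toroidal itself
    \<Rightarrow> (('g, 'r) toroidal list \<Rightarrow>\<^sub>0 complex) set ring" where
  "U_toroidal _ = enveloping_algebra toroidal_scale toroidal_bracket UNIV"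

definition U_toroidal_plus :: "('g, 'r::finite) toroidal itself
    \<Rightarrow> (('g, 'r) toroidal list \<Rightarrow>\<^sub>0 complex) set ring" where
  "U_toroidal_plus _ = enveloping_algebra toroidal_scale toroidal_bracket toroidal_plus"

definition induced_class :: "complex
    \<Rightarrow> ((('g, 'r::finite) toroidal list \<Rightarrow>\<^sub>0 complex) set \<times> ('g \<times> complex) \<Rightarrow>\<^sub>0 int)
    \<Rightarrow> ('g, 'r) induced" where
  "induced_class level =
     tensor_class (U_toroidal_plus TYPE(('g, 'r) toroidal)) (U_toroidal TYPE(('g, 'r) toroidal))
       (enveloping_map toroidal_scale toroidal_bracket UNIV)
       (enveloping_action base_scale (base_action level))"

definition induced_left_action :: "complex
    \<Rightarrow> (('g, 'r::finite) toroidal list \<Rightarrow>\<^sub>0 complex) set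
    \<Rightarrow> ('g, 'r) induced \<Rightarrow> ('g, 'r) induced" where
  "induced_left_action level =
     tensor_left_action
       (U_toroidal_plus TYPE(('g, 'r) toroidal)) (U_toroidal TYPE(('g, 'r) toroidal))
       (enveloping_map toroidal_scale toroidal_bracket UNIV)
       (enveloping_action base_scale (base_action level))"

text \<open>
  The complex vector space underlying the induced module. The multiplication and unit fields of
  the record are unused.
\<close>

definition induced_module :: "complex \<Rightarrow> (complex, ('g, 'r::finite) induced) module" where
  "induced_module level =
     (let T = tensor_group
          (U_toroidal_plus TYPE(('g, 'r) toroidal)) (U_toroidal TYPE(('g, 'r) toroidal))
          (enveloping_map toroidal_scale toroidal_bracket UNIV)
          (enveloping_action base_scale (base_action level))
      in \<lparr>carrier = carrier T, monoid.mult = undefined, one = undefined,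
          zero = one T, add = monoid.mult T,
          module.smult = (\<lambda>c. induced_left_action level
            (enveloping_class toroidal_scale toroidal_bracket UNIV (Poly_Mapping.single [] c)))\<rparr>)"

definition induced_action :: "complex \<Rightarrow> ('g, 'r::finite) toroidal
    \<Rightarrow> ('g, 'r) induced \<Rightarrow> ('g, 'r) induced" where
  "induced_action level x =
     induced_left_action level (enveloping_class toroidal_scale toroidal_bracket UNIV (word [x]))"

definition induced_vacuum :: "complex \<Rightarrow> ('g, 'r::finite) induced" where
  "induced_vacuum level =
     induced_class level (frag_of (\<one>\<^bsub>U_toroidal TYPE(('g, 'r) toroidal)\<^esub>, (0, 1)))"

definition induced_embed :: "complex \<Rightarrow> 'g \<Rightarrow> ('g, 'r::finite) induced" where
  "induced_embed level a =
     induced_class level (frag_of (\<one>\<^bsub>U_toroidal TYPE(('g, 'r) toroidal)\<^esub>, (a, 0)))"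

text \<open>
  The coefficient of \<open>x\<^sub>0\<^sup>k x\<^sup>m\<close> in \<open>a(x\<^sub>0, x) v = \<Sum> (a \<otimes> t\<^sub>0\<^sup>n\<^sup>0 t\<^sup>n) v x\<^sub>0\<^sup>-\<^sup>n\<^sup>0\<^sup>-\<^sup>1 x\<^sup>-\<^sup>n\<close>.
\<close>

definition current_series :: "complex \<Rightarrow> 'g \<Rightarrow> ('g, 'r::finite) induced
    \<Rightarrow> int \<Rightarrow> int ^ 'r \<Rightarrow> ('g, 'r) induced" where
  "current_series level a v k m = induced_action level (monomial a (- k - 1) (- m)) v"

end


section \<open>Toroidal vertex algebras\<close>

text \<open>The coefficient of \<open>x\<^sup>j y\<^sup>k\<close> in \<open>(x - y)\<^sup>n\<close>, expanded in nonnegative powers of \<open>y\<close>.\<close>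

definition binomial_coeff :: "int \<Rightarrow> int \<Rightarrow> int \<Rightarrow> complex" where
  "binomial_coeff n j k =
     (if 0 \<le> k \<and> j + k = n then (- 1) ^ nat k * ((of_int n :: complex) gchoose nat k) else 0)"

text \<open>
  Series in \<open>z\<^sub>0, x\<^sub>0, y\<^sub>0\<close> are given by their coefficients, the index \<open>(i, j, k)\<close> being that of
  \<open>z\<^sub>0\<^sup>i x\<^sub>0\<^sup>j y\<^sub>0\<^sup>k\<close>. The three kernels below are, in this order,
  \<open>z\<^sub>0\<^sup>-\<^sup>1\<delta>((x\<^sub>0 - y\<^sub>0)/z\<^sub>0) = \<Sum>\<^sub>n z\<^sub>0\<^sup>-\<^sup>n\<^sup>-\<^sup>1 (x\<^sub>0 - y\<^sub>0)\<^sup>n\<close>,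
  \<open>z\<^sub>0\<^sup>-\<^sup>1\<delta>((y\<^sub>0 - x\<^sub>0)/(-z\<^sub>0)) = \<Sum>\<^sub>n (-1)\<^sup>n z\<^sub>0\<^sup>-\<^sup>n\<^sup>-\<^sup>1 (y\<^sub>0 - x\<^sub>0)\<^sup>n\<close> and
  \<open>y\<^sub>0\<^sup>-\<^sup>1\<delta>((x\<^sub>0 - z\<^sub>0)/y\<^sub>0) = \<Sum>\<^sub>n y\<^sub>0\<^sup>-\<^sup>n\<^sup>-\<^sup>1 (x\<^sub>0 - z\<^sub>0)\<^sup>n\<close>.
\<close>

definition delta_xy :: "int \<times> int \<times> int \<Rightarrow> complex" where
  "delta_xy = (\<lambda>(i, j, k). binomial_coeff (- i - 1) j k)"

definition delta_yx :: "int \<times> int \<times> int \<Rightarrow> complex" where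
  "delta_yx = (\<lambda>(i, j, k). (- 1) powi (- i - 1) * binomial_coeff (- i - 1) k j)"

definition delta_xz :: "int \<times> int \<times> int \<Rightarrow> complex" where
  "delta_xz = (\<lambda>(i, j, k). binomial_coeff (- k - 1) j i)"

text \<open>
  The product of a scalar series with a vector-valued series. In the Jacobi identity below every
  coefficient is a finite sum, because of the truncation condition on \<open>Y\<close>.
\<close>

definition series_mult ::
  "(complex, 'v, 'm) module_scheme \<Rightarrow> (int \<times> int \<times> int \<Rightarrow> complex) \<Rightarrow> (int \<times> int \<times> int \<Rightarrow> 'v)
    \<Rightarrow> int \<times> int \<times> int \<Rightarrow> 'v"
where
  "series_mult V K F e =
     (\<Oplus>\<^bsub>V\<^esub>d\<in>{d. K d \<noteq> 0 \<and> F (e - d) \<noteq> \<zero>\<^bsub>V\<^esub>}. K d \<odot>\<^bsub>V\<^esub> F (e - d))"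

text \<open>
  \<^term>\<open>Y u v k m\<close> is the coefficient of \<open>x\<^sub>0\<^sup>k x\<^sup>m\<close> in \<open>Y(u; x\<^sub>0, x) v\<close>. In the Jacobi identity,
  applied to \<open>w\<close>, \<open>a\<close> and \<open>b\<close> are the exponents of \<open>z\<close> and \<open>y\<close>. Since \<open>(zy)\<^sup>a y\<^sup>c = z\<^sup>a y\<^sup>a\<^sup>+\<^sup>c\<close>, the
  products with \<open>Y(u; x\<^sub>0, zy)\<close> have at \<open>z\<^sup>a y\<^sup>b\<close> the coefficient of \<open>Y(v; y\<^sub>0, y)\<close> at
  \<open>y\<^sup>b\<^sup>-\<^sup>a\<close>.
\<close>

locale toroidal_vertex_algebra =
  Module.module "ring_of_type_algebra :: complex ring" V
  for V :: "(complex, 'v, 'm) module_scheme" +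
  fixes Y :: "'v \<Rightarrow> 'v \<Rightarrow> int \<Rightarrow> int ^ ('r::finite) \<Rightarrow> 'v"
    and vac :: 'v
  assumes vac_closed: "vac \<in> carrier V"
    and Y_closed: "\<lbrakk>u \<in> carrier V; v \<in> carrier V\<rbrakk> \<Longrightarrow> Y u v k m \<in> carrier V"
    and Y_add_left: "\<lbrakk>u \<in> carrier V; u' \<in> carrier V; v \<in> carrier V\<rbrakk>
      \<Longrightarrow> Y (u \<oplus>\<^bsub>V\<^esub> u') v k m = Y u v k m \<oplus>\<^bsub>V\<^esub> Y u' v k m"
    and Y_smult_left: "\<lbrakk>u \<in> carrier V; v \<in> carrier V\<rbrakk>
      \<Longrightarrow> Y (c \<odot>\<^bsub>V\<^esub> u) v k m = c \<odot>\<^bsub>V\<^esub> Y u v k m"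
    and Y_add_right: "\<lbrakk>u \<in> carrier V; v \<in> carrier V; v' \<in> carrier V\<rbrakk>
      \<Longrightarrow> Y u (v \<oplus>\<^bsub>V\<^esub> v') k m = Y u v k m \<oplus>\<^bsub>V\<^esub> Y u v' k m"
    and Y_smult_right: "\<lbrakk>u \<in> carrier V; v \<in> carrier V\<rbrakk>
      \<Longrightarrow> Y u (c \<odot>\<^bsub>V\<^esub> v) k m = c \<odot>\<^bsub>V\<^esub> Y u v k m"
    and truncation: "\<lbrakk>u \<in> carrier V; v \<in> carrier V\<rbrakk>
      \<Longrightarrow> \<exists>N. \<forall>k<N. \<forall>m. Y u v k m = \<zero>\<^bsub>V\<^esub>"
    and vacuum: "v \<in> carrier V
      \<Longrightarrow> Y vac v k m = (if k = 0 \<and> m = 0 then v else \<zero>\<^bsub>V\<^esub>)"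
    and creation: "\<lbrakk>v \<in> carrier V; k < 0\<rbrakk> \<Longrightarrow> Y v vac k m = \<zero>\<^bsub>V\<^esub>"
    and jacobi: "\<lbrakk>u \<in> carrier V; v \<in> carrier V; w \<in> carrier V\<rbrakk> \<Longrightarrow>
      series_mult V delta_xy
        (\<lambda>(i, j, k). if i = 0 then Y u (Y v w k (b - a)) j a else \<zero>\<^bsub>V\<^esub>) e
      \<ominus>\<^bsub>V\<^esub> series_mult V delta_yx
        (\<lambda>(i, j, k). if i = 0 then Y v (Y u w j a) k (b - a) else \<zero>\<^bsub>V\<^esub>) e
      = series_mult V delta_xz
        (\<lambda>(i, j, k). if j = 0 then Y (Y u v i a) w k b else \<zero>\<^bsub>V\<^esub>) e"

end

theory Submission imports Defs "HOL-Library.Function_Algebras" begin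

text \<open>
  The \<open>r\<close> variables \<open>x\<close> only carry a grading. Write \<open>Y u \<alpha> n\<close> for the coefficient of
  \<open>x\<^sub>0\<^sup>-\<^sup>n\<^sup>-\<^sup>1 x\<^sup>\<alpha>\<close> in \<open>Y(u; x\<^sub>0, x)\<close>; for fixed \<open>\<alpha>\<close> this is a field in one variable, and the coefficient of
  \<open>z\<^sup>a y\<^sup>b\<close> in the toroidal Jacobi identity is the ordinary Borcherds identity for the fields of \<open>u\<close> of degree
  \<open>a\<close>, of \<open>v\<close> of degree \<open>b - a\<close> and of the iterates of degree \<open>b\<close>. Everything therefore happens in the
  calculus of fields in one variable, with degrees that add.

  \<^emph>\<open>Existence.\<close> Consider all families of fields on the module \<open>V\<close>, indexed by \<open>\<int>\<^sup>r\<close> and truncated uniformly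
  in the degree. Let \<open>a \<otimes> t\<^sub>0\<^sup>n t\<^sup>m\<close> act on them by the \<open>n\<close>-th product with the field of \<open>a\<close> of degree
  \<open>-m\<close>, and \<open>k\<close> by \<open>\<ell>\<close>. This is a representation of the toroidal Lie algebra (\<open>comm_commutator\<close>,
  \<open>cur_act_commutator\<close>), and \<open>b + s1 \<mapsto> b(x\<^sub>0, x) + s id\<close> is a homomorphism from \<open>(\<gg> + \<complex>)\<^sub>\<ell>\<close>
  (\<open>base_field_act\<close>). The universal property of the induced module (\<open>universal\<close>) extends it to a linear map
  \<open>Y\<close> on \<open>V\<close>. By construction
  \<open>Y(1) = id\<close>, \<open>Y(a) = a(x\<^sub>0, x)\<close> and \<open>Y\<close> sends the action of a current on \<open>v\<close> to a product of fields.

  For \<open>u = a \<in> \<gg>\<close>, the last property is one instance of the Borcherds identity, and together with locality one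
  instance implies all of them (\<open>Borcherds_criterion\<close>). Locality comes from Dong's lemma (\<open>Dong\<close>), applied along
  the generation of \<open>V\<close> from \<open>\<gg> + \<complex>\<close> by currents. The identity also passes from \<open>a\<close> and \<open>u\<close> to the
  \<open>n\<close>-th product \<open>a\<^sub>n u\<close> (\<open>Borcherds_product\<close>), because at a suitable instance it is weak associativity
  (\<open>Borcherds_at_iff_weak_assoc\<close>), and weak associativity is inherited by products (\<open>weak_assoc_comm\<close>). Since
  \<open>V\<close> is generated in this way, the identity holds for all \<open>u\<close> and \<open>v\<close> (\<open>Borcherds_Y\<close>).

  \<^emph>\<open>Uniqueness.\<close> In one coefficient of the Jacobi identity for \<open>a \<in> \<gg>\<close> and \<open>v\<close> the right-hand side is the
  single term \<open>Y(a\<^sub>n v)\<close>. So \<open>Y(a)\<close> and \<open>Y(v)\<close> determine the field of \<open>a\<^sub>n v\<close>, and \<open>V\<close> is generated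
  from \<open>\<gg> + \<complex>\<close>.

  Two identities of series carry nearly all computations. A series in \<open>x, y\<close> with \<open>y\<close>-modes bounded
  above is determined by its product with \<open>x + \<epsilon>y\<close> expanded in nonnegative powers of \<open>y\<close>
  (\<open>binomial_recursion_unique\<close>), so that identities between expansions of \<open>(x + \<epsilon>y)\<^sup>n\<close> need a proof for one
  exponent only. And \<open>x - w = (x - y) + (y - w)\<close> lets powers of one difference be traded for powers of the other
  two (\<open>triangular_recursion_zero\<close>).
\<close>


section \<open>Binomial recursions\<close>

text \<open>
  The coefficient of \<open>x\<^sup>n\<^sup>-\<^sup>s y\<^sup>s\<close> in \<open>(x + \<epsilon>y)\<^sup>n\<close>.
\<close>

definition binom :: "complex \<Rightarrow> int \<Rightarrow> nat \<Rightarrow> complex" where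
  "binom \<epsilon> n s = \<epsilon> ^ s * (of_int n gchoose s)"

lemma binom_0 [simp]: "binom \<epsilon> n 0 = 1"
  by (simp add: binom_def)

lemma binom_zero_Suc [simp]: "binom \<epsilon> 0 (Suc s) = 0"
  by (simp add: binom_def gbinomial_0)

lemma binom_Suc: "binom \<epsilon> (n + 1) (Suc s) = binom \<epsilon> n (Suc s) + \<epsilon> * binom \<epsilon> n s"
  using gbinomial_Suc_Suc[of "of_int n :: complex" s] by (simp add: binom_def algebra_simps)

text \<open>
  Think of \<open>D m n l\<close> as a coefficient of
  \<open>(x - y)\<^sup>m (y - w)\<^sup>n (x - w)\<^sup>l S\<close>; the recursion is \<open>x - w = (y - w) + (x - y)\<close>. Expanding by it, a product of total
  exponent \<open>M + N + L\<close> becomes a combination of terms in which \<open>m \<ge> M\<close>, or both \<open>n \<ge> N\<close> and \<open>l \<ge> L\<close>. The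
  outer induction lowers \<open>M - m\<close>; at a fixed \<open>m\<close>, exponents are moved between \<open>n\<close> and \<open>l\<close> until both are large.
\<close>

lemma triangular_recursion_zero:
  fixes D :: "int \<Rightarrow> int \<Rightarrow> int \<Rightarrow> 'w::ab_group_add"
  assumes rec: "\<And>m n l. n \<ge> 0 \<Longrightarrow> l \<ge> 0 \<Longrightarrow> D m n (l + 1) = D m (n + 1) l + D (m + 1) n l"
    and top: "\<And>m n l. m \<ge> M \<Longrightarrow> n \<ge> 0 \<Longrightarrow> l \<ge> 0 \<Longrightarrow> D m n l = 0"
    and corner: "\<And>m n l. n \<ge> N \<Longrightarrow> l \<ge> L \<Longrightarrow> D m n l = 0"
    and "N \<ge> 0" "L \<ge> 0" "n \<ge> 0" "l \<ge> 0" "m + n + l \<ge> M + N + L"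
  shows "D m n l = 0"
  using assms(6-)
proof (induction "nat (M - m)" arbitrary: m n l)
  case 0
  then show ?case using top by simp
next
  case (Suc k)
  have next_m: "D (m + 1) n' l' = 0" if "n' \<ge> 0" "l' \<ge> 0" "m + 1 + n' + l' \<ge> M + N + L" for n' l'
    using Suc.hyps(1)[of "m + 1" n' l'] Suc.hyps(2) that by simp
  show ?case
    using Suc.prems
  proof (induction "nat (L - l) + nat (N - n)" arbitrary: n l rule: less_induct)
    case less
    have m: "m < M" using Suc.hyps(2) by simp
    consider "l < L" | "n < N" | "l \<ge> L" "n \<ge> N" by linarith
    then show ?case
    proof cases
      case 1
      with m less.prems have n: "n > N" by linarith
      have "D m (n - 1) (l + 1) = D m n l + D (m + 1) (n - 1) l"
        using rec[of "n - 1" l m] n \<open>N \<ge> 0\<close> less.prems by simp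
      moreover have "D m (n - 1) (l + 1) = 0"
        by (rule less.hyps) (use 1 n \<open>N \<ge> 0\<close> less.prems in auto)
      moreover have "D (m + 1) (n - 1) l = 0"
        by (rule next_m) (use n \<open>N \<ge> 0\<close> less.prems in auto)
      ultimately show ?thesis by simp
    next
      case 2
      with m less.prems have l: "l > L" by linarith
      have "D m n l = D m (n + 1) (l - 1) + D (m + 1) n (l - 1)"
        using rec[of n "l - 1" m] l \<open>L \<ge> 0\<close> less.prems by simp
      moreover have "D m (n + 1) (l - 1) = 0"
        by (rule less.hyps) (use 2 l \<open>L \<ge> 0\<close> less.prems in auto)
      moreover have "D (m + 1) n (l - 1) = 0"
        by (rule next_m) (use l \<open>L \<ge> 0\<close> less.prems in auto)
      ultimately show ?thesis by simp
    qed (use corner in auto)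
  qed
qed

locale complex_vector_space = vector_space scale
  for scale :: "complex \<Rightarrow> 'w::ab_group_add \<Rightarrow> 'w" (infixr "\<cdot>" 75)
begin

text \<open>
  The recursion says that \<open>f (m + 1)\<close> is \<open>x + \<epsilon>y\<close> times \<open>f m\<close>, for modes \<open>i\<close>
  of \<open>x\<close> and \<open>j\<close> of \<open>y\<close>. Upwards from \<open>m\<^sub>0\<close> the recursion is explicit. Downwards one has to divide by
  \<open>x + \<epsilon>y\<close>, which is possible because the modes \<open>j\<close> are bounded above: the equation gives \<open>f m i j\<close> from
  \<open>f m (i - 1) (j + 1)\<close>, and \<open>j\<close> increases until \<open>f\<close> vanishes. Two expansions of the same
  expression are shown to agree in this form: as the zero difference for one exponent.
\<close>

lemma binomial_recursion_unique:
  fixes f :: "int \<Rightarrow> int \<Rightarrow> int \<Rightarrow> 'w"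
  assumes rec: "\<And>m i j. j \<ge> J \<Longrightarrow> f (m + 1) i j = f m (i + 1) j + \<epsilon> \<cdot> f m i (j + 1)"
    and base: "\<And>i j. j \<ge> J \<Longrightarrow> f m\<^sub>0 i j = 0"
    and trunc: "\<And>m. \<exists>K. \<forall>j\<ge>K. \<forall>i. f m i j = 0"
    and "j \<ge> J"
  shows "f m i j = 0"
  using \<open>j \<ge> J\<close>
proof (induction m arbitrary: i j rule: int_induct[where k = m\<^sub>0])
  case base
  then show ?case using assms(2) by simp
next
  case (step1 m)
  then show ?case using rec[of j m i] by simp
next
  case (step2 m)
  obtain K where K: "\<And>i j. j \<ge> K \<Longrightarrow> f (m - 1) i j = 0" using trunc by blast
  have "\<forall>i. \<forall>j\<ge>J. K - j \<le> int k \<longrightarrow> f (m - 1) i j = 0" for k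
  proof (induction k)
    case 0
    then show ?case using K by auto
  next
    case (Suc k)
    show ?case
    proof (intro allI impI)
      fix i j assume "J \<le> j" "K - j \<le> int (Suc k)"
      then have "f (m - 1) (i - 1) (j + 1) = 0" using Suc by simp
      moreover have "f (m - 1) i j = - (\<epsilon> \<cdot> f (m - 1) (i - 1) (j + 1))"
        using rec[OF \<open>J \<le> j\<close>, of "m - 1" "i - 1"] step2.IH[OF \<open>J \<le> j\<close>, of "i - 1"]
        by (simp add: eq_neg_iff_add_eq_0)
      ultimately show "f (m - 1) i j = 0" by simp
    qed
  qed
  from this[of "nat (K - j)"] show ?case using step2.prems by simp
qed

section \<open>Expansions of binomial powers\<close>

text \<open>
  The mode \<open>(i, j)\<close> of \<open>(x + \<epsilon>y)\<^sup>n F(x, y)\<close>, with the binomial expanded in nonnegative powers of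
  \<open>y\<close> and \<open>F i j\<close> the coefficient of \<open>x\<^sup>-\<^sup>i\<^sup>-\<^sup>1 y\<^sup>-\<^sup>j\<^sup>-\<^sup>1\<close>. The bound \<open>K\<close> stands for \<open>F i j = 0\<close>
  whenever \<open>j \<ge> K\<close>; it makes the sum finite.
\<close>

definition expand :: "complex \<Rightarrow> int \<Rightarrow> int \<Rightarrow> (int \<Rightarrow> int \<Rightarrow> 'w) \<Rightarrow> int \<Rightarrow> int \<Rightarrow> 'w" where
  "expand \<epsilon> K n F i j = (\<Sum>s<nat (K - j). binom \<epsilon> n s \<cdot> F (i + n - int s) (j + int s))"

lemma expand_Suc:
  "expand \<epsilon> K (n + 1) F i j = expand \<epsilon> K n F (i + 1) j + \<epsilon> \<cdot> expand \<epsilon> K n F i (j + 1)"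
proof (cases "nat (K - j)")
  case 0
  then show ?thesis by (simp add: expand_def)
next
  case (Suc k)
  have k: "nat (K - (j + 1)) = k" using Suc by simp
  have "expand \<epsilon> K (n + 1) F i j = F (i + n + 1) j +
     (\<Sum>s<k. binom \<epsilon> n (Suc s) \<cdot> F (i + n - int s) (j + 1 + int s) + \<epsilon> \<cdot> binom \<epsilon> n s \<cdot> F (i + n - int s) (j + 1 + int s))"
    unfolding expand_def Suc sum.lessThan_Suc_shift
    by (simp add: binom_Suc binom_Suc[unfolded add.commute[of _ 1]] scale_left_distrib algebra_simps)
  also have "\<dots> = expand \<epsilon> K n F (i + 1) j + \<epsilon> \<cdot> expand \<epsilon> K n F i (j + 1)"
    unfolding expand_def Suc k sum.lessThan_Suc_shift
    by (simp add: sum.distrib scale_sum_right algebra_simps)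
  finally show ?thesis .
qed

lemma expand_0: "expand \<epsilon> K 0 F i j = (if j < K then F i j else 0)"
proof (cases "nat (K - j)")
  case 0
  then show ?thesis by (simp add: expand_def)
next
  case (Suc k)
  then have "j < K" by simp
  then show ?thesis unfolding expand_def Suc sum.lessThan_Suc_shift by simp
qed

lemma expand_zero: "j \<ge> K \<Longrightarrow> expand \<epsilon> K n F i j = 0"
  by (simp add: expand_def)

lemma expand_cong:
  assumes "\<And>i' j'. j' \<ge> j \<Longrightarrow> j' < K \<Longrightarrow> F i' j' = G i' j'"
  shows "expand \<epsilon> K n F i j = expand \<epsilon> K n G i j"
  unfolding expand_def by (rule sum.cong) (use assms in auto)

lemma expand_eq_0:
  assumes "\<And>i' j'. j' \<ge> j \<Longrightarrow> j' < K \<Longrightarrow> F i' j' = 0"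
  shows "expand \<epsilon> K n F i j = 0"
  unfolding expand_def by (rule sum.neutral) (use assms in auto)

lemma expand_add: "expand \<epsilon> K n (\<lambda>i j. F i j + G i j) i j = expand \<epsilon> K n F i j + expand \<epsilon> K n G i j"
  by (simp add: expand_def sum.distrib scale_right_distrib)

lemma expand_diff: "expand \<epsilon> K n (\<lambda>i j. F i j - G i j) i j = expand \<epsilon> K n F i j - expand \<epsilon> K n G i j"
  by (simp add: expand_def sum_subtractf scale_right_diff_distrib)

lemma expand_scale: "expand \<epsilon> K n (\<lambda>i j. c \<cdot> F i j) i j = c \<cdot> expand \<epsilon> K n F i j"
  by (simp add: expand_def scale_sum_right ac_simps)

lemma expand_bound:
  assumes "\<And>i' j'. j' \<ge> K \<Longrightarrow> F i' j' = 0" "K \<le> K'"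
  shows "expand \<epsilon> K' n F i j = expand \<epsilon> K n F i j"
  unfolding expand_def
  by (rule sum.mono_neutral_right) (use assms in auto)

lemma expand_shift2: "expand \<epsilon> K n (\<lambda>i j. F i (j + d)) i j = expand \<epsilon> (K + d) n F i (j + d)"
  by (simp add: expand_def algebra_simps)

section \<open>Fields and their ordered products\<close>

definition lin :: "('w \<Rightarrow> 'w) \<Rightarrow> bool" where
  "lin f \<longleftrightarrow> (\<forall>x y. f (x + y) = f x + f y) \<and> (\<forall>c x. f (c \<cdot> x) = c \<cdot> f x)"

lemma lin_add: "lin f \<Longrightarrow> f (x + y) = f x + f y"
  and lin_scale: "lin f \<Longrightarrow> f (c \<cdot> x) = c \<cdot> f x"
  by (auto simp: lin_def)

lemma lin_0: "lin f \<Longrightarrow> f 0 = 0"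
  using lin_scale[of f 0 0] by simp

lemma lin_uminus: "lin f \<Longrightarrow> f (- x) = - f x"
  using lin_scale[of f "-1" x] by simp

lemma lin_diff: "lin f \<Longrightarrow> f (x - y) = f x - f y"
  using lin_add[of f x "- y"] by (simp add: lin_uminus)

lemma lin_sum: "lin f \<Longrightarrow> f (sum g S) = (\<Sum>x\<in>S. f (g x))"
  by (induction S rule: infinite_finite_induct) (auto simp: lin_0 lin_add)

lemma lin_expand: "lin f \<Longrightarrow> f (expand \<epsilon> K n F i j) = expand \<epsilon> K n (\<lambda>i j. f (F i j)) i j"
  by (simp add: expand_def lin_sum lin_scale)

definition vfield :: "(int \<Rightarrow> 'w \<Rightarrow> 'w) \<Rightarrow> bool" where
  "vfield A \<longleftrightarrow> (\<forall>n. lin (A n)) \<and> (\<forall>w. \<exists>N. \<forall>n\<ge>N. A n w = 0)"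

lemma vfield_lin: "vfield A \<Longrightarrow> lin (A n)"
  and vfield_trunc: "vfield A \<Longrightarrow> \<exists>N. \<forall>n\<ge>N. A n w = 0"
  by (auto simp: vfield_def)

text \<open>
  A single choice of truncation bound per vector makes the products below total functions of the fields;
  they do not depend on it, by \<open>ord_prod_eq\<close>.
\<close>

definition cutoff :: "(int \<Rightarrow> 'w \<Rightarrow> 'w) \<Rightarrow> 'w \<Rightarrow> int" where
  "cutoff A w = (SOME N. \<forall>n\<ge>N. A n w = 0)"

lemma cutoff: "vfield A \<Longrightarrow> n \<ge> cutoff A w \<Longrightarrow> A n w = 0"
  using someI_ex[OF vfield_trunc[of A w]] by (simp add: cutoff_def)

text \<open>
  The coefficient of \<open>x\<^sup>-\<^sup>p\<^sup>-\<^sup>1 y\<^sup>-\<^sup>q\<^sup>-\<^sup>1\<close> in \<open>(x - y)\<^sup>n A(x) B(y)\<close>, expanded where \<open>x\<close> dominates \<open>y\<close>.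
\<close>

definition ord_prod :: "int \<Rightarrow> (int \<Rightarrow> 'w \<Rightarrow> 'w) \<Rightarrow> (int \<Rightarrow> 'w \<Rightarrow> 'w) \<Rightarrow> int \<Rightarrow> int \<Rightarrow> 'w \<Rightarrow> 'w" where
  "ord_prod n A B p q w = expand (-1) (cutoff B w) n (\<lambda>i j. A i (B j w)) p q"

text \<open>
  The coefficient of \<open>x\<^sup>-\<^sup>p\<^sup>-\<^sup>1 y\<^sup>-\<^sup>q\<^sup>-\<^sup>1\<close> in \<open>(x - y)\<^sup>n A(x) B(y) - (- y + x)\<^sup>n B(y) A(x)\<close>, where
  each binomial is expanded in nonnegative powers of the variable of the inner field. For \<open>n = 0\<close> this is the
  commutator, for large \<open>n\<close> its vanishing is locality, and for \<open>p = 0\<close> (the residue in \<open>x\<close>) it is the field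
  \<open>A\<^sub>(\<^sub>n\<^sub>)B\<close>, the \<open>n\<close>-th product.
\<close>

definition comm :: "int \<Rightarrow> (int \<Rightarrow> 'w \<Rightarrow> 'w) \<Rightarrow> (int \<Rightarrow> 'w \<Rightarrow> 'w) \<Rightarrow> int \<Rightarrow> int \<Rightarrow> 'w \<Rightarrow> 'w" where
  "comm n A B p q w = ord_prod n A B p q w - ((-1) powi n) \<cdot> ord_prod n B A q p w"

lemma ord_prod_eq:
  assumes "vfield A" "vfield B" "\<And>n. n \<ge> K \<Longrightarrow> B n w = 0"
  shows "ord_prod n A B p q w = expand (-1) K n (\<lambda>i j. A i (B j w)) p q"
proof -
  have "expand (-1) (max K (cutoff B w)) n (\<lambda>i j. A i (B j w)) p q = expand (-1) K n (\<lambda>i j. A i (B j w)) p q"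
    by (rule expand_bound) (use assms in \<open>auto simp: lin_0 vfield_lin\<close>)
  moreover have "expand (-1) (max K (cutoff B w)) n (\<lambda>i j. A i (B j w)) p q = ord_prod n A B p q w"
    unfolding ord_prod_def
    by (rule expand_bound) (use assms in \<open>auto simp: lin_0 vfield_lin cutoff\<close>)
  ultimately show ?thesis by simp
qed

lemma ord_prod_Suc: "ord_prod (n + 1) A B p q w = ord_prod n A B (p + 1) q w - ord_prod n A B p (q + 1) w"
  unfolding ord_prod_def expand_Suc by simp

lemma ord_prod_0:
  assumes "vfield A" "vfield B"
  shows "ord_prod 0 A B p q w = A p (B q w)"
  unfolding ord_prod_def expand_0 using assms by (auto simp: lin_0 vfield_lin cutoff)

lemma ord_prod_zero:
  assumes "vfield A" "\<And>j. j \<ge> q \<Longrightarrow> B j w = 0"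
  shows "ord_prod n A B p q w = 0"
  unfolding ord_prod_def by (rule expand_eq_0) (use assms in \<open>auto simp: lin_0 vfield_lin\<close>)

lemma lin_ord_prod:
  assumes "vfield A" "vfield B"
  shows "lin (ord_prod n A B p q)"
  unfolding lin_def
proof (intro conjI allI)
  fix x y
  let ?K = "max (cutoff B x) (cutoff B y)"
  have *: "ord_prod n A B p q z = expand (-1) ?K n (\<lambda>i j. A i (B j z)) p q" if "z \<in> {x, y, x + y}" for z
    by (rule ord_prod_eq) (use that assms in \<open>auto simp: lin_add vfield_lin cutoff\<close>)
  show "ord_prod n A B p q (x + y) = ord_prod n A B p q x + ord_prod n A B p q y"
    using assms by (simp add: * lin_add vfield_lin expand_add)
next
  fix c x
  have "ord_prod n A B p q (c \<cdot> x) = expand (-1) (cutoff B x) n (\<lambda>i j. A i (B j (c \<cdot> x))) p q"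
    by (rule ord_prod_eq) (use assms in \<open>auto simp: lin_scale vfield_lin cutoff\<close>)
  then show "ord_prod n A B p q (c \<cdot> x) = c \<cdot> ord_prod n A B p q x"
    using assms by (simp add: ord_prod_def lin_scale vfield_lin expand_scale)
qed

lemma ord_prod_trunc_left:
  assumes "vfield A" "vfield B"
  shows "\<exists>N. \<forall>p\<ge>N. ord_prod n A B p q w = 0"
proof -
  let ?k = "nat (cutoff B w - q)"
  define N where "N = Max (insert 0 ((\<lambda>s. cutoff A (B (q + int s) w) - n + int s) ` {..<?k}))"
  have "ord_prod n A B p q w = 0" if "p \<ge> N" for p
    unfolding ord_prod_def expand_def
  proof (rule sum.neutral, rule ballI)
    fix s assume "s \<in> {..<?k}"
    then have "cutoff A (B (q + int s) w) - n + int s \<le> N"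
      unfolding N_def by (intro Max_ge) auto
    then have "A (p + n - int s) (B (q + int s) w) = 0"
      using cutoff[OF assms(1)] that by auto
    then show "binom (- 1) n s \<cdot> A (p + n - int s) (B (q + int s) w) = 0" by simp
  qed
  then show ?thesis by blast
qed

lemma ord_prod_trunc_right:
  assumes "vfield A" "vfield B"
  shows "\<exists>N. \<forall>q\<ge>N. \<forall>n p. ord_prod n A B p q w = 0"
  by (rule exI[of _ "cutoff B w"]) (auto intro!: ord_prod_zero simp: assms cutoff)

lemma vfield_ord_prod_right: "vfield A \<Longrightarrow> vfield B \<Longrightarrow> vfield (ord_prod n A B p)"
  unfolding vfield_def[of "ord_prod n A B p"] using lin_ord_prod ord_prod_trunc_right by meson

lemma vfield_ord_prod_left: "vfield A \<Longrightarrow> vfield B \<Longrightarrow> vfield (\<lambda>p. ord_prod n A B p q)"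
  unfolding vfield_def[of "\<lambda>p. ord_prod n A B p q"] using lin_ord_prod ord_prod_trunc_left by simp

lemma comm_Suc: "comm (n + 1) A B p q w = comm n A B (p + 1) q w - comm n A B p (q + 1) w"
proof -
  have "(- 1 :: complex) powi (n + 1) = - ((- 1) powi n)"
    by (simp add: power_int_add_1)
  then show ?thesis
    by (simp add: comm_def ord_prod_Suc scale_right_diff_distrib)
qed

lemma comm_0: "vfield A \<Longrightarrow> vfield B \<Longrightarrow> comm 0 A B p q w = A p (B q w) - B q (A p w)"
  by (simp add: comm_def ord_prod_0)

lemma comm_swap: "comm n B A q p w = - ((-1) powi n \<cdot> comm n A B p q w)"
  by (simp add: comm_def scale_right_diff_distrib flip: power_int_mult_distrib)

lemma lin_combine: "lin f \<Longrightarrow> lin g \<Longrightarrow> lin (\<lambda>x. f x - c \<cdot> g x)"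
  by (simp add: lin_def algebra_simps)

lemma lin_comm: "vfield A \<Longrightarrow> vfield B \<Longrightarrow> lin (comm n A B p q)"
  unfolding comm_def[abs_def] by (intro lin_combine lin_ord_prod)

lemma vfield_combine:
  assumes "vfield A" "vfield B" shows "vfield (\<lambda>n x. A n x - c \<cdot> B n x)"
  unfolding vfield_def
proof (intro conjI allI)
  show "lin (\<lambda>x. A n x - c \<cdot> B n x)" for n using assms by (intro lin_combine vfield_lin)
  show "\<exists>N. \<forall>n\<ge>N. A n w - c \<cdot> B n w = 0" for w
    by (rule exI[of _ "max (cutoff A w) (cutoff B w)"]) (simp add: cutoff assms)
qed

lemma vfield_comm_right: "vfield A \<Longrightarrow> vfield B \<Longrightarrow> vfield (comm n A B p)"
  unfolding comm_def[abs_def] by (intro vfield_combine vfield_ord_prod_left vfield_ord_prod_right)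


section \<open>Locality and the lemma of Dong\<close>

text \<open>
  Multiplication by \<open>x + \<epsilon>y\<close> in terms of modes.
\<close>

definition step :: "complex \<Rightarrow> (int \<Rightarrow> int \<Rightarrow> 'w) \<Rightarrow> int \<Rightarrow> int \<Rightarrow> 'w" where
  "step \<epsilon> F p q = F (p + 1) q + \<epsilon> \<cdot> F p (q + 1)"

lemma step_pow_Suc:
  "(step \<epsilon> ^^ Suc k) F p q = (step \<epsilon> ^^ k) F (p + 1) q + \<epsilon> \<cdot> (step \<epsilon> ^^ k) F p (q + 1)"
  by (simp add: step_def)

lemma step_pow_combine:
  "(step \<epsilon> ^^ k) (\<lambda>p q. F p q - c \<cdot> G p q) p q = (step \<epsilon> ^^ k) F p q - c \<cdot> (step \<epsilon> ^^ k) G p q"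
proof (induction k arbitrary: p q)
  case (Suc k)
  show ?case unfolding step_pow_Suc Suc.IH by (simp add: algebra_simps)
qed simp

lemma step_pow_relation:
  assumes "\<And>p q. H p q = F (p + a) (q + b) + c \<cdot> G (p + a') (q + b')"
  shows "(step \<epsilon> ^^ k) H p q = (step \<epsilon> ^^ k) F (p + a) (q + b) + c \<cdot> (step \<epsilon> ^^ k) G (p + a') (q + b')"
proof (induction k arbitrary: p q)
  case 0
  then show ?case using assms by simp
next
  case (Suc k)
  show ?case unfolding step_pow_Suc Suc.IH by (simp add: algebra_simps)
qed

text \<open>
  Multiplication by \<open>x - y\<close> commutes with multiplication by powers of \<open>x + \<epsilon>w\<close> and \<open>y + \<delta>w\<close>; the
  modes of \<open>x, y, w\<close> are \<open>i, j, q\<close>.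
\<close>

lemma step_pow_nested_diff:
  assumes "\<And>i j q. H i j q = F (i + 1) j q - F i (j + 1) q"
  shows "(step \<epsilon> ^^ l) (\<lambda>i q. (step \<delta> ^^ n) (\<lambda>j q. H i j q) j q) i q =
    (step \<epsilon> ^^ l) (\<lambda>i q. (step \<delta> ^^ n) (\<lambda>j q. F i j q) j q) (i + 1) q
    - (step \<epsilon> ^^ l) (\<lambda>i q. (step \<delta> ^^ n) (\<lambda>j q. F i j q) (j + 1) q) i q"
proof -
  have H: "H i p q = F (i + 1) (p + 0) (q + 0) + (-1) \<cdot> F i (p + 1) (q + 0)" for i p q
    by (simp add: assms)
  have "(step \<delta> ^^ n) (\<lambda>j q. H i j q) j q =
      (step \<delta> ^^ n) (\<lambda>j q. F (i + 1) j q) j q - (step \<delta> ^^ n) (\<lambda>j q. F i j q) (j + 1) q" for i j q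
    using step_pow_relation[where F = "F (i + 1)" and G = "F i" and H = "H i"
        and a = 0 and b = 0 and c = "-1" and a' = 1 and b' = 0, OF H] by simp
  then show ?thesis
    using step_pow_relation[where H = "\<lambda>i q. (step \<delta> ^^ n) (\<lambda>j q. H i j q) j q"
        and F = "\<lambda>i q. (step \<delta> ^^ n) (\<lambda>j q. F i j q) j q"
        and G = "\<lambda>i q. (step \<delta> ^^ n) (\<lambda>j q. F i j q) (j + 1) q"
        and a = 1 and b = 0 and c = "-1" and a' = 0 and b' = 0] by simp
qed

lemma step_pow_add:
  "(step \<epsilon> ^^ k) (\<lambda>p q. F p q + G p q) p q = (step \<epsilon> ^^ k) F p q + (step \<epsilon> ^^ k) G p q"
  using step_pow_combine[where c = "-1"] by simp

lemma step_pow_cong: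
  assumes "\<And>p' q'. p' \<ge> p \<Longrightarrow> q' \<ge> q \<Longrightarrow> F p' q' = G p' q'"
  shows "(step \<epsilon> ^^ k) F p q = (step \<epsilon> ^^ k) G p q"
  using assms by (induction k arbitrary: p q) (simp_all add: step_pow_Suc del: funpow.simps(2))

lemma step_pow_0 [simp]: "(step \<epsilon> ^^ k) (\<lambda>p q. 0) p q = 0"
  by (induction k arbitrary: p q) (simp_all add: step_pow_Suc del: funpow.simps(2))

lemma step_pow_zero:
  assumes "\<And>p' q'. p' \<ge> p \<Longrightarrow> q' \<ge> q \<Longrightarrow> F p' q' = 0"
  shows "(step \<epsilon> ^^ k) F p q = 0"
  using step_pow_cong[where G = "\<lambda>_ _. 0"] assms by simp

lemma step_pow_shift2: "(step \<epsilon> ^^ k) (\<lambda>p q. F p (q + d)) p q = (step \<epsilon> ^^ k) F p (q + d)"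
  by (induction k arbitrary: p q) (simp_all add: step_pow_Suc algebra_simps del: funpow.simps(2))

lemma step_pow_lin:
  "lin f \<Longrightarrow> f ((step \<epsilon> ^^ k) F p q) = (step \<epsilon> ^^ k) (\<lambda>p q. f (F p q)) p q"
  by (induction k arbitrary: p q) (simp_all add: step_pow_Suc lin_add lin_scale del: funpow.simps(2))

lemma step_pow_trunc:
  assumes "\<And>p. \<exists>K. \<forall>q\<ge>K. \<forall>x. F x p q = 0"
  shows "\<exists>K. \<forall>q\<ge>K. \<forall>x. (step \<epsilon> ^^ k) (F x) p q = 0"
proof (induction k arbitrary: p)
  case 0
  then show ?case using assms by simp
next
  case (Suc k)
  obtain K1 K2 where "\<forall>q\<ge>K1. \<forall>x. (step \<epsilon> ^^ k) (F x) p q = 0" "\<forall>q\<ge>K2. \<forall>x. (step \<epsilon> ^^ k) (F x) (p + 1) q = 0"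
    using Suc by meson
  then show ?case
    by (intro exI[of _ "max K1 K2"]) (simp add: step_pow_Suc del: funpow.simps(2))
qed

lemma step_pow_trunc1:
  assumes "\<And>q. \<exists>K. \<forall>p\<ge>K. \<forall>x. F x p q = 0"
  shows "\<exists>K. \<forall>p\<ge>K. \<forall>x. (step \<epsilon> ^^ k) (F x) p q = 0"
proof (induction k arbitrary: q)
  case 0
  then show ?case using assms by simp
next
  case (Suc k)
  obtain K1 K2 where "\<forall>p\<ge>K1. \<forall>x. (step \<epsilon> ^^ k) (F x) p q = 0" "\<forall>p\<ge>K2. \<forall>x. (step \<epsilon> ^^ k) (F x) p (q + 1) = 0"
    using Suc by meson
  then show ?case
    by (intro exI[of _ "max K1 K2"]) (simp add: step_pow_Suc del: funpow.simps(2))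
qed

text \<open>
  All expansions of powers of \<open>x + \<epsilon>y\<close> satisfy this recursion, so they are related to each other by honest
  multiplication, without reference to the region of expansion.
\<close>

lemma step_pow_rec:
  assumes "\<And>m p q. f (m + 1) p q = f m (p + 1) q + \<epsilon> \<cdot> f m p (q + 1)"
  shows "f (m + int k) p q = (step \<epsilon> ^^ k) (f m) p q"
proof (induction k arbitrary: p q)
  case (Suc k)
  have "f (m + int (Suc k)) p q = f (m + int k) (p + 1) q + \<epsilon> \<cdot> f (m + int k) p (q + 1)"
    using assms[of "m + int k"] by (simp add: algebra_simps)
  then show ?case by (simp add: Suc.IH step_pow_Suc del: funpow.simps(2))
qed simp

lemma step_pow_swap:
  "(step \<epsilon> ^^ i) (\<lambda>l q. (step \<delta> ^^ j) (\<lambda>n q. F l n q) n q) l q =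
   (step \<delta> ^^ j) (\<lambda>n q. (step \<epsilon> ^^ i) (\<lambda>l q. F l n q) l q) n q"
proof (induction i arbitrary: l q)
  case 0
  then show ?case by simp
next
  case (Suc i)
  have "(step \<epsilon> ^^ Suc i) (\<lambda>l q. (step \<delta> ^^ j) (\<lambda>n q. F l n q) n q) l q =
    (step \<delta> ^^ j) (\<lambda>n q. (step \<epsilon> ^^ i) (\<lambda>l q. F l n q) (l + 1) q) n q +
    \<epsilon> \<cdot> (step \<delta> ^^ j) (\<lambda>n q. (step \<epsilon> ^^ i) (\<lambda>l q. F l n q) l q) n (q + 1)"
    by (simp add: step_pow_Suc Suc.IH del: funpow.simps(2))
  also have "\<dots> = (step \<delta> ^^ j) (\<lambda>n q. (step \<epsilon> ^^ i) (\<lambda>l q. F l n q) (l + 1) q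
       - (- \<epsilon>) \<cdot> (step \<epsilon> ^^ i) (\<lambda>l q. F l n q) l (q + 1)) n q"
    unfolding step_pow_combine
      step_pow_shift2[where F = "\<lambda>n q. (step \<epsilon> ^^ i) (\<lambda>l q. F l n q) l q"] by simp
  also have "\<dots> = (step \<delta> ^^ j) (\<lambda>n q. (step \<epsilon> ^^ Suc i) (\<lambda>l q. F l n q) l q) n q"
    by (simp add: step_pow_Suc del: funpow.simps(2))
  finally show ?case .
qed

lemma comm_step_pow: "comm (m + int k) A B p q w = (step (-1) ^^ k) (\<lambda>p q. comm m A B p q w) p q"
  by (rule step_pow_rec[where f = "\<lambda>m p q. comm m A B p q w"]) (simp add: comm_Suc)

definition local_order :: "int \<Rightarrow> (int \<Rightarrow> 'w \<Rightarrow> 'w) \<Rightarrow> (int \<Rightarrow> 'w \<Rightarrow> 'w) \<Rightarrow> bool" where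
  "local_order N A B \<longleftrightarrow> (\<forall>n\<ge>N. \<forall>p q w. comm n A B p q w = 0)"

lemma local_order_sym: "local_order N A B \<Longrightarrow> local_order N B A"
  unfolding local_order_def by (metis comm_swap scale_zero_right neg_0_equal_iff_equal)

text \<open>
  The easy half of Dong's lemma: \<open>(x - w)\<^sup>l (y - w)\<^sup>n\<close> annihilates \<open>[(x - y)\<^sup>m A(x) B(y), V(w)]\<close> for
  every \<open>m\<close>. For \<open>m = 0\<close> this is the Leibniz rule for \<open>[A B, V]\<close>, and passing from \<open>m\<close> to
  \<open>m + 1\<close> multiplies by \<open>x - y\<close>, so the other \<open>m\<close> follow by uniqueness.
\<close>

lemma ord_prod_bracket_local:
  assumes "vfield A" "vfield B" "vfield V" "local_order L A V" "local_order N B V" "int n \<ge> N" "int l \<ge> L"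
  shows "(step (-1) ^^ l) (\<lambda>i q. (step (-1) ^^ n) (\<lambda>j q. ord_prod m A B i j (V q w) - V q (ord_prod m A B i j w)) j q) i q = 0"
    (is "?f m i j = 0")
proof (rule binomial_recursion_unique[where f = ?f and m\<^sub>0 = 0 and \<epsilon> = "-1" and J = j])
  let ?Z = "\<lambda>m i j q. ord_prod m A B i j (V q w) - V q (ord_prod m A B i j w)"
  note [simp] = lin_0[OF vfield_lin] lin_diff[OF vfield_lin] lin_ord_prod vfield_lin assms(1,2,3)
  show "?f (m + 1) i j = ?f m (i + 1) j + (-1) \<cdot> ?f m i (j + 1)" for m i j
    using step_pow_nested_diff[where H = "?Z (m + 1)" and F = "?Z m"] by (simp add: ord_prod_Suc)
  show "\<exists>K. \<forall>j\<ge>K. \<forall>i. ?f m i j = 0" for m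
  proof -
    have "\<exists>K. \<forall>j\<ge>K. \<forall>i. ?Z m i j q = 0" for q
      by (intro exI[of _ "max (cutoff B w) (cutoff B (V q w))"]) (simp add: ord_prod_zero cutoff)
    from step_pow_trunc1[of "\<lambda>i j q. ?Z m i j q", OF this]
    have tr: "\<exists>K. \<forall>j\<ge>K. \<forall>i. (step (-1) ^^ n) (\<lambda>j q. ?Z m i j q) j q = 0" for q .
    have "\<exists>K. \<forall>j\<ge>K. \<forall>x\<in>S. \<forall>i. (step (-1) ^^ n) (\<lambda>j q. ?Z m i j q) j x = 0" if "finite S" for S
      using that
    proof (induction S rule: finite_induct)
      case (insert x S)
      then obtain K1 K2 where "\<forall>j\<ge>K1. \<forall>x\<in>S. \<forall>i. (step (-1) ^^ n) (\<lambda>j q. ?Z m i j q) j x = 0"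
        "\<forall>j\<ge>K2. \<forall>i. (step (-1) ^^ n) (\<lambda>j q. ?Z m i j q) j x = 0" using tr by meson
      then show ?case by (intro exI[of _ "max K1 K2"]) auto
    qed simp
    from this[of "{q..q + int l}"] obtain K where
      "\<forall>j\<ge>K. \<forall>x\<in>{q..q + int l}. \<forall>i. (step (-1) ^^ n) (\<lambda>j q. ?Z m i j q) j x = 0" by blast
    then have K: "(step (-1) ^^ n) (\<lambda>j q. ?Z m i j q) j x = 0" if "j \<ge> K" "q \<le> x" "x \<le> q + int l" for j x i
      using that by simp
    have "(step (-1) ^^ l') (\<lambda>i q. (step (-1) ^^ n) (\<lambda>j q. ?Z m i j q) j q) i q' = 0"
      if "j \<ge> K" "q' \<ge> q" "q' + int l' \<le> q + int l" for i j l' q'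
      using that by (induction l' arbitrary: i q') (simp_all add: K step_pow_Suc del: funpow.simps(2))
    from this[of _ q l] show ?thesis by (intro exI[of _ K]) simp
  qed
  show "?f 0 i j = 0" for i j
  proof -
    have Z: "?Z 0 i j q = A i (comm 0 B V j q w) + comm 0 A V i q (B j w)" for i j q
      by (simp add: ord_prod_0 comm_0)
    have 1: "(step (-1) ^^ n) (\<lambda>j q. A i (comm 0 B V j q w)) j q = 0" for i j q
      using comm_step_pow[of 0 n B V j q w] assms(5,6)
      by (simp add: step_pow_lin[of "A i", symmetric] local_order_def)
    have 2: "(step (-1) ^^ l) (\<lambda>i q. comm 0 A V i q (B j w)) i q = 0" for i j q
      using comm_step_pow[of 0 l A V i q] assms(4,7) by (simp add: local_order_def)
    show ?thesis
      by (simp add: Z step_pow_add 1 step_pow_swap[of l _ n] 2)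
  qed
qed simp

text \<open>
  With \<open>D m n l\<close> the coefficients of
  \<open>(x - w)\<^sup>l (y - w)\<^sup>n\<close> times the commutator of \<open>comm m A B\<close> with \<open>V\<close>, locality of \<open>A, B\<close> kills
  \<open>m \<ge> M\<close>, the previous lemma kills \<open>l \<ge> L, n \<ge> N\<close>, and \<open>x - w = (x - y) + (y - w)\<close> reduces the claim to
  these cases. Taking the mode \<open>0\<close> of \<open>x\<close> with \<open>l = 0\<close> gives the \<open>m\<close>-th product.
\<close>

lemma Dong:
  assumes "vfield A" "vfield B" "vfield V" "local_order M A B" "local_order L A V" "local_order N B V" "N \<ge> 0" "L \<ge> 0"
    "K \<ge> 0" "K + m \<ge> M + N + L"
  shows "local_order K (comm m A B 0) V"
  unfolding local_order_def
proof (intro allI impI)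
  fix n p q w assume "n \<ge> K"
  define D where "D m n l i j q = (step (-1) ^^ nat l) (\<lambda>i q. (step (-1) ^^ nat n)
     (\<lambda>j q. comm m A B i j (V q w) - V q (comm m A B i j w)) j q) i q" for m n l i j q
  note [simp] = lin_0[OF vfield_lin] lin_diff[OF vfield_lin] lin_scale[OF vfield_lin] assms(1,2,3)
  have nat1: "nat (k + 1) = Suc (nat k)" if "k \<ge> 0" for k using that by simp
  have D_l: "D m n (l + 1) i j q = D m n l (i + 1) j q - D m n l i j (q + 1)" if "l \<ge> 0" for m n l i j q
    unfolding D_def nat1[OF that] step_pow_Suc by simp
  have D_n: "D m (n + 1) l i j q = D m n l i (j + 1) q - D m n l i j (q + 1)" if "n \<ge> 0" for m n l i j q
  proof -
    let ?G = "\<lambda>i j q. (step (-1) ^^ nat n) (\<lambda>j q. comm m A B i j (V q w) - V q (comm m A B i j w)) j q"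
    show ?thesis
      using step_pow_relation[where H = "\<lambda>i q. ?G i (j + 1) q - ?G i j (q + 1)"
          and F = "\<lambda>i q. ?G i (j + 1) q" and G = "\<lambda>i q. ?G i j q"
          and a = 0 and b = 0 and c = "-1" and a' = 0 and b' = 1]
      unfolding D_def nat1[OF that] step_pow_Suc by simp
  qed
  have D_m: "D (m + 1) n l i j q = D m n l (i + 1) j q - D m n l i (j + 1) q" for m n l i j q
    unfolding D_def by (rule step_pow_nested_diff) (simp add: comm_Suc)
  have "D m n 0 0 p q = 0"
  proof (rule triangular_recursion_zero[where D = "\<lambda>m n l. D m n l 0 p q" and M = M and N = N and L = L])
    show "D m n (l + 1) 0 p q = D m (n + 1) l 0 p q + D (m + 1) n l 0 p q" if "n \<ge> 0" "l \<ge> 0" for m n l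
      using that by (simp add: D_l D_n D_m)
    show "D m n l 0 p q = 0" if "m \<ge> M" for m n l
      using assms(4) that by (simp add: D_def local_order_def)
    show "D m n l 0 p q = 0" if "n \<ge> N" "l \<ge> L" for m n l
    proof -
      have Z: "comm m A B i j (V q w) - V q (comm m A B i j w) =
         (ord_prod m A B i j (V q w) - V q (ord_prod m A B i j w)) -
         (-1) powi m \<cdot> (ord_prod m B A j i (V q w) - V q (ord_prod m B A j i w))" for i j q
        by (simp add: comm_def algebra_simps)
      show ?thesis
        using ord_prod_bracket_local[OF assms(1,2,3,5,6), of "nat n" "nat l" m w p 0 q] that assms(7,8)
          ord_prod_bracket_local[OF assms(2,1,3,6,5), of "nat l" "nat n" m w 0 p q]
          step_pow_swap[where i = "nat n" and j = "nat l" and l = p and n = 0 and q = q and \<epsilon> = "-1" and \<delta> = "-1"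
            and F = "\<lambda>j i q. ord_prod m B A j i (V q w) - V q (ord_prod m B A j i w)"]
        unfolding D_def Z step_pow_combine by simp
    qed
  qed (use assms(7-) \<open>n \<ge> K\<close> in auto)
  then have "(step (-1) ^^ nat n) (\<lambda>j q. comm 0 (comm m A B 0) V j q w) p q = 0"
    by (simp add: D_def comm_0 vfield_comm_right)
  then show "comm n (comm m A B 0) V p q w = 0"
    using comm_step_pow[of 0 "nat n" "comm m A B 0" V p q w] \<open>n \<ge> K\<close> assms(9) by simp
qed


section \<open>Weak associativity of products\<close>

text \<open>
  The expansion of \<open>(x - w)\<^sup>l (y - w)\<^sup>n F(x, y, w)\<close> in nonnegative powers of \<open>w\<close>; the modes of
  \<open>x, y, w\<close> are \<open>i, j, q\<close>.
\<close>

definition expand3 :: "int \<Rightarrow> int \<Rightarrow> int \<Rightarrow> (int \<Rightarrow> int \<Rightarrow> int \<Rightarrow> 'w) \<Rightarrow> int \<Rightarrow> int \<Rightarrow> int \<Rightarrow> 'w" where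
  "expand3 K n l F i j q = expand (-1) K l (\<lambda>i q. expand (-1) K n (\<lambda>j q. F i j q) j q) i q"

lemma expand_relation:
  assumes "\<And>p q. H p q = F (p + a) q + c \<cdot> G (p + a') q"
  shows "expand \<epsilon> K n H p q = expand \<epsilon> K n F (p + a) q + c \<cdot> expand \<epsilon> K n G (p + a') q"
  unfolding expand_def assms
  by (simp add: scale_right_distrib sum.distrib scale_sum_right algebra_simps)

lemma expand3_zero: "q \<ge> K \<Longrightarrow> expand3 K n l F i j q = 0"
  by (simp add: expand3_def expand_zero)

lemma expand3_l: "expand3 K n (l + 1) F i j q = expand3 K n l F (i + 1) j q - expand3 K n l F i j (q + 1)"
  unfolding expand3_def expand_Suc by simp

lemma expand3_n: "expand3 K (n + 1) l F i j q = expand3 K n l F i (j + 1) q - expand3 K n l F i j (q + 1)"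
proof -
  let ?G = "\<lambda>j i q. expand (-1) K n (F i) j q"
  have "expand (-1) K l (\<lambda>i q. ?G j i (q + 1)) i q = expand (-1) K l (?G j) i (q + 1)"
    unfolding expand_shift2[where F = "?G j" and d = 1]
    by (rule expand_bound) (auto simp: expand_zero)
  then show ?thesis
    unfolding expand3_def expand_Suc[of _ _ n]
    using expand_relation[where H = "\<lambda>i q. ?G (j + 1) i q + (-1) \<cdot> ?G j i (q + 1)" and F = "?G (j + 1)"
      and G = "\<lambda>i q. ?G j i (q + 1)" and a = 0 and a' = 0 and c = "-1"] by simp
qed

lemma expand3_combine:
  "expand3 K n l (\<lambda>i j q. F i j q - c \<cdot> G i j q) i j q = expand3 K n l F i j q - c \<cdot> expand3 K n l G i j q"
proof -
  have "expand (-1) K n (\<lambda>j q. F i j q - c \<cdot> G i j q) j q =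
    expand (-1) K n (F i) j q - c \<cdot> expand (-1) K n (G i) j q" for i q
    using expand_relation[where H = "\<lambda>j q. F i j q - c \<cdot> G i j q" and F = "F i" and G = "G i"
      and a = 0 and a' = 0 and c = "- c"] by simp
  then have "expand (-1) K l (\<lambda>i q. expand (-1) K n (\<lambda>j q. F i j q - c \<cdot> G i j q) j q) i q =
    expand (-1) K l (\<lambda>i q. expand (-1) K n (F i) j q) (i + 0) q
    + (- c) \<cdot> expand (-1) K l (\<lambda>i q. expand (-1) K n (G i) j q) (i + 0) q"
    by (intro expand_relation) simp
  then show ?thesis by (simp add: expand3_def)
qed

lemma expand3_m:
  assumes "\<And>i j q. H i j q = F (i + 1) j q - F i (j + 1) q"
  shows "expand3 K n l H i j q = expand3 K n l F (i + 1) j q - expand3 K n l F i (j + 1) q"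
proof -
  have 1: "expand (-1) K n (H i) j q = expand (-1) K n (F (i + 1)) j q - expand (-1) K n (F i) (j + 1) q" for i j q
    unfolding expand_def by (simp add: assms scale_right_diff_distrib sum_subtractf algebra_simps)
  show ?thesis
  proof -
    have "expand (-1) K l (\<lambda>i q. expand (-1) K n (H i) j q) i q =
      expand (-1) K l (\<lambda>i q. expand (-1) K n (F i) j q) (i + 1) q
      + (-1) \<cdot> expand (-1) K l (\<lambda>i q. expand (-1) K n (F i) (j + 1) q) (i + 0) q"
      by (rule expand_relation) (simp add: 1)
    then show ?thesis by (simp add: expand3_def)
  qed
qed

text \<open>
  Both binomials are expanded in powers of the same variable \<open>w\<close>, so their order is immaterial.
\<close>

lemma expand3_swap: "expand3 K n l F i j q = expand3 K l n (\<lambda>j i q. F i j q) j i q"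
proof -
  let ?f = "\<lambda>l i q. expand3 K n l F i j q - expand3 K l n (\<lambda>j i q. F i j q) j i q"
  have "?f l i q = 0"
  proof (rule binomial_recursion_unique[where f = ?f and m\<^sub>0 = 0 and \<epsilon> = "-1" and J = q])
    show "?f (l + 1) i q = ?f l (i + 1) q + (-1) \<cdot> ?f l i (q + 1)" for l i q
      by (simp add: expand3_l expand3_n)
    show "?f 0 i q = 0" for i q
      unfolding expand3_def by (auto simp: expand_0 expand_zero intro!: expand_cong)
    show "\<exists>K. \<forall>j\<ge>K. \<forall>i. ?f l i j = 0" for l
      by (intro exI[of _ K]) (simp add: expand3_zero)
  qed simp
  then show ?thesis by simp
qed

lemma expand3_trunc:
  assumes "\<And>q. \<exists>J. \<forall>j\<ge>J. \<forall>i. F i j q = 0"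
  shows "\<exists>J. \<forall>j\<ge>J. \<forall>i. expand3 K n l F i j q = 0"
proof -
  obtain J where J: "\<And>q i j. j \<ge> J q \<Longrightarrow> F i j q = 0" using assms by metis
  define N where "N = Max (insert 0 ((\<lambda>s. J (q + int s) - n + int s) ` {..<nat (K - q)}))"
  have N: "J (q + int s) - n + int s \<le> N" if "s < nat (K - q)" for s
    unfolding N_def using that by (intro Max_ge) auto
  have "expand3 K n l F i j q = 0" if "j \<ge> N" for i j
    unfolding expand3_def
  proof (rule expand_eq_0)
    fix i' q' assume q': "q \<le> q'" "q' < K"
    show "expand (-1) K n (\<lambda>j q. F i' j q) j q' = 0"
      unfolding expand_def
    proof (intro sum.neutral ballI)
      fix s assume "s \<in> {..<nat (K - q')}"
      then have "J (q' + int s) - n + int (nat (q' - q) + s) \<le> N"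
        using N[of "nat (q' - q) + s"] q' by auto
      then have "F i' (j + n - int s) (q' + int s) = 0"
        using that q' by (intro J) auto
      then show "binom (- 1) n s \<cdot> F i' (j + n - int s) (q' + int s) = 0" by simp
    qed
  qed
  then show ?thesis by blast
qed

text \<open>
  A field \<open>A\<close> is weakly associative at \<open>x, w\<close> when \<open>(z + y)\<^sup>i Y(A(z)x; y)w\<close> is
  \<open>(z + y)\<^sup>i A(z + y) Y(x; y)w\<close>; in modes this is the hypothesis on \<open>A\<close>, with \<open>y3\<close> in place of
  \<open>Y\<close> on the left and \<open>y1\<close> on the right. The claim is the same statement for two fields at once, with
  \<open>(x - y)\<^sup>m A(x) B(y)\<close> in place of \<open>A\<close>. For \<open>m = 0\<close> it is the composition of the two
  hypotheses, and the recursion in \<open>m\<close> holds on both sides, since the difference of \<open>z\<^sub>1 + y\<close> and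
  \<open>z\<^sub>2 + y\<close> is \<open>z\<^sub>1 - z\<^sub>2\<close>.
\<close>

lemma weak_assoc_ordered:
  assumes A: "vfield A" and B: "vfield B" and V: "vfield V" and y1: "\<And>x. vfield (y1 x)" and y3: "\<And>q w. lin (\<lambda>x. y3 x q w)"
    and y1_lin: "\<And>q w. lin (\<lambda>x. y1 x q w)"
    and HA: "\<And>x l i q. int i \<ge> I \<Longrightarrow> (step 1 ^^ i) (\<lambda>l q. y3 (A l x) q w) l q = ord_prod l A (y1 x) (int i) q w"
    and HB: "\<And>n j q. int j \<ge> J \<Longrightarrow> (step 1 ^^ j) (\<lambda>n q. y1 (B n v) q w) n q = ord_prod n B V (int j) q w"
    and J: "J \<ge> 0" and i: "int i \<ge> I" and j: "int j \<ge> J"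
  shows "expand3 (cutoff V w) n l (\<lambda>i j q. ord_prod m A B i j (V q w)) (int i) (int j) q =
     (step 1 ^^ i) (\<lambda>l q. (step 1 ^^ j) (\<lambda>n q. y3 (ord_prod m A B l n v) q w) n q) l q"
proof -
  define K where "K = cutoff V w"
  note [simp] = lin_0[OF vfield_lin] lin_diff[OF vfield_lin] A B V y1 lin_0[OF y3] lin_diff[OF y3]
     lin_0[OF y1_lin]
  define L where "L m n l i j q = expand3 K n l (\<lambda>i j q. ord_prod m A B i j (V q w)) i j q" for m n l i j q
  define R where "R m l n q = (step 1 ^^ i) (\<lambda>l q. (step 1 ^^ j) (\<lambda>n q. y3 (ord_prod m A B l n v) q w) n q) l q" for m l n q
  have L_l: "L m n (l + 1) i j q = L m n l (i + 1) j q - L m n l i j (q + 1)" for m n l i j q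
    unfolding L_def by (rule expand3_l)
  have L_n: "L m (n + 1) l i j q = L m n l i (j + 1) q - L m n l i j (q + 1)" for m n l i j q
    unfolding L_def by (rule expand3_n)
  have L_m: "L (m + 1) n l i j q = L m n l (i + 1) j q - L m n l i (j + 1) q" for m n l i j q
    unfolding L_def by (rule expand3_m) (simp add: ord_prod_Suc)
  have R_m: "R (m + 1) l n q = R m (l + 1) n q - R m l (n + 1) q" for m l n q
    unfolding R_def by (rule step_pow_nested_diff) (simp add: ord_prod_Suc)
  have ordBV: "ord_prod n B V j q w = expand (-1) K n (\<lambda>j q. B j (V q w)) j q" for n j q
    by (simp add: ord_prod_def K_def)
  have L0: "L 0 n l i j q = expand (-1) K l (\<lambda>i q. A i (ord_prod n B V j q w)) i q" for n l i j q
    by (simp add: L_def expand3_def ord_prod_0 ordBV lin_expand vfield_lin)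
  have R0: "R 0 l n q = L 0 n l (int i) (int j) q" for l n q
  proof -
    have "R 0 l n q = (step 1 ^^ j) (\<lambda>n q. (step 1 ^^ i) (\<lambda>l q. y3 (A l (B n v)) q w) l q) n q"
      unfolding R_def by (subst step_pow_swap) (simp add: ord_prod_0)
    also have "\<dots> = (step 1 ^^ j) (\<lambda>n q. ord_prod l A (y1 (B n v)) (int i) q w) n q"
      using HA[OF i] by simp
    also have "\<dots> = L 0 n l (int i) (int j) q"
    proof -
      let ?f = "\<lambda>l i q. (step 1 ^^ j) (\<lambda>n q. ord_prod l A (y1 (B n v)) i q w) n q - L 0 n l i (int j) q"
      have "?f l i q = 0" for i
      proof (rule binomial_recursion_unique[where f = ?f and m\<^sub>0 = 0 and \<epsilon> = "-1" and J = q])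
        show "?f (l + 1) i q = ?f l (i + 1) q + (-1) \<cdot> ?f l i (q + 1)" for l i q
          using step_pow_relation[where H = "\<lambda>n q. ord_prod (l + 1) A (y1 (B n v)) i q w"
            and F = "\<lambda>n q. ord_prod l A (y1 (B n v)) (i + 1) q w" and G = "\<lambda>n q. ord_prod l A (y1 (B n v)) i q w"
            and a = 0 and b = 0 and c = "-1" and a' = 0 and b' = 1]
          by (simp add: L_l ord_prod_Suc)
        show "?f 0 i q = 0" for i q
        proof -
          have "(step 1 ^^ j) (\<lambda>n q. A i (y1 (B n v) q w)) n q = A i (ord_prod n B V (int j) q w)"
            by (simp flip: HB[OF j] add: step_pow_lin vfield_lin)
          moreover have "ord_prod n B V (int j) q w = 0" if "q \<ge> K"
            using that by (simp add: ordBV expand_zero)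
          ultimately show ?thesis by (simp add: L0 ord_prod_0 expand_0)
        qed
        show "\<exists>K. \<forall>j\<ge>K. \<forall>i. ?f l i j = 0" for l
        proof -
          have "\<exists>K. \<forall>q\<ge>K. \<forall>i. ord_prod l A (y1 (B n v)) i q w = 0" for n
            using ord_prod_trunc_right[of A "y1 (B n v)" w] by auto
          from step_pow_trunc[of "\<lambda>i n q. ord_prod l A (y1 (B n v)) i q w", OF this]
          obtain K' where "\<forall>q\<ge>K'. \<forall>i. (step 1 ^^ j) (\<lambda>n q. ord_prod l A (y1 (B n v)) i q w) n q = 0"
            by meson
          then show ?thesis
            by (intro exI[of _ "max K K'"]) (simp add: L_def expand3_zero)
        qed
      qed simp
      then show ?thesis by simp
    qed
    finally show ?thesis .
  qed
  \<comment> \<open>Both sides vanish for large \<open>n\<close>, the truncation under which the recursion in \<open>m\<close> can be inverted.\<close>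
  have Rn: "R m l n q = 0" if "n \<ge> cutoff B v" for m l n q
    unfolding R_def by (rule step_pow_zero, rule step_pow_zero) (use that in \<open>simp add: ord_prod_zero cutoff\<close>)
  have Ln: "L m n l i j q = 0" if "n \<ge> cutoff B v" "j \<ge> J" for m n l i j q
  proof (rule binomial_recursion_unique[where f = "\<lambda>m i j. L m n l i j q" and m\<^sub>0 = 0 and \<epsilon> = "-1" and J = J])
    show "L 0 n l i j q = 0" if "j \<ge> J" for i j
    proof -
      have "ord_prod n B V j q w = 0" for q
        using HB[of "nat j" n q] that J step_pow_zero[of n q "\<lambda>n q. y1 (B n v) q w"] \<open>n \<ge> cutoff B v\<close>
        by (simp add: cutoff)
      then show ?thesis by (simp add: L0 expand_eq_0)
    qed
    show "\<exists>K. \<forall>j\<ge>K. \<forall>i. L m n l i j q = 0" for m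
      unfolding L_def
    proof (rule expand3_trunc)
      show "\<exists>J. \<forall>j\<ge>J. \<forall>i. ord_prod m A B i j (V q w) = 0" for q
        using ord_prod_trunc_right[of A B "V q w"] by auto
    qed
  qed (use that L_m in auto)
  have "R m l n q - L m n l (int i) (int j) q = 0"
  proof (rule binomial_recursion_unique[where f = "\<lambda>m l n. R m l n q - L m n l (int i) (int j) q"
        and m\<^sub>0 = 0 and \<epsilon> = "-1" and J = n])
    show "R (m + 1) l n q - L (m + 1) n l (int i) (int j) q = R m (l + 1) n q - L m n (l + 1) (int i) (int j) q
      + (- 1) \<cdot> (R m l (n + 1) q - L m (n + 1) l (int i) (int j) q)" for m l n
      by (simp add: R_m L_m L_l L_n)
    show "\<exists>K. \<forall>n\<ge>K. \<forall>l. R m l n q - L m n l (int i) (int j) q = 0" for m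
      by (intro exI[of _ "cutoff B v"]) (simp add: Rn Ln j)
  qed (simp_all add: R0)
  then show ?thesis by (simp add: R_def L_def K_def)
qed

text \<open>
  Applying the previous lemma to both orders of \<open>A\<close> and \<open>B\<close> gives the claim for the two-variable
  expression \<open>comm m A B\<close>, multiplied by \<open>(z\<^sub>1 + y)\<^sup>i (z\<^sub>2 + y)\<^sup>j\<close> with \<open>i \<ge> I\<close> and \<open>j \<ge> J\<close>.
  To take the residue that defines the \<open>m\<close>-th product one needs \<open>i = 0\<close>. As in Dong's lemma,
  \<open>z\<^sub>1 + y = (z\<^sub>2 + y) + (z\<^sub>1 - z\<^sub>2)\<close> and the locality of \<open>A, B\<close> bring \<open>i\<close> down at the expense of
  \<open>j\<close>.
\<close>

lemma weak_assoc_comm: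
  assumes A: "vfield A" and B: "vfield B" and V: "vfield V" and y1: "\<And>x. vfield (y1 x)" and y2: "\<And>x. vfield (y2 x)"
    and y1_lin: "\<And>q w. lin (\<lambda>x. y1 x q w)" and y2_lin: "\<And>q w. lin (\<lambda>x. y2 x q w)"
    and y3: "\<And>q w. lin (\<lambda>x. y3 x q w)"
    and HA1: "\<And>x l i q. int i \<ge> I \<Longrightarrow> (step 1 ^^ i) (\<lambda>l q. y3 (A l x) q w) l q = ord_prod l A (y1 x) (int i) q w"
    and HB1: "\<And>n j q. int j \<ge> J \<Longrightarrow> (step 1 ^^ j) (\<lambda>n q. y1 (B n v) q w) n q = ord_prod n B V (int j) q w"
    and HB2: "\<And>x n j q. int j \<ge> J \<Longrightarrow> (step 1 ^^ j) (\<lambda>n q. y3 (B n x) q w) n q = ord_prod n B (y2 x) (int j) q w"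
    and HA2: "\<And>l i q. int i \<ge> I \<Longrightarrow> (step 1 ^^ i) (\<lambda>l q. y2 (A l v) q w) l q = ord_prod l A V (int i) q w"
    and I: "I \<ge> 0" and J: "J \<ge> 0" and M: "local_order M A B" and j: "m + int j \<ge> M + I + J"
  shows "(step 1 ^^ j) (\<lambda>n q. y3 (comm m A B 0 n v) q w) n q = ord_prod n (comm m A B 0) V (int j) q w"
proof -
  define K where "K = cutoff V w"
  note [simp] = lin_0[OF vfield_lin] A B V y1 y2 lin_0[OF y3] lin_diff[OF y3] lin_scale[OF y3]
  define L where "L m i j n l q = expand3 K n l (\<lambda>i j q. comm m A B i j (V q w)) i j q" for m i j n l q
  define R where "R m i j n l q = (step 1 ^^ nat i) (\<lambda>l q. (step 1 ^^ nat j)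
     (\<lambda>n q. y3 (comm m A B l n v) q w) n q) l q" for m i j l n q
  have L_m: "L (m + 1) i j n l q = L m (i + 1) j n l q - L m i (j + 1) n l q" for m n l i j q
    unfolding L_def by (rule expand3_m) (simp add: comm_Suc)
  have nat1: "nat (k + 1) = Suc (nat k)" if "k \<ge> 0" for k using that by simp
  have R_i: "R m (i + 1) j n l q = R m i j n (l + 1) q + R m i j n l (q + 1)" if "i \<ge> 0" for m i j n l q
    unfolding R_def nat1[OF that] step_pow_Suc by simp
  have R_j: "R m i (j + 1) n l q = R m i j (n + 1) l q + R m i j n l (q + 1)" if "j \<ge> 0" for m i j n l q
    unfolding R_def nat1[OF that] step_pow_Suc
    using step_pow_relation[where H = "\<lambda>l q. (step 1 ^^ nat j) (\<lambda>n q. y3 (comm m A B l n v) q w) (n + 1) q +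
        (step 1 ^^ nat j) (\<lambda>n q. y3 (comm m A B l n v) q w) n (q + 1)"
          and F = "\<lambda>l q. (step 1 ^^ nat j) (\<lambda>n q. y3 (comm m A B l n v) q w) (n + 1) q"
          and G = "\<lambda>l q. (step 1 ^^ nat j) (\<lambda>n q. y3 (comm m A B l n v) q w) n q"
          and a = 0 and b = 0 and c = "1" and a' = 0 and b' = 1] by simp
  have R_m: "R (m + 1) i j n l q = R m i j n (l + 1) q - R m i j (n + 1) l q" for m i j l n q
    unfolding R_def by (rule step_pow_nested_diff) (simp add: comm_Suc)
  have corner: "L m i j n l q = R m i j n l q" if "i \<ge> I" "j \<ge> J" for m i j n l q
  proof -
    have 1: "expand3 K n l (\<lambda>i j q. ord_prod m A B i j (V q w)) i j q =
      (step 1 ^^ nat i) (\<lambda>l q. (step 1 ^^ nat j) (\<lambda>n q. y3 (ord_prod m A B l n v) q w) n q) l q"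
    proof -
      have "expand3 K n l (\<lambda>i j q. ord_prod m A B i j (V q w)) (int (nat i)) (int (nat j)) q =
        (step 1 ^^ nat i) (\<lambda>l q. (step 1 ^^ nat j) (\<lambda>n q. y3 (ord_prod m A B l n v) q w) n q) l q"
        unfolding K_def by (rule weak_assoc_ordered[where I = I and J = J and ?y1.0 = y1])
          (fact A B V y1 y3 y1_lin HA1 HB1 J | use that I J in simp)+
      then show ?thesis using that I J by simp
    qed
    have "expand3 K n l (\<lambda>i j q. ord_prod m B A j i (V q w)) i j q =
      expand3 K l n (\<lambda>j i q. ord_prod m B A j i (V q w)) j i q"
      by (rule expand3_swap)
    also have "\<dots> = (step 1 ^^ nat j) (\<lambda>n q. (step 1 ^^ nat i) (\<lambda>l q. y3 (ord_prod m B A n l v) q w) l q) n q"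
    proof -
      have "expand3 K l n (\<lambda>j i q. ord_prod m B A j i (V q w)) (int (nat j)) (int (nat i)) q =
        (step 1 ^^ nat j) (\<lambda>n q. (step 1 ^^ nat i) (\<lambda>l q. y3 (ord_prod m B A n l v) q w) l q) n q"
        unfolding K_def by (rule weak_assoc_ordered[where I = J and J = I and ?y1.0 = y2])
          (fact A B V y2 y3 y2_lin HA2 HB2 I | use that I J in simp)+
      then show ?thesis using that I J by simp
    qed
    also have "\<dots> = (step 1 ^^ nat i) (\<lambda>l q. (step 1 ^^ nat j) (\<lambda>n q. y3 (ord_prod m B A n l v) q w) n q) l q"
      by (rule step_pow_swap)
    finally have 2: "expand3 K n l (\<lambda>i j q. ord_prod m B A j i (V q w)) i j q = \<dots>" .
    have "R m i j n l q =
      (step 1 ^^ nat i) (\<lambda>l q. (step 1 ^^ nat j) (\<lambda>n q. y3 (ord_prod m A B l n v) q w) n q) (l + 0) (q + 0) +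
      (- ((-1) powi m)) \<cdot>
      (step 1 ^^ nat i) (\<lambda>l q. (step 1 ^^ nat j) (\<lambda>n q. y3 (ord_prod m B A n l v) q w) n q) (l + 0) (q + 0)"
      unfolding R_def by (rule step_pow_relation) (simp add: comm_def step_pow_combine)
    then show ?thesis
      unfolding L_def comm_def expand3_combine by (simp add: 1 2)
  qed
  have "L m 0 (int j) n 0 q - R m 0 (int j) n 0 q = 0"
  proof (rule triangular_recursion_zero[where D = "\<lambda>m j i. L m i j n 0 q - R m i j n 0 q"
        and M = M and N = J and L = I])
    show "L m (i + 1) j n 0 q - R m (i + 1) j n 0 q = L m i (j + 1) n 0 q - R m i (j + 1) n 0 q +
      (L (m + 1) i j n 0 q - R (m + 1) i j n 0 q)" if "j \<ge> 0" "i \<ge> 0" for m j i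
      using that by (simp add: L_m R_i R_j R_m)
    show "L m i j n 0 q - R m i j n 0 q = 0" if "m \<ge> M" for m j i
      using M that by (simp add: L_def R_def local_order_def expand3_def expand_def)
  qed (use j I J corner in auto)
  moreover have "L m 0 (int j) n 0 q = ord_prod n (comm m A B 0) V (int j) q w"
    unfolding L_def expand3_def expand_0 by (simp add: K_def ord_prod_def expand_zero)
  ultimately show ?thesis by (simp add: R_def)
qed

section \<open>The Borcherds identity\<close>

text \<open>
  The Borcherds identity \<open>\<Sum>\<^sub>s (p choose s) (a\<^sub>n\<^sub>+\<^sub>s v)\<^sub>p\<^sub>+\<^sub>q\<^sub>-\<^sub>s w = \<Sum>\<^sub>s (-1)\<^sup>s (n choose s)
  (a\<^sub>p\<^sub>+\<^sub>n\<^sub>-\<^sub>s v\<^sub>q\<^sub>+\<^sub>s - (-1)\<^sup>n v\<^sub>q\<^sub>+\<^sub>n\<^sub>-\<^sub>s a\<^sub>p\<^sub>+\<^sub>s) w\<close> for a fixed vector \<open>v\<close>. The three kinds of modes that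
  occur are separate arguments: those of \<open>A\<close> and \<open>V\<close>, and those of the fields \<open>y x\<close> of the iterates \<open>x = a\<^sub>n v\<close>; in the
  toroidal case they have different degrees.
\<close>

definition Borcherds :: "(int \<Rightarrow> 'w \<Rightarrow> 'w) \<Rightarrow> (int \<Rightarrow> 'w \<Rightarrow> 'w) \<Rightarrow> ('w \<Rightarrow> int \<Rightarrow> 'w \<Rightarrow> 'w) \<Rightarrow> 'w \<Rightarrow> bool" where
  "Borcherds A V y v \<longleftrightarrow>
     (\<forall>p q n w. comm n A V p q w = expand 1 (cutoff A v) p (\<lambda>q n. y (A n v) q w) q n)"

lemma Borcherds_local: "vfield A \<Longrightarrow> Borcherds A V y v \<Longrightarrow> local_order (cutoff A v) A V"
  unfolding Borcherds_def local_order_def by (simp add: expand_zero)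

text \<open>
  For \<open>p\<close> large with respect to \<open>w\<close>, the summand with \<open>A\<close> acting first on \<open>w\<close> vanishes, and the
  Borcherds identity at \<open>p\<close> says that \<open>(z + y)\<^sup>p\<close> clears the difference between iterate and product.
\<close>

lemma Borcherds_at_iff_weak_assoc:
  assumes "vfield A" "vfield V" "\<And>q w. lin (\<lambda>x. y x q w)" "int j \<ge> cutoff A w"
  shows "comm n A V (int j) q w = expand 1 (cutoff A v) (int j) (\<lambda>q n. y (A n v) q w) q n \<longleftrightarrow>
    (step 1 ^^ j) (\<lambda>n q. y (A n v) q w) n q = ord_prod n A V (int j) q w"
proof -
  have "expand 1 (cutoff A v) (0 + int j) (\<lambda>q n. y (A n v) q w) q n =
    (step 1 ^^ j) (\<lambda>n q. expand 1 (cutoff A v) 0 (\<lambda>q n. y (A n v) q w) q n) n q"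
    by (rule step_pow_rec[where f = "\<lambda>j n q. expand 1 (cutoff A v) j (\<lambda>q n. y (A n v) q w) q n"])
       (simp add: expand_Suc)
  also have "(\<lambda>n q. expand 1 (cutoff A v) 0 (\<lambda>q n. y (A n v) q w) q n) = (\<lambda>n q. y (A n v) q w)"
    using assms(1) by (intro ext) (simp add: expand_0 cutoff[OF assms(1)] lin_0[OF assms(3)])
  moreover have "ord_prod n V A q (int j) w = 0" for n
    by (rule ord_prod_zero) (use assms in \<open>auto simp: cutoff\<close>)
  then have "comm n A V (int j) q w = ord_prod n A V (int j) q w"
    by (simp add: comm_def)
  ultimately show ?thesis by auto
qed

lemma Borcherds_weak_assoc:
  assumes "vfield A" "vfield V" "Borcherds A V y v" "\<And>q w. lin (\<lambda>x. y x q w)" "int j \<ge> cutoff A w"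
  shows "(step 1 ^^ j) (\<lambda>n q. y (A n v) q w) n q = ord_prod n A V (int j) q w"
  using Borcherds_at_iff_weak_assoc[where y = y and v = v, OF assms(1,2,4,5)] assms(3) by (simp add: Borcherds_def)

text \<open>
  For a single \<open>p\<close> the identity is weaker than the Borcherds identity. Locality bounds the modes
  \<open>n\<close> of its left side, so the recursion in \<open>p\<close> can be run in both directions.
\<close>

lemma Borcherds_criterion:
  assumes "vfield A" "vfield V" "local_order N A V"
    and "\<And>w. \<exists>p. \<forall>q n. comm n A V p q w = expand 1 (cutoff A v) p (\<lambda>q n. y (A n v) q w) q n"
  shows "Borcherds A V y v"
  unfolding Borcherds_def
proof (intro allI)
  fix p q n w
  let ?f = "\<lambda>p q n. comm n A V p q w - expand 1 (cutoff A v) p (\<lambda>q n. y (A n v) q w) q n"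
  obtain p\<^sub>0 where p\<^sub>0: "\<And>q n. ?f p\<^sub>0 q n = 0" using assms(4)[of w] by auto
  have "?f p q n = 0"
  proof (rule binomial_recursion_unique[where f = ?f and m\<^sub>0 = p\<^sub>0 and \<epsilon> = 1 and J = n])
    show "?f (p + 1) q n = ?f p (q + 1) n + 1 \<cdot> ?f p q (n + 1)" for p q n
      by (simp add: expand_Suc comm_Suc)
    show "\<exists>K. \<forall>n\<ge>K. \<forall>q. ?f p q n = 0" for p
      using assms(3) by (intro exI[of _ "max N (cutoff A v)"]) (simp add: local_order_def expand_zero)
  qed (use p\<^sub>0 in auto)
  then show "comm n A V p q w = expand 1 (cutoff A v) p (\<lambda>q n. y (A n v) q w) q n" by simp
qed

text \<open>
  The product is local by Dong's lemma, and by the criterion it is enough to find one \<open>p\<close> for each \<open>w\<close>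
  at which the identity holds. There it is weak associativity, which the product inherits. The bounds \<open>M, L, N\<close> are
  the orders of locality of the three pairs, and \<open>I, J\<close> those of weak associativity on \<open>w\<close>.
\<close>

theorem Borcherds_product:
  fixes Y :: "'w \<Rightarrow> 't::ab_group_add \<Rightarrow> int \<Rightarrow> 'w \<Rightarrow> 'w"
  assumes vfield: "\<And>x \<gamma>. vfield (Y x \<gamma>)" and lin: "\<And>\<gamma> q w. lin (\<lambda>x. Y x \<gamma> q w)"
    and Ba: "\<And>v \<alpha> \<gamma>. Borcherds (Y a \<alpha>) (Y v \<gamma>) (\<lambda>x. Y x (\<alpha> + \<gamma>)) v"
    and Bu: "\<And>v \<beta> \<gamma>. Borcherds (Y u \<beta>) (Y v \<gamma>) (\<lambda>x. Y x (\<beta> + \<gamma>)) v"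
    and c: "\<And>\<gamma>. Y c \<gamma> = comm m (Y a \<alpha>) (Y u (\<gamma> - \<alpha>)) 0"
  shows "Borcherds (Y c \<delta>) (Y v \<gamma>) (\<lambda>x. Y x (\<delta> + \<gamma>)) v"
proof -
  let ?A = "Y a \<alpha>" and ?B = "Y u (\<delta> - \<alpha>)" and ?V = "Y v \<gamma>"
  note lA = Borcherds_local[OF vfield Ba] and lB = Borcherds_local[OF vfield Bu]
  define M where "M = cutoff ?A u"
  define L where "L = max 0 (cutoff ?A v)"
  define N where "N = max 0 (cutoff ?B v)"
  have M: "local_order M ?A ?B" unfolding M_def by (rule lA)
  have L: "local_order L ?A ?V" and N: "local_order N ?B ?V"
    using lA[of \<alpha> v \<gamma>] lB[of "\<delta> - \<alpha>" v \<gamma>] by (auto simp: L_def N_def local_order_def)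
  have loc: "local_order (max 0 (M + N + L - m)) (Y c \<delta>) ?V"
    unfolding c by (rule Dong[OF vfield vfield vfield M L N]) (auto simp: L_def N_def)
  show ?thesis
  proof (rule Borcherds_criterion[OF vfield vfield loc])
    fix w
    define I where "I = max 0 (cutoff ?A w)"
    define J where "J = max 0 (cutoff ?B w)"
    define j where "j = nat (max (M + I + J - m) (cutoff (Y c \<delta>) w))"
    have wa: "(step 1 ^^ j) (\<lambda>n q. Y (comm m ?A ?B 0 n v) (\<delta> + \<gamma>) q w) n q = ord_prod n (comm m ?A ?B 0) ?V (int j) q w"
      for n q
    proof (rule weak_assoc_comm[where A = ?A and B = ?B and I = I and J = J and M = M
          and ?y1.0 = "\<lambda>x. Y x (\<delta> - \<alpha> + \<gamma>)" and ?y2.0 = "\<lambda>x. Y x (\<alpha> + \<gamma>)"])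
      show "(step 1 ^^ i) (\<lambda>l q. Y (?A l x) (\<delta> + \<gamma>) q w) l q = ord_prod l ?A (Y x (\<delta> - \<alpha> + \<gamma>)) (int i) q w"
        if "I \<le> int i" for x l i q
        using Borcherds_weak_assoc[where A = ?A and V = "Y x (\<delta> - \<alpha> + \<gamma>)" and y = "\<lambda>x. Y x (\<delta> + \<gamma>)" and v = x and w = w] Ba[of \<alpha> x "\<delta> - \<alpha> + \<gamma>"]
          vfield lin that by (simp add: I_def algebra_simps)
      show "(step 1 ^^ j) (\<lambda>n q. Y (?B n v) (\<delta> - \<alpha> + \<gamma>) q w) n q = ord_prod n ?B ?V (int j) q w"
        if "J \<le> int j" for j n q
        using Borcherds_weak_assoc[where A = ?B and V = "?V" and y = "\<lambda>x. Y x (\<delta> - \<alpha> + \<gamma>)" and v = v and w = w] Bu[of "\<delta> - \<alpha>" v \<gamma>]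
          vfield lin that by (simp add: J_def algebra_simps)
      show "(step 1 ^^ j) (\<lambda>n q. Y (?B n x) (\<delta> + \<gamma>) q w) n q = ord_prod n ?B (Y x (\<alpha> + \<gamma>)) (int j) q w"
        if "J \<le> int j" for x j n q
        using Borcherds_weak_assoc[where A = ?B and V = "Y x (\<alpha> + \<gamma>)" and y = "\<lambda>x. Y x (\<delta> + \<gamma>)" and v = x and w = w] Bu[of "\<delta> - \<alpha>" x "\<alpha> + \<gamma>"]
          vfield lin that by (simp add: J_def algebra_simps)
      show "(step 1 ^^ i) (\<lambda>l q. Y (?A l v) (\<alpha> + \<gamma>) q w) l q = ord_prod l ?A ?V (int i) q w"
        if "I \<le> int i" for l i q
        using Borcherds_weak_assoc[where A = ?A and V = "?V" and y = "\<lambda>x. Y x (\<alpha> + \<gamma>)" and v = v and w = w] Ba[of \<alpha> v \<gamma>]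
          vfield lin that by (simp add: I_def algebra_simps)
    qed (auto simp: vfield lin I_def J_def M j_def)
    have "comm n (Y c \<delta>) ?V (int j) q w =
       expand 1 (cutoff (Y c \<delta>) v) (int j) (\<lambda>q n. Y (Y c \<delta> n v) (\<delta> + \<gamma>) q w) q n" for q n
      by (rule Borcherds_at_iff_weak_assoc[THEN iffD2]) (use vfield lin wa in \<open>auto simp: c j_def vfield_comm_right\<close>)
    then show "\<exists>p. \<forall>q n. comm n (Y c \<delta>) ?V p q w =
       expand 1 (cutoff (Y c \<delta>) v) p (\<lambda>q n. Y (Y c \<delta> n v) (\<delta> + \<gamma>) q w) q n" by blast
  qed
qed


section \<open>Commutators of products of fields\<close>

lemma ord_prod_combine_right:
  assumes "vfield A" "vfield F" "vfield G"
  shows "ord_prod l A (\<lambda>q x. F q x - c \<cdot> G q x) p q w = ord_prod l A F p q w - c \<cdot> ord_prod l A G p q w"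
proof -
  let ?K = "max (cutoff F w) (cutoff G w)"
  have "ord_prod l A (\<lambda>q x. F q x - c \<cdot> G q x) p q w = expand (-1) ?K l (\<lambda>i j. A i (F j w - c \<cdot> G j w)) p q"
    by (rule ord_prod_eq) (use assms in \<open>auto simp: vfield_combine cutoff\<close>)
  also have "\<dots> = expand (-1) ?K l (\<lambda>i j. A i (F j w)) p q - c \<cdot> expand (-1) ?K l (\<lambda>i j. A i (G j w)) p q"
    using assms by (simp add: lin_diff lin_scale vfield_lin expand_diff expand_scale)
  also have "expand (-1) ?K l (\<lambda>i j. A i (F j w)) p q = ord_prod l A F p q w"
    by (rule ord_prod_eq[symmetric]) (use assms in \<open>auto simp: cutoff\<close>)
  also have "expand (-1) ?K l (\<lambda>i j. A i (G j w)) p q = ord_prod l A G p q w"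
    by (rule ord_prod_eq[symmetric]) (use assms in \<open>auto simp: cutoff\<close>)
  finally show ?thesis .
qed

lemma ord_prod_combine_left:
  "ord_prod l (\<lambda>q x. F q x - c \<cdot> G q x) A q p w = ord_prod l F A q p w - c \<cdot> ord_prod l G A q p w"
  unfolding ord_prod_def by (simp add: expand_diff expand_scale)

lemma expand_trunc:
  fixes F :: "int \<Rightarrow> int \<Rightarrow> int \<Rightarrow> 'w"
  assumes "\<And>r. \<exists>K. \<forall>p\<ge>K. \<forall>q. F p q r = 0"
  shows "\<exists>K. \<forall>p\<ge>K. \<forall>q. expand \<epsilon> N n (\<lambda>q r. F p q r) q r = 0"
proof -
  obtain K where K: "\<And>r p q. p \<ge> K r \<Longrightarrow> F p q r = 0" using assms by metis
  define M where "M = Max (insert 0 ((\<lambda>s. K (r + int s)) ` {..<nat (N - r)}))"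
  have M: "K (r + int s) \<le> M" if "s < nat (N - r)" for s
    unfolding M_def using that by (intro Max_ge) auto
  have "expand \<epsilon> N n (\<lambda>q r. F p q r) q r = 0" if "p \<ge> M" for p q
    unfolding expand_def
  proof (intro sum.neutral ballI)
    fix s assume "s \<in> {..<nat (N - r)}"
    then have "F p (q + n - int s) (r + int s) = 0"
      using M[of s] that by (intro K) auto
    then show "binom \<epsilon> n s \<cdot> F p (q + n - int s) (r + int s) = 0" by simp
  qed
  then show ?thesis by blast
qed

text \<open>
  Both sides are the expansion of \<open>(x - w)\<^sup>l (w - y)\<^sup>n A(x) V(w) B(y)\<close> with \<open>x\<close> dominating \<open>w\<close> dominating
  \<open>y\<close>.
\<close>

lemma ord_prod_assoc:
  assumes A: "vfield A" and V: "vfield V" and B: "vfield B"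
  shows "ord_prod l A (\<lambda>q. ord_prod n V B q r) p q w = ord_prod n (ord_prod l A V p) B q r w"
proof -
  note [simp] = A B V vfield_ord_prod_left vfield_ord_prod_right
  let ?f = "\<lambda>l p q. ord_prod l A (\<lambda>q. ord_prod n V B q r) p q w - ord_prod n (ord_prod l A V p) B q r w"
  have "?f l p q = 0"
  proof (rule binomial_recursion_unique[where f = ?f and m\<^sub>0 = 0 and \<epsilon> = "-1" and J = q])
    show "?f (l + 1) p q = ?f l (p + 1) q + (-1) \<cdot> ?f l p (q + 1)" for l p q
    proof -
      have "expand (-1) (cutoff B w) n (\<lambda>q r. ord_prod (l + 1) A V p q (B r w)) q r =
        expand (-1) (cutoff B w) n (\<lambda>q r. ord_prod l A V (p + 1) q (B r w)) (q + 0) r +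
        (-1) \<cdot> expand (-1) (cutoff B w) n (\<lambda>q r. ord_prod l A V p q (B r w)) (q + 1) r"
        by (rule expand_relation) (simp add: ord_prod_Suc)
      then show ?thesis
        using ord_prod_Suc[of l A "\<lambda>q. ord_prod n V B q r"] by (simp add: ord_prod_def[of n])
    qed
    show "?f 0 p q = 0" for p q
      by (simp add: ord_prod_0 ord_prod_def[of n] lin_expand vfield_lin)
    show "\<exists>K. \<forall>q\<ge>K. \<forall>p. ?f l p q = 0" for l
    proof -
      have "\<exists>K. \<forall>q\<ge>K. \<forall>p. ord_prod n (ord_prod l A V p) B q r w = 0"
      proof -
        define K where "K = Max (insert 0 ((\<lambda>s. cutoff V (B (r + int s) w) - n + int s) ` {..<nat (cutoff B w - r)}))"
        have K: "cutoff V (B (r + int s) w) - n + int s \<le> K" if "s < nat (cutoff B w - r)" for s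
          unfolding K_def using that by (intro Max_ge) auto
        have "ord_prod n (ord_prod l A V p) B q r w = 0" if "q \<ge> K" for p q
          unfolding ord_prod_def[of n] expand_def
        proof (intro sum.neutral ballI)
          fix s assume "s \<in> {..<nat (cutoff B w - r)}"
          then have "ord_prod l A V p (q + n - int s) (B (r + int s) w) = 0"
            using K[of s] that by (simp add: ord_prod_zero cutoff)
          then show "binom (-1) n s \<cdot> ord_prod l A V p (q + n - int s) (B (r + int s) w) = 0" by simp
        qed
        then show ?thesis by blast
      qed
      then obtain K1 where "\<forall>q\<ge>K1. \<forall>p. ord_prod n (ord_prod l A V p) B q r w = 0" ..
      moreover obtain K2 where "\<forall>q\<ge>K2. \<forall>n' p. ord_prod n' A (\<lambda>q. ord_prod n V B q r) p q w = 0"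
        using ord_prod_trunc_right[of A "\<lambda>q. ord_prod n V B q r" w] by auto
      ultimately show ?thesis by (intro exI[of _ "max K1 K2"]) simp
    qed
  qed simp
  then show ?thesis by simp
qed

text \<open>
  The two terms are \<open>(x - w)\<^sup>l (y - w)\<^sup>n [A(x), B(y)] V(w)\<close>. The hypothesis on modes says
  \<open>[A(x), B(y)] = C(y) \<delta>(x, y) + \<kappa> U(y) \<partial>\<^sub>y \<delta>(x, y)\<close> with \<open>\<delta>(x, y) = x\<^sup>-\<^sup>1 \<delta>(y / x)\<close>. The delta
  function turns \<open>(x - w)\<^sup>l (y - w)\<^sup>n\<close> into \<open>(y - w)\<^sup>l\<^sup>+\<^sup>n\<close>, and its derivative adds the term with
  \<open>l (y - w)\<^sup>l\<^sup>+\<^sup>n\<^sup>-\<^sup>1\<close>. The proof checks \<open>l = n = 0\<close> and the recursions in \<open>n\<close> and \<open>l\<close>.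
\<close>

lemma ord_prod_commutator_left:
  assumes A: "vfield A" and B: "vfield B" and V: "vfield V" and C: "vfield C" and U: "vfield U"
    and AB: "\<And>p r w. A p (B r w) - B r (A p w) = C (p + r) w + (of_int p * \<kappa>) \<cdot> U (p + r - 1) w"
  shows "ord_prod l A (ord_prod n B V r) p q w - ord_prod n B (ord_prod l A V p) r q w =
     ord_prod (l + n) C V (p + r) q w + (of_int p * \<kappa>) \<cdot> ord_prod (l + n) U V (p + r - 1) q w
     + (of_int l * \<kappa>) \<cdot> ord_prod (l + n - 1) U V (p + r) q w" (is "?X l n p r q = ?G l n p r q")
proof -
  note [simp] = A B V C U vfield_ord_prod_left vfield_ord_prod_right
  define K where "K = cutoff V w"
  have inner: "ord_prod l A (ord_prod n B V r) p q w = expand3 K n l (\<lambda>p r q. A p (B r (V q w))) p r q"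
    if "vfield A" "vfield B" for A B l n p r q
  proof -
    have "ord_prod l A (ord_prod n B V r) p q w = expand (-1) K l (\<lambda>p q. A p (ord_prod n B V r q w)) p q"
      using that by (intro ord_prod_eq) (auto simp: ord_prod_zero cutoff K_def)
    then show ?thesis
      using that by (simp add: expand3_def ord_prod_def K_def lin_expand vfield_lin)
  qed
  have X: "?X l n p r q = expand3 K n l (\<lambda>p r q. A p (B r (V q w))) p r q -
    expand3 K n l (\<lambda>p r q. B r (A p (V q w))) p r q" for l n p r q
    using expand3_swap[of K l n "\<lambda>r p q. B r (A p (V q w))" r p q] by (simp add: inner)
  have G_zero: "?G l n p r q = 0" if "q \<ge> K" for l n p r q
    using that by (simp add: ord_prod_zero K_def cutoff)
  have idx: "l + (n + 1) = l + n + 1" "l + n + 1 - 1 = l + n" "l + 1 + n = l + n + 1"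
    "p + (r + 1) = p + r + 1" "p + r + 1 - 1 = p + r" "p + 1 + r = p + r + 1" for l n p r :: int by simp_all
  have rec: "ord_prod (l + n + 1) C V (p + r) q w = ord_prod (l + n) C V (p + r + 1) q w - ord_prod (l + n) C V (p + r) (q + 1) w"
    "ord_prod (l + n + 1) U V (p + r - 1) q w = ord_prod (l + n) U V (p + r) q w - ord_prod (l + n) U V (p + r - 1) (q + 1) w"
    "ord_prod (l + n) U V (p + r) q w = ord_prod (l + n - 1) U V (p + r + 1) q w - ord_prod (l + n - 1) U V (p + r) (q + 1) w" for l n p r q
    using ord_prod_Suc[of "l + n" C V "p + r" q w] ord_prod_Suc[of "l + n" U V "p + r - 1" q w]
      ord_prod_Suc[of "l + n - 1" U V "p + r" q w] by simp_all
  have G_n: "?G l (n + 1) p r q = ?G l n p (r + 1) q - ?G l n p r (q + 1)" for l n p r q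
    unfolding idx unfolding rec[of l n p r q] by (simp add: scale_right_diff_distrib algebra_simps)
  have G_l: "?G (l + 1) n p r q = ?G l n (p + 1) r q - ?G l n p r (q + 1)" for l n p r q
    unfolding idx unfolding rec[of l n p r q] by (simp add: scale_right_diff_distrib algebra_simps)
  have n: "?X 0 n p r q - ?G 0 n p r q = 0" for n p r q
  proof (rule binomial_recursion_unique[where f = "\<lambda>n r q. ?X 0 n p r q - ?G 0 n p r q"
        and m\<^sub>0 = 0 and \<epsilon> = "-1" and J = q])
    show "?X 0 (n + 1) p r q - ?G 0 (n + 1) p r q = ?X 0 n p (r + 1) q - ?G 0 n p (r + 1) q +
      (-1) \<cdot> (?X 0 n p r (q + 1) - ?G 0 n p r (q + 1))" for n r q
      unfolding X G_n expand3_n by (simp add: algebra_simps)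
    show "?X 0 0 p r q - ?G 0 0 p r q = 0" for r q
    proof -
      have "ord_prod 0 A (ord_prod 0 B V r) p q w = A p (B r (V q w))"
        by (subst ord_prod_0) (simp_all add: ord_prod_0)
      moreover have "ord_prod 0 B (ord_prod 0 A V p) r q w = B r (A p (V q w))"
        by (subst ord_prod_0) (simp_all add: ord_prod_0)
      ultimately have "?X 0 0 p r q = C (p + r) (V q w) + (of_int p * \<kappa>) \<cdot> U (p + r - 1) (V q w)"
        by (simp only: AB)
      then show ?thesis by (simp add: ord_prod_0)
    qed
    show "\<exists>K. \<forall>q\<ge>K. \<forall>r. ?X 0 n p r q - ?G 0 n p r q = 0" for n
      by (intro exI[of _ K] allI impI) (simp only: X G_zero expand3_zero diff_self)
  qed simp
  have "?X l n p r q - ?G l n p r q = 0"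
  proof (rule binomial_recursion_unique[where f = "\<lambda>l p q. ?X l n p r q - ?G l n p r q"
        and m\<^sub>0 = 0 and \<epsilon> = "-1" and J = q])
    show "?X (l + 1) n p r q - ?G (l + 1) n p r q = ?X l n (p + 1) r q - ?G l n (p + 1) r q +
      (-1) \<cdot> (?X l n p r (q + 1) - ?G l n p r (q + 1))" for l p q
      unfolding X G_l expand3_l by (simp add: algebra_simps)
    show "?X 0 n p r q - ?G 0 n p r q = 0" for p q by (rule n)
    show "\<exists>K. \<forall>q\<ge>K. \<forall>p. ?X l n p r q - ?G l n p r q = 0" for l
      by (intro exI[of _ K] allI impI) (simp only: X G_zero expand3_zero diff_self)
  qed simp
  then show ?thesis by simp
qed

lemma ord_prod_commutator_right:
  assumes A: "vfield A" and B: "vfield B" and V: "vfield V" and C: "vfield C" and U: "vfield U"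
    and AB: "\<And>p r w. A p (B r w) - B r (A p w) = C (p + r) w + (of_int p * \<kappa>) \<cdot> U (p + r - 1) w"
  shows "ord_prod l (\<lambda>q. ord_prod n V B q r) A q p w - ord_prod n (\<lambda>q. ord_prod l V A q p) B q r w =
     - ord_prod (l + n) V C q (p + r) w - (of_int p * \<kappa>) \<cdot> ord_prod (l + n) V U q (p + r - 1) w
     + (of_int l * \<kappa>) \<cdot> ord_prod (l + n - 1) V U q (p + r) w" (is "?X l n p r q = ?G l n p r q")
proof -
  note [simp] = A B V C U vfield_ord_prod_left vfield_ord_prod_right
  have X_l: "?X (l + 1) n p r q = ?X l n p r (q + 1) - ?X l n (p + 1) r q" for l n p r q
  proof -
    have "expand (-1) (cutoff B w) n (\<lambda>q r. ord_prod (l + 1) V A q p (B r w)) q r =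
        expand (-1) (cutoff B w) n (\<lambda>q r. ord_prod l V A q p (B r w)) (q + 1) r +
        (-1) \<cdot> expand (-1) (cutoff B w) n (\<lambda>q r. ord_prod l V A q (p + 1) (B r w)) (q + 0) r"
      by (rule expand_relation) (simp add: ord_prod_Suc)
    moreover have "ord_prod n (\<lambda>q. ord_prod l V A q p) B q r w = expand (-1) (cutoff B w) n (\<lambda>q r. ord_prod l V A q p (B r w)) q r"
      for l p q by (rule ord_prod_def)
    ultimately show ?thesis
      using ord_prod_Suc[of l "\<lambda>q. ord_prod n V B q r" A] by simp
  qed
  have o: "ord_prod 0 (\<lambda>q. ord_prod n V B q r) A q p w = ord_prod n V B q r (A p w)" for n p r q
    by (rule ord_prod_0) simp_all
  have X_n: "?X 0 (n + 1) p r q = ?X 0 n p r (q + 1) - ?X 0 n p (r + 1) q" for n p r q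
    unfolding o using ord_prod_Suc[of n "\<lambda>q. ord_prod 0 V A q p" B] ord_prod_Suc[of n V B] by simp
  have idx: "l + (n + 1) = l + n + 1" "l + n + 1 - 1 = l + n" "l + 1 + n = l + n + 1"
    "p + (r + 1) = p + r + 1" "p + r + 1 - 1 = p + r" "p + 1 + r = p + r + 1" for l n p r :: int by simp_all
  have rec: "ord_prod (l + n + 1) V C q (p + r) w = ord_prod (l + n) V C (q + 1) (p + r) w - ord_prod (l + n) V C q (p + r + 1) w"
    "ord_prod (l + n + 1) V U q (p + r - 1) w = ord_prod (l + n) V U (q + 1) (p + r - 1) w - ord_prod (l + n) V U q (p + r) w"
    "ord_prod (l + n) V U q (p + r) w = ord_prod (l + n - 1) V U (q + 1) (p + r) w - ord_prod (l + n - 1) V U q (p + r + 1) w" for l n p r q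
    using ord_prod_Suc[of "l + n" V C q "p + r" w] ord_prod_Suc[of "l + n" V U q "p + r - 1" w]
      ord_prod_Suc[of "l + n - 1" V U q "p + r" w] by simp_all
  have G_n: "?G l (n + 1) p r q = ?G l n p r (q + 1) - ?G l n p (r + 1) q" for l n p r q
    unfolding idx unfolding rec[of l n q p r] by (simp add: scale_right_diff_distrib algebra_simps)
  have G_l: "?G (l + 1) n p r q = ?G l n p r (q + 1) - ?G l n (p + 1) r q" for l n p r q
    unfolding idx unfolding rec[of l n q p r] by (simp add: scale_right_diff_distrib algebra_simps)
  have n: "?X 0 n p r q - ?G 0 n p r q = 0" for n p r q
  proof (rule binomial_recursion_unique[where f = "\<lambda>n q r. ?X 0 n p r q - ?G 0 n p r q"
        and m\<^sub>0 = 0 and \<epsilon> = "-1" and J = r])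
    show "?X 0 (n + 1) p r q - ?G 0 (n + 1) p r q = ?X 0 n p r (q + 1) - ?G 0 n p r (q + 1) +
      (-1) \<cdot> (?X 0 n p (r + 1) q - ?G 0 n p (r + 1) q)" for n r q
      unfolding X_n G_n by (simp add: algebra_simps)
    show "?X 0 0 p r q - ?G 0 0 p r q = 0" for r q
    proof -
      have "V q (B r (A p w)) - V q (A p (B r w)) = - V q (A p (B r w) - B r (A p w))"
        by (simp add: lin_diff vfield_lin)
      moreover have "ord_prod 0 (\<lambda>q. ord_prod 0 V B q r) A q p w = V q (B r (A p w))"
        by (subst ord_prod_0) (simp_all add: ord_prod_0)
      moreover have "ord_prod 0 (\<lambda>q. ord_prod 0 V A q p) B q r w = V q (A p (B r w))"
        by (subst ord_prod_0) (simp_all add: ord_prod_0)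
      ultimately have "?X 0 0 p r q = - V q (C (p + r) w + (of_int p * \<kappa>) \<cdot> U (p + r - 1) w)"
        by (simp only: AB)
      then show ?thesis
        by (simp add: ord_prod_0 lin_add lin_scale vfield_lin)
    qed
    show "\<exists>K. \<forall>r\<ge>K. \<forall>q. ?X 0 n p r q - ?G 0 n p r q = 0" for n
      by (intro exI[of _ "max (max (cutoff B (A p w)) (cutoff B w)) (max (cutoff C w - p) (max (cutoff U w - p + 1) (cutoff U w - p)))"])
         (simp add: o ord_prod_zero cutoff)
  qed simp
  have "?X l n p r q - ?G l n p r q = 0"
  proof (rule binomial_recursion_unique[where f = "\<lambda>l q p. ?X l n p r q - ?G l n p r q"
        and m\<^sub>0 = 0 and \<epsilon> = "-1" and J = p])
    show "?X (l + 1) n p r q - ?G (l + 1) n p r q = ?X l n p r (q + 1) - ?G l n p r (q + 1) +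
      (-1) \<cdot> (?X l n (p + 1) r q - ?G l n (p + 1) r q)" for l p q
      unfolding X_l G_l by (simp add: algebra_simps)
    show "?X 0 n p r q - ?G 0 n p r q = 0" for p q by (rule n)
    show "\<exists>K. \<forall>p\<ge>K. \<forall>q. ?X l n p r q - ?G l n p r q = 0" for l
    proof -
      have "\<exists>K. \<forall>p\<ge>K. \<forall>q. ord_prod l V A q p (B r w) = 0" for r
        by (intro exI[of _ "cutoff A (B r w)"]) (simp add: ord_prod_zero cutoff)
      then obtain K where K: "\<forall>p\<ge>K. \<forall>q. ord_prod n (\<lambda>q. ord_prod l V A q p) B q r w = 0"
        unfolding ord_prod_def[of n _ B] using expand_trunc[of "\<lambda>p q r. ord_prod l V A q p (B r w)"] by meson
      show ?thesis
        by (intro exI[of _ "max (max K (cutoff A w)) (max (cutoff C w - r) (max (cutoff U w - r + 1) (cutoff U w - r)))"])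
          (simp add: K ord_prod_zero cutoff)
    qed
  qed simp
  then show ?thesis by simp
qed

text \<open>
  The commutator formula of currents survives the passage to products with a third field: the operators
  \<open>V \<mapsto> A\<^sub>(\<^sub>n\<^sub>)V\<close> satisfy the relations of the modes of \<open>A\<close>. Of the four ordered products of three
  fields, the mixed ones, with \<open>V\<close> between the two currents, cancel by associativity; the remaining ones are given by
  the two lemmas above.
\<close>

lemma comm_commutator:
  assumes A: "vfield A" and B: "vfield B" and V: "vfield V" and C: "vfield C" and U: "vfield U"
    and AB: "\<And>p r w. A p (B r w) - B r (A p w) = C (p + r) w + (of_int p * \<kappa>) \<cdot> U (p + r - 1) w"
  shows "comm l A (comm n B V 0) 0 q w - comm n B (comm l A V 0) 0 q w =
     comm (l + n) C V 0 q w + (of_int l * \<kappa>) \<cdot> comm (l + n - 1) U V 0 q w"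
proof -
  note [simp] = A B V C U vfield_ord_prod_left vfield_ord_prod_right vfield_combine
  have expanded: "comm l A (comm n B V 0) 0 q w =
    ord_prod l A (ord_prod n B V 0) 0 q w - (-1) powi n \<cdot> ord_prod l A (\<lambda>q. ord_prod n V B q 0) 0 q w
    - (-1) powi l \<cdot> (ord_prod l (ord_prod n B V 0) A q 0 w - (-1) powi n \<cdot> ord_prod l (\<lambda>q. ord_prod n V B q 0) A q 0 w)"
    if "vfield A" "vfield B" for A B l n
    using that unfolding comm_def[abs_def] by (simp add: ord_prod_combine_right ord_prod_combine_left)
  have sgn: "(-1) powi (l + n) = (-1 :: complex) powi l * (-1) powi n"
    by (simp add: power_int_add)
  have sgn': "(-1) powi (l + n - 1) = - ((-1 :: complex) powi l * (-1) powi n)"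
    by (simp add: power_int_add power_int_diff)
  have "comm l A (comm n B V 0) 0 q w - comm n B (comm l A V 0) 0 q w =
    (ord_prod l A (ord_prod n B V 0) 0 q w - ord_prod n B (ord_prod l A V 0) 0 q w)
    + (-1) powi (l + n) \<cdot> (ord_prod l (\<lambda>q. ord_prod n V B q 0) A q 0 w - ord_prod n (\<lambda>q. ord_prod l V A q 0) B q 0 w)"
    unfolding expanded[OF A B] expanded[OF B A] ord_prod_assoc[OF A V B] ord_prod_assoc[OF B V A] sgn
    by (simp add: scale_right_diff_distrib algebra_simps)
  also have "\<dots> = comm (l + n) C V 0 q w + (of_int l * \<kappa>) \<cdot> comm (l + n - 1) U V 0 q w"
    unfolding ord_prod_commutator_left[OF A B V C U AB] ord_prod_commutator_right[OF A B V C U AB] comm_def sgn'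
    by (simp add: sgn scale_right_diff_distrib algebra_simps)
  finally show ?thesis .
qed


lemma Borcherds_combine:
  assumes A: "vfield A" and B: "vfield B" and V: "vfield V" and y: "\<And>q w. lin (\<lambda>x. y x q w)"
    and "Borcherds A V y v" "Borcherds B V y v"
  shows "Borcherds (\<lambda>n x. A n x - c \<cdot> B n x) V y v"
  unfolding Borcherds_def
proof (intro allI)
  fix p q n w
  let ?F = "\<lambda>n x. A n x - c \<cdot> B n x"
  let ?K = "max (cutoff A v) (max (cutoff B v) (cutoff ?F v))"
  note [simp] = A B V vfield_combine
  have bound: "expand 1 ?K p (\<lambda>q n. y (C n v) q w) q n = expand 1 (cutoff C v) p (\<lambda>q n. y (C n v) q w) q n"
    if "C \<in> {A, B, ?F}" for C
    by (rule expand_bound) (use that A B cutoff[OF vfield_combine[OF A B]] in \<open>auto simp: lin_0[OF y] cutoff\<close>)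
  have "comm n ?F V p q w = comm n A V p q w - c \<cdot> comm n B V p q w"
    by (simp add: comm_def ord_prod_combine_left ord_prod_combine_right algebra_simps)
  also have "\<dots> = expand 1 ?K p (\<lambda>q n. y (A n v) q w) q n - c \<cdot> expand 1 ?K p (\<lambda>q n. y (B n v) q w) q n"
    using assms(5,6) by (simp add: Borcherds_def bound)
  also have "\<dots> = expand 1 ?K p (\<lambda>q n. y (?F n v) q w) q n"
    by (simp add: lin_diff[OF y] lin_scale[OF y] expand_diff expand_scale)
  also have "\<dots> = expand 1 (cutoff ?F v) p (\<lambda>q n. y (?F n v) q w) q n"
    by (rule bound) simp
  finally show "comm n ?F V p q w = expand 1 (cutoff ?F v) p (\<lambda>q n. y (?F n v) q w) q n" .
qed

lemma local_order_commuting: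
  assumes "\<And>p q w. comm 0 A B p q w = 0"
  shows "local_order 0 A B"
  unfolding local_order_def
proof (intro allI impI)
  fix n p q w assume "(0 :: int) \<le> n"
  then show "comm n A B p q w = 0"
    using comm_step_pow[of 0 "nat n" A B p q w] assms by simp
qed

lemma comm_scaled_right:
  assumes "vfield A" "vfield B" "vfield C"
  shows "comm n A (\<lambda>n x. B n x - c \<cdot> C n x) p q w = comm n A B p q w - c \<cdot> comm n A C p q w"
  using assms by (simp add: comm_def ord_prod_combine_left ord_prod_combine_right algebra_simps)

lemma comm_scaled_left:
  assumes "vfield A" "vfield B" "vfield C"
  shows "comm n (\<lambda>n x. B n x - c \<cdot> C n x) A p q w = comm n B A p q w - c \<cdot> comm n C A p q w"
  using assms by (simp add: comm_def ord_prod_combine_left ord_prod_combine_right algebra_simps)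

end

section \<open>Families of fields as a representation of the current algebra\<close>

text \<open>
  Currents \<open>cur a \<alpha> n\<close>, the modes of the field of \<open>a\<close> of degree \<open>\<alpha>\<close>, acting at level \<open>level\<close> on a
  vector space type. The type may be larger than the module: \<open>one\<close> is a projection, and the currents live on its image,
  where it is the identity.
\<close>

locale current_representation = complex_vector_space scale
  for scale :: "complex \<Rightarrow> 'w::ab_group_add \<Rightarrow> 'w" (infixr "\<cdot>" 75) +
  fixes gscale :: "complex \<Rightarrow> 'g::ab_group_add \<Rightarrow> 'g"
    and bracket :: "'g \<Rightarrow> 'g \<Rightarrow> 'g" and form :: "'g \<Rightarrow> 'g \<Rightarrow> complex" and level :: complex
    and cur :: "'g \<Rightarrow> 't::ab_group_add \<Rightarrow> int \<Rightarrow> 'w \<Rightarrow> 'w" and one :: "'w \<Rightarrow> 'w"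
  assumes cur_lin: "lin (cur a \<alpha> n)"
    and cur_trunc: "\<exists>N. \<forall>n\<ge>N. \<forall>\<alpha>. cur a \<alpha> n w = 0"
    and cur_add: "cur (a + b) \<alpha> n w = cur a \<alpha> n w + cur b \<alpha> n w"
    and cur_gscale: "cur (gscale c a) \<alpha> n w = c \<cdot> cur a \<alpha> n w"
    and one_lin: "lin one" and one_one: "one (one w) = one w"
    and one_cur: "one (cur a \<alpha> n w) = cur a \<alpha> n w" and cur_one: "cur a \<alpha> n (one w) = cur a \<alpha> n w"
    and cur_commutator: "cur a \<alpha> p (cur b \<beta> r w) - cur b \<beta> r (cur a \<alpha> p w) =
       cur (bracket a b) (\<alpha> + \<beta>) (p + r) w
       + (if \<alpha> + \<beta> = 0 \<and> p + r = 0 then (of_int p * form a b * level) \<cdot> one w else 0)"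
begin

lemma vfield_cur: "vfield (cur a \<alpha>)"
  unfolding vfield_def using cur_lin cur_trunc by meson

text \<open>
  Truncation has to be uniform in the degree \<open>\<gamma>\<close>, as \<open>Y(v; x\<^sub>0, x)w\<close> is a Laurent series in \<open>x\<^sub>0\<close>.
\<close>

definition tfields :: "('t \<Rightarrow> int \<Rightarrow> 'w \<Rightarrow> 'w) set" where
  "tfields = {\<beta>. (\<forall>\<gamma> n. lin (\<beta> \<gamma> n)) \<and> (\<forall>w. \<exists>N. \<forall>n\<ge>N. \<forall>\<gamma>. \<beta> \<gamma> n w = 0) \<and>
     (\<forall>\<gamma> n w. one (\<beta> \<gamma> n w) = \<beta> \<gamma> n w \<and> \<beta> \<gamma> n (one w) = \<beta> \<gamma> n w)}"

definition fscale :: "complex \<Rightarrow> ('t \<Rightarrow> int \<Rightarrow> 'w \<Rightarrow> 'w) \<Rightarrow> 't \<Rightarrow> int \<Rightarrow> 'w \<Rightarrow> 'w" where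
  "fscale c \<beta> = (\<lambda>\<gamma> n w. c \<cdot> \<beta> \<gamma> n w)"

definition unit_field :: "'t \<Rightarrow> int \<Rightarrow> 'w \<Rightarrow> 'w" where
  "unit_field = (\<lambda>\<gamma> n w. if \<gamma> = 0 \<and> n = -1 then one w else 0)"

text \<open>
  The \<open>n\<close>-th product with a current. Degrees add, so degree \<open>\<gamma>\<close> of the product uses degree \<open>\<gamma> - \<alpha>\<close> of \<open>\<beta>\<close>.
\<close>

definition cur_act :: "int \<Rightarrow> 't \<Rightarrow> 'g \<Rightarrow> ('t \<Rightarrow> int \<Rightarrow> 'w \<Rightarrow> 'w) \<Rightarrow> 't \<Rightarrow> int \<Rightarrow> 'w \<Rightarrow> 'w" where
  "cur_act n \<alpha> a \<beta> = (\<lambda>\<gamma>. comm n (cur a \<alpha>) (\<beta> (\<gamma> - \<alpha>)) 0)"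

lemma vfield_tfields: "\<beta> \<in> tfields \<Longrightarrow> vfield (\<beta> \<gamma>)"
  unfolding vfield_def tfields_def mem_Collect_eq by meson

lemma vector_space_fscale: "vector_space fscale"
  by unfold_locales (auto simp: fscale_def fun_eq_iff algebra_simps)

lemma cur_in_tfields: "cur a \<in> tfields"
  using cur_lin cur_trunc one_cur cur_one by (simp add: tfields_def)

lemma unit_field_in_tfields: "unit_field \<in> tfields"
proof -
  have "\<exists>N. \<forall>n\<ge>N. \<forall>\<gamma>. unit_field \<gamma> n w = 0" for w
    by (rule exI[of _ 0]) (simp add: unit_field_def)
  moreover have "lin (unit_field \<gamma> n)" for \<gamma> n
    using one_lin by (auto simp: unit_field_def lin_def)
  ultimately show ?thesis
    unfolding tfields_def by (simp add: unit_field_def one_one lin_0[OF one_lin])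
qed

lemma tfields_combine:
  assumes "\<beta> \<in> tfields" "\<beta>' \<in> tfields"
  shows "(\<lambda>\<gamma> n w. \<beta> \<gamma> n w - c \<cdot> \<beta>' \<gamma> n w) \<in> tfields"
  unfolding tfields_def mem_Collect_eq
proof (intro conjI allI)
  show "lin (\<lambda>w. \<beta> \<gamma> n w - c \<cdot> \<beta>' \<gamma> n w)" for \<gamma> n
    using assms by (intro lin_combine) (auto simp: tfields_def)
  show "\<exists>N. \<forall>n\<ge>N. \<forall>\<gamma>. \<beta> \<gamma> n w - c \<cdot> \<beta>' \<gamma> n w = 0" for w
  proof -
    obtain N1 N2 where "\<forall>n\<ge>N1. \<forall>\<gamma>. \<beta> \<gamma> n w = 0" "\<forall>n\<ge>N2. \<forall>\<gamma>. \<beta>' \<gamma> n w = 0"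
      using assms unfolding tfields_def mem_Collect_eq by meson
    then show ?thesis by (intro exI[of _ "max N1 N2"]) simp
  qed
qed (use assms in \<open>auto simp: tfields_def lin_diff[OF one_lin] lin_scale[OF one_lin]\<close>)

lemma tfields_0: "0 \<in> tfields"
  using tfields_combine[OF unit_field_in_tfields unit_field_in_tfields, of 1] by (simp add: zero_fun_def)

lemma tfields_add: "\<beta> \<in> tfields \<Longrightarrow> \<beta>' \<in> tfields \<Longrightarrow> \<beta> + \<beta>' \<in> tfields"
  using tfields_combine[of \<beta> \<beta>' "-1"] by (simp add: plus_fun_def)

lemma tfields_fscale: "\<beta> \<in> tfields \<Longrightarrow> fscale c \<beta> \<in> tfields"
  using tfields_combine[OF tfields_0, of \<beta> "-c"] by (simp add: fscale_def)

text \<open>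
  Uniform truncation is preserved because only finitely many modes of the current act nontrivially on a given
  vector, and each of the resulting vectors has a bound that serves all degrees.
\<close>

lemma cur_act_in_tfields:
  assumes "\<beta> \<in> tfields"
  shows "cur_act n \<alpha> a \<beta> \<in> tfields"
proof -
  note [simp] = vfield_cur vfield_tfields[OF assms]
  have oneb: "one (\<beta> \<gamma> n w) = \<beta> \<gamma> n w" "\<beta> \<gamma> n (one w) = \<beta> \<gamma> n w" for \<gamma> n w
    using assms by (auto simp: tfields_def)
  have cutoff_one: "cutoff (\<beta> \<gamma>) (one w) = cutoff (\<beta> \<gamma>) w" "cutoff (cur a \<alpha>) (one w) = cutoff (cur a \<alpha>) w" for \<gamma> w
    by (simp_all add: cutoff_def oneb cur_one)
  have lin: "lin (cur_act n \<alpha> a \<beta> \<gamma> k)" for \<gamma> k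
    unfolding cur_act_def by (rule lin_comm) simp_all
  have "one (cur_act n \<alpha> a \<beta> \<gamma> k w) = cur_act n \<alpha> a \<beta> \<gamma> k w" for \<gamma> k w
    by (simp add: cur_act_def comm_def ord_prod_def lin_diff[OF one_lin] lin_scale[OF one_lin]
       lin_expand[OF one_lin] one_cur oneb)
  moreover have "cur_act n \<alpha> a \<beta> \<gamma> k (one w) = cur_act n \<alpha> a \<beta> \<gamma> k w" for \<gamma> k w
    by (simp add: cur_act_def comm_def ord_prod_def cutoff_one cur_one oneb)
  moreover have "\<exists>N. \<forall>k\<ge>N. \<forall>\<gamma>. cur_act n \<alpha> a \<beta> \<gamma> k w = 0" for w
  proof -
    obtain N1 where N1: "\<And>k \<gamma>. k \<ge> N1 \<Longrightarrow> \<beta> \<gamma> k w = 0"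
      using assms unfolding tfields_def mem_Collect_eq by meson
    have "\<exists>N. \<forall>k\<ge>N. \<forall>\<gamma>. \<beta> \<gamma> k w' = 0" for w'
      using assms unfolding tfields_def mem_Collect_eq by meson
    then obtain N where N: "\<And>k \<gamma> w. k \<ge> N w \<Longrightarrow> \<beta> \<gamma> k w = 0" by metis
    define N2 where "N2 = Max (insert 0 ((\<lambda>s. N (cur a \<alpha> (int s) w) - n + int s) ` {..<nat (cutoff (cur a \<alpha>) w)}))"
    have N2: "N (cur a \<alpha> (int s) w) - n + int s \<le> N2" if "s < nat (cutoff (cur a \<alpha>) w)" for s
      unfolding N2_def using that by (intro Max_ge) auto
    have "ord_prod n (\<beta> (\<gamma> - \<alpha>)) (cur a \<alpha>) k 0 w = 0" if "k \<ge> N2" for k \<gamma>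
      unfolding ord_prod_def expand_def
    proof (intro sum.neutral ballI)
      fix s assume "s \<in> {..<nat (cutoff (cur a \<alpha>) w - 0)}"
      then have "\<beta> (\<gamma> - \<alpha>) (k + n - int s) (cur a \<alpha> (0 + int s) w) = 0"
        using N2[of s] that by (intro N) auto
      then show "binom (-1) n s \<cdot> \<beta> (\<gamma> - \<alpha>) (k + n - int s) (cur a \<alpha> (0 + int s) w) = 0" by simp
    qed
    then have "\<forall>k\<ge>max N1 N2. \<forall>\<gamma>. cur_act n \<alpha> a \<beta> \<gamma> k w = 0"
      by (simp add: cur_act_def comm_def ord_prod_zero N1)
    then show ?thesis by blast
  qed
  ultimately show ?thesis using lin by (simp add: tfields_def)
qed

lemma cur_act_combine:
  assumes "\<beta> \<in> tfields" "\<beta>' \<in> tfields"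
  shows "cur_act n \<alpha> a (\<lambda>\<gamma> n w. \<beta> \<gamma> n w - c \<cdot> \<beta>' \<gamma> n w) =
    (\<lambda>\<gamma> k w. cur_act n \<alpha> a \<beta> \<gamma> k w - c \<cdot> cur_act n \<alpha> a \<beta>' \<gamma> k w)"
  unfolding cur_act_def by (intro ext comm_scaled_right vfield_cur vfield_tfields assms)

lemma cur_act_add:
  assumes "\<beta> \<in> tfields" "\<beta>' \<in> tfields"
  shows "cur_act n \<alpha> a (\<beta> + \<beta>') = cur_act n \<alpha> a \<beta> + cur_act n \<alpha> a \<beta>'"
  using cur_act_combine[OF assms, of n \<alpha> a "-1"] by (simp add: plus_fun_def)

lemma cur_act_fscale:
  assumes "\<beta> \<in> tfields"
  shows "cur_act n \<alpha> a (fscale c \<beta>) = fscale c (cur_act n \<alpha> a \<beta>)"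
proof -
  have "cur_act n \<alpha> a 0 = 0"
    using cur_act_combine[OF tfields_0 tfields_0, of n \<alpha> a 1] by (simp add: zero_fun_def)
  then show ?thesis
    using cur_act_combine[OF tfields_0 assms, of n \<alpha> a "-c"] by (simp add: fscale_def)
qed

lemma cur_act_left_combine:
  assumes "\<beta> \<in> tfields"
  shows "cur_act n \<alpha> (a + gscale c b) \<beta> = cur_act n \<alpha> a \<beta> + fscale c (cur_act n \<alpha> b \<beta>)"
proof -
  have eq: "cur (a + gscale c b) \<alpha> = (\<lambda>n w. cur a \<alpha> n w - (-c) \<cdot> cur b \<alpha> n w)"
    by (intro ext) (simp add: cur_add cur_gscale)
  show ?thesis
    unfolding cur_act_def eq
    using comm_scaled_left[OF vfield_tfields[OF assms] vfield_cur vfield_cur, where c = "- c"]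
    by (simp add: fun_eq_iff fscale_def)
qed

text \<open>
  The unit field is constant in \<open>x\<close>, so \<open>(x - y)\<^sup>n\<close> times it has a residue in \<open>x\<close> only from
  \<open>(x - y)\<^sup>-\<^sup>1\<close>.
\<close>

lemma comm_unit_field:
  assumes "\<beta> \<in> tfields"
  shows "comm n (unit_field \<alpha>) (\<beta> \<gamma>) 0 q w = (if \<alpha> = 0 \<and> n = -1 then \<beta> \<gamma> q w else 0)"
proof -
  let ?U = "unit_field \<alpha>" and ?V = "\<beta> \<gamma>"
  have V: "vfield ?V" and U: "vfield ?U" using vfield_tfields assms unit_field_in_tfields by blast+
  have oneb: "one (\<beta> \<gamma> n w) = \<beta> \<gamma> n w" "\<beta> \<gamma> n (one w) = \<beta> \<gamma> n w" for n w
    using assms by (auto simp: tfields_def)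
  have right: "ord_prod n ?V ?U q 0 w = 0"
    by (rule ord_prod_zero) (use V in \<open>auto simp: unit_field_def\<close>)
  consider "n \<ge> 0" | "n < -1" | "n = -1" by linarith
  then show ?thesis
  proof cases
    case 1
    have "local_order 0 ?U ?V"
      by (rule local_order_commuting) (simp add: comm_0 U V, simp add: unit_field_def oneb lin_0[OF vfield_lin[OF V]])
    with 1 show ?thesis by (simp add: local_order_def)
  next
    case 2
    then have "ord_prod n ?U ?V 0 q w = 0"
      unfolding ord_prod_def expand_def by (intro sum.neutral ballI) (simp add: unit_field_def)
    with 2 right show ?thesis by (simp add: comm_def)
  next
    case 3
    have "ord_prod n ?U ?V 0 q w = (\<Sum>s<nat (cutoff ?V w - q). if s = 0 then (if \<alpha> = 0 then ?V q w else 0) else 0)"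
      unfolding ord_prod_def expand_def 3 by (rule sum.cong) (auto simp: unit_field_def oneb)
    also have "\<dots> = (if \<alpha> = 0 then ?V q w else 0)"
      by (auto simp: cutoff[OF V])
    finally show ?thesis using 3 right by (simp add: comm_def)
  qed
qed

lemma cur_act_commutator:
  assumes "\<beta> \<in> tfields"
  shows "cur_act l \<alpha> a (cur_act n \<alpha>' b \<beta>) - cur_act n \<alpha>' b (cur_act l \<alpha> a \<beta>) =
    cur_act (l + n) (\<alpha> + \<alpha>') (bracket a b) \<beta>
    + fscale (if \<alpha> + \<alpha>' = 0 \<and> l + n = 0 then of_int l * form a b * level else 0) \<beta>"
proof (intro ext)
  fix \<gamma> q w
  define \<kappa> where "\<kappa> = form a b * level"
  have tag: "\<gamma> - \<alpha>' - \<alpha> = \<gamma> - (\<alpha> + \<alpha>')" "\<gamma> - \<alpha> - \<alpha>' = \<gamma> - (\<alpha> + \<alpha>')" by (simp_all add: algebra_simps)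
  have "cur a \<alpha> p (cur b \<alpha>' r w) - cur b \<alpha>' r (cur a \<alpha> p w) =
     cur (bracket a b) (\<alpha> + \<alpha>') (p + r) w + (of_int p * \<kappa>) \<cdot> unit_field (\<alpha> + \<alpha>') (p + r - 1) w" for p r w
    by (simp add: cur_commutator unit_field_def \<kappa>_def)
  note rel = comm_commutator[OF vfield_cur vfield_cur vfield_tfields[OF assms] vfield_cur vfield_tfields[OF unit_field_in_tfields] this]
  have idx: "(l + n - 1 = - 1) = (l + n = 0)" by linarith
  show "(cur_act l \<alpha> a (cur_act n \<alpha>' b \<beta>) - cur_act n \<alpha>' b (cur_act l \<alpha> a \<beta>)) \<gamma> q w =
    (cur_act (l + n) (\<alpha> + \<alpha>') (bracket a b) \<beta>
    + fscale (if \<alpha> + \<alpha>' = 0 \<and> l + n = 0 then of_int l * form a b * level else 0) \<beta>) \<gamma> q w"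
    unfolding cur_act_def plus_fun_def fun_diff_def tag rel comm_unit_field[OF assms] idx
    by (auto simp: fscale_def \<kappa>_def mult.assoc)
qed

text \<open>
  For \<open>k \<ge> 0\<close> the \<open>k\<close>-th product is the coefficient of the \<open>k\<close>-th derivative of the delta function in the
  commutator, here \<open>[a, b]\<close> and \<open>\<langle>a, b\<rangle>\<ell>\<close>. These are the relations that define the module \<open>(\<gg> + \<complex>)\<^sub>\<ell>\<close>.
\<close>

lemma cur_act_cur:
  assumes "k \<ge> 0"
  shows "cur_act k \<alpha> a (cur b) = (if k = 0 then cur (bracket a b) else
    if k = 1 then fscale (form a b * level) unit_field else 0)"
proof (intro ext)
  fix \<gamma> q w
  let ?A = "cur a \<alpha>" and ?B = "cur b (\<gamma> - \<alpha>)"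
  have c0: "comm 0 ?A ?B p q w = cur (bracket a b) \<gamma> (p + q) w
      + (of_int p * form a b * level) \<cdot> unit_field \<gamma> (p + q - 1) w" for p q
    using cur_commutator[of a \<alpha> p b "\<gamma> - \<alpha>" q w] by (simp add: comm_0 vfield_cur unit_field_def)
  have c1: "comm 1 ?A ?B p q w = (form a b * level) \<cdot> unit_field \<gamma> (p + q) w" for p q
    using comm_Suc[of 0 ?A ?B p q w] by (simp add: c0 algebra_simps)
  have c2: "comm 2 ?A ?B p q w = 0" for p q
    using comm_Suc[of 1 ?A ?B p q w] by (simp add: c1 algebra_simps)
  have "comm k ?A ?B p q w = 0" if "k \<ge> 2" for p q
    using comm_step_pow[of 2 "nat (k - 2)" ?A ?B p q w] that c2 by simp
  then show "cur_act k \<alpha> a (cur b) \<gamma> q w = (if k = 0 then cur (bracket a b) else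
    if k = 1 then fscale (form a b * level) unit_field else 0) \<gamma> q w"
    using assms by (auto simp: cur_act_def c0 c1 fscale_def)
qed

lemma cur_act_unit_field:
  assumes "k \<ge> 0"
  shows "cur_act k \<alpha> a unit_field = 0"
proof (intro ext)
  fix \<gamma> q w
  have "local_order 0 (cur a \<alpha>) (unit_field (\<gamma> - \<alpha>))"
    by (rule local_order_commuting)
      (simp add: comm_0 vfield_cur vfield_tfields unit_field_in_tfields,
       simp add: unit_field_def one_cur cur_one lin_0[OF cur_lin])
  with assms show "cur_act k \<alpha> a unit_field \<gamma> q w = 0 \<gamma> q w"
    by (simp add: cur_act_def local_order_def)
qed

lemma cur_local: "local_order 2 (cur a \<alpha>) (cur b \<beta>)"
  unfolding local_order_def
proof (intro allI impI)
  fix n p q w assume "(2 :: int) \<le> n"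
  have "comm 2 (cur a \<alpha>) (cur b \<beta>) p q w = 0" for p q
  proof -
    have c: "comm 0 (cur a \<alpha>) (cur b \<beta>) p q w = cur (bracket a b) (\<alpha> + \<beta>) (p + q) w
      + (of_int p * form a b * level) \<cdot> unit_field (\<alpha> + \<beta>) (p + q - 1) w" for p q
      using cur_commutator[of a \<alpha> p b \<beta> q w] by (simp add: comm_0 vfield_cur unit_field_def)
    have c1: "comm 1 (cur a \<alpha>) (cur b \<beta>) p q w = (form a b * level) \<cdot> unit_field (\<alpha> + \<beta>) (p + q) w" for p q
      using comm_Suc[of 0 "cur a \<alpha>" "cur b \<beta>" p q w] by (simp add: c algebra_simps)
    show ?thesis using comm_Suc[of 1 "cur a \<alpha>" "cur b \<beta>" p q w] by (simp add: c1 algebra_simps)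
  qed
  then show "comm n (cur a \<alpha>) (cur b \<beta>) p q w = 0"
    using comm_step_pow[of 2 "nat (n - 2)" "cur a \<alpha>" "cur b \<beta>" p q w] \<open>2 \<le> n\<close> by simp
qed

end

section \<open>The Borcherds identity on a module generated by currents\<close>

text \<open>
  What the universal property of the induced module provides: a linear map from states to families of fields that
  intertwines the currents with products, on a module generated from the vacuum and the vectors of \<open>\<gg>\<close>.
  The single closure condition on \<open>x - cy\<close> covers sums and multiples.
\<close>

locale state_field_map = current_representation +
  fixes Y :: "'a \<Rightarrow> 'c \<Rightarrow> int \<Rightarrow> 'a \<Rightarrow> 'a" and vac :: 'a and emb :: "'b \<Rightarrow> 'a"
  assumes Y_field: "Y x \<in> tfields"
    and Y_lin: "lin (\<lambda>x. Y x \<gamma> n w)"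
    and Y_one: "Y (one x) = Y x"
    and Y_vac: "Y vac = unit_field"
    and Y_emb: "Y (emb a) = cur a"
    and Y_cur: "Y (cur a \<alpha> n x) = cur_act n \<alpha> a (Y x)"
    and generated: "\<lbrakk>P vac; \<And>a. P (emb a); \<And>x y c. P x \<Longrightarrow> P y \<Longrightarrow> P (x - scale c y);
       \<And>a \<alpha> n x. P x \<Longrightarrow> P (cur a \<alpha> n x)\<rbrakk> \<Longrightarrow> P (one x)"
begin

lemma vfield_Y: "vfield (Y x \<gamma>)"
  using vfield_tfields[OF Y_field] .

lemma Y_combine: "Y (x - scale c y) \<gamma> = (\<lambda>n w. Y x \<gamma> n w - scale c (Y y \<gamma> n w))"
  using lin_diff[OF Y_lin] lin_scale[OF Y_lin] by (simp add: fun_eq_iff)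

text \<open>
  Induction on the generation of \<open>v\<close>; Dong's lemma treats the step from \<open>x\<close> to the action of a current on
  \<open>x\<close>, with \<open>2\<close> as the order of locality of two currents.
\<close>

lemma cur_Y_local: "\<exists>N\<ge>0. local_order N (cur a \<alpha>) (Y v \<gamma>)"
proof -
  have "\<forall>a \<alpha> \<gamma>. \<exists>N\<ge>0. local_order N (cur a \<alpha>) (Y (one v) \<gamma>)"
  proof (rule generated)
    show "\<forall>a \<alpha> \<gamma>. \<exists>N\<ge>0. local_order N (cur a \<alpha>) (Y vac \<gamma>)"
    proof (intro allI exI conjI)
      show "local_order 0 (cur a \<alpha>) (Y vac \<gamma>)" for a \<alpha> \<gamma>
        unfolding Y_vac
        by (rule local_order_commuting)
          (simp add: comm_0 vfield_cur vfield_tfields unit_field_in_tfields,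
           simp add: unit_field_def one_cur cur_one lin_0[OF cur_lin])
    qed simp
    show "\<forall>a \<alpha> \<gamma>. \<exists>N\<ge>0. local_order N (cur a \<alpha>) (Y (emb b) \<gamma>)" for b
      unfolding Y_emb using cur_local by (intro allI exI[of _ 2]) simp
    show "\<forall>a \<alpha> \<gamma>. \<exists>N\<ge>0. local_order N (cur a \<alpha>) (Y (x - scale c y) \<gamma>)"
      if x: "\<forall>a \<alpha> \<gamma>. \<exists>N\<ge>0. local_order N (cur a \<alpha>) (Y x \<gamma>)"
        and y: "\<forall>a \<alpha> \<gamma>. \<exists>N\<ge>0. local_order N (cur a \<alpha>) (Y y \<gamma>)" for x y c
    proof (intro allI)
      fix a \<alpha> \<gamma>
      obtain N1 N2 where "N1 \<ge> 0" "local_order N1 (cur a \<alpha>) (Y x \<gamma>)" "N2 \<ge> 0" "local_order N2 (cur a \<alpha>) (Y y \<gamma>)"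
        using x y by meson
      then show "\<exists>N\<ge>0. local_order N (cur a \<alpha>) (Y (x - scale c y) \<gamma>)"
        by (intro exI[of _ "max N1 N2"]) (simp add: local_order_def Y_combine comm_scaled_right vfield_cur vfield_Y)
    qed
    show "\<forall>a \<alpha> \<gamma>. \<exists>N\<ge>0. local_order N (cur a \<alpha>) (Y (cur b \<beta> n x) \<gamma>)"
      if x: "\<forall>a \<alpha> \<gamma>. \<exists>N\<ge>0. local_order N (cur a \<alpha>) (Y x \<gamma>)" for b \<beta> n x
    proof (intro allI)
      fix a \<alpha> \<gamma>
      obtain M N where M: "M \<ge> 0" "local_order M (cur b \<beta>) (Y x (\<gamma> - \<beta>))"
        and N: "N \<ge> 0" "local_order N (cur a \<alpha>) (Y x (\<gamma> - \<beta>))"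
        using x by meson
      have "local_order (max 0 (M + N + 2 - n)) (comm n (cur b \<beta>) (Y x (\<gamma> - \<beta>)) 0) (cur a \<alpha>)"
        by (rule Dong[OF vfield_cur vfield_Y vfield_cur M(2) cur_local local_order_sym[OF N(2)] N(1)]) auto
      then show "\<exists>N\<ge>0. local_order N (cur a \<alpha>) (Y (cur b \<beta> n x) \<gamma>)"
        unfolding Y_cur cur_act_def by (intro exI[of _ "max 0 (M + N + 2 - n)"]) (simp add: local_order_sym)
    qed
  qed
  then show ?thesis by (simp add: Y_one)
qed

text \<open>
  For a current the intertwining property is the instance \<open>p = 0\<close> of the identity, and locality gives the rest.
  The identity is linear in \<open>u\<close> and passes to products, hence it spreads to all \<open>u\<close>.
\<close>

theorem Borcherds_Y: "Borcherds (Y u \<alpha>) (Y v \<gamma>) (\<lambda>x. Y x (\<alpha> + \<gamma>)) v"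
proof -
  note vfields = vfield_Y vfield_cur
  have zero_exp: "expand 1 (cutoff A v) 0 (\<lambda>q n. Y (A n v) \<delta> q w) q n = Y (A n v) \<delta> q w" if "vfield A" for A v \<delta> q n w
    using that by (simp add: expand_0 cutoff lin_0[OF Y_lin])
  have vac: "Borcherds (Y vac \<alpha>) (Y v \<gamma>) (\<lambda>x. Y x (\<alpha> + \<gamma>)) v" for \<alpha> \<gamma> v
  proof (rule Borcherds_criterion[where N = 0])
    have oneb: "one (Y v \<gamma> n w) = Y v \<gamma> n w" "Y v \<gamma> n (one w) = Y v \<gamma> n w" for n w
      using Y_field[of v] by (auto simp: tfields_def)
    show "local_order 0 (Y vac \<alpha>) (Y v \<gamma>)"
      by (rule local_order_commuting)
        (simp add: comm_0 vfield_Y, simp add: Y_vac unit_field_def oneb lin_0[OF vfield_lin[OF vfield_Y]])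
    have "comm n (Y vac \<alpha>) (Y v \<gamma>) 0 q w = Y (Y vac \<alpha> n v) (\<alpha> + \<gamma>) q w" for n q w
      unfolding Y_vac comm_unit_field[OF Y_field]
      by (simp add: unit_field_def Y_one lin_0[OF Y_lin])
    then show "\<exists>p. \<forall>q n. comm n (Y vac \<alpha>) (Y v \<gamma>) p q w =
        expand 1 (cutoff (Y vac \<alpha>) v) p (\<lambda>q n. Y (Y vac \<alpha> n v) (\<alpha> + \<gamma>) q w) q n" for w
      by (intro exI[of _ 0]) (simp add: zero_exp vfield_Y)
  qed (rule vfield_Y)+
  have emb: "Borcherds (Y (emb a) \<alpha>) (Y v \<gamma>) (\<lambda>x. Y x (\<alpha> + \<gamma>)) v" for a \<alpha> \<gamma> v
  proof -
    obtain N where N: "local_order N (cur a \<alpha>) (Y v \<gamma>)" using cur_Y_local by blast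
    show ?thesis
      unfolding Y_emb
    proof (rule Borcherds_criterion[OF vfield_cur vfield_Y N])
      have "comm n (cur a \<alpha>) (Y v \<gamma>) 0 q w = Y (cur a \<alpha> n v) (\<alpha> + \<gamma>) q w" for n q w
        by (simp add: Y_cur cur_act_def)
      then show "\<exists>p. \<forall>q n. comm n (cur a \<alpha>) (Y v \<gamma>) p q w =
          expand 1 (cutoff (cur a \<alpha>) v) p (\<lambda>q n. Y (cur a \<alpha> n v) (\<alpha> + \<gamma>) q w) q n" for w
        by (intro exI[of _ 0]) (simp add: zero_exp vfield_cur)
    qed
  qed
  have "\<forall>\<alpha> \<gamma> v. Borcherds (Y (one u) \<alpha>) (Y v \<gamma>) (\<lambda>x. Y x (\<alpha> + \<gamma>)) v"
  proof (rule generated)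
    show "\<forall>\<alpha> \<gamma> v. Borcherds (Y (x - scale c y) \<alpha>) (Y v \<gamma>) (\<lambda>x. Y x (\<alpha> + \<gamma>)) v"
      if "\<forall>\<alpha> \<gamma> v. Borcherds (Y x \<alpha>) (Y v \<gamma>) (\<lambda>x. Y x (\<alpha> + \<gamma>)) v"
        "\<forall>\<alpha> \<gamma> v. Borcherds (Y y \<alpha>) (Y v \<gamma>) (\<lambda>x. Y x (\<alpha> + \<gamma>)) v" for x y c
      using that unfolding Y_combine[of x c y] by (intro allI Borcherds_combine vfield_Y Y_lin) auto
    show "\<forall>\<delta> \<gamma> v. Borcherds (Y (cur a \<alpha> n x) \<delta>) (Y v \<gamma>) (\<lambda>x. Y x (\<delta> + \<gamma>)) v"
      if "\<forall>\<alpha> \<gamma> v. Borcherds (Y x \<alpha>) (Y v \<gamma>) (\<lambda>x. Y x (\<alpha> + \<gamma>)) v" for a \<alpha> n x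
    proof (intro allI)
      fix \<delta> \<gamma> v
      show "Borcherds (Y (cur a \<alpha> n x) \<delta>) (Y v \<gamma>) (\<lambda>x. Y x (\<delta> + \<gamma>)) v"
        by (rule Borcherds_product[where a = "emb a" and u = x and m = n and \<alpha> = \<alpha>])
          (use that in \<open>auto simp: vfield_Y Y_lin emb emb[unfolded Y_emb] Y_emb Y_cur cur_act_def\<close>)
    qed
  qed (use vac emb in auto)
  then show ?thesis by (simp add: Y_one)
qed

lemma creation_Y:
  assumes "\<And>a \<alpha> n. n \<ge> 0 \<Longrightarrow> cur a \<alpha> n vac = 0" "n \<ge> 0"
  shows "Y x \<gamma> n vac = 0"
proof -
  have "\<forall>\<gamma> n. n \<ge> 0 \<longrightarrow> Y (one x) \<gamma> n vac = 0"
    by (rule generated)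
      (use assms in \<open>auto simp: Y_vac unit_field_def Y_emb Y_combine Y_cur cur_act_def comm_def ord_prod_zero vfield_cur vfield_Y\<close>)
  then show ?thesis using assms by (simp add: Y_one)
qed

end

section \<open>Enveloping algebras\<close>

text \<open>
  Concatenation makes words an additive monoid, so that the convolution product of finitely supported functions on
  words is the product of the free algebra and its ring laws are those of the type class.
\<close>

instantiation list :: (type) monoid_add
begin
definition zero_list :: "'a list" where "zero_list = []"
definition plus_list :: "'a list \<Rightarrow> 'a list \<Rightarrow> 'a list" where "plus_list = (@)"
instance by standard (simp_all add: zero_list_def plus_list_def)
end

lemma poly_mapping_sum_single: "(\<Sum>k\<in>Poly_Mapping.keys p. Poly_Mapping.single k (Poly_Mapping.lookup p k)) = p"
proof (rule poly_mapping_eqI)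
  fix i
  have "Poly_Mapping.lookup (\<Sum>k\<in>Poly_Mapping.keys p. Poly_Mapping.single k (Poly_Mapping.lookup p k)) i =
    (\<Sum>k\<in>Poly_Mapping.keys p. if k = i then Poly_Mapping.lookup p k else 0)"
    unfolding lookup_sum by (rule sum.cong) (auto simp: lookup_single when_def)
  then show "Poly_Mapping.lookup (\<Sum>k\<in>Poly_Mapping.keys p. Poly_Mapping.single k (Poly_Mapping.lookup p k)) i
    = Poly_Mapping.lookup p i"
    by (simp add: in_keys_iff)
qed

lemma poly_mapping_single_induct [case_names zero single add]:
  fixes p :: "'a \<Rightarrow>\<^sub>0 'b::comm_monoid_add"
  assumes "P 0" "\<And>k c. k \<in> Poly_Mapping.keys p \<Longrightarrow> P (Poly_Mapping.single k c)"
    and "\<And>q q'. Poly_Mapping.keys q \<subseteq> Poly_Mapping.keys p \<Longrightarrow> Poly_Mapping.keys q' \<subseteq> Poly_Mapping.keys p \<Longrightarrow>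
       P q \<Longrightarrow> P q' \<Longrightarrow> P (q + q')"
  shows "P p"
proof -
  let ?f = "\<lambda>S. \<Sum>k\<in>S. Poly_Mapping.single k (Poly_Mapping.lookup p k)"
  have "P (?f S) \<and> Poly_Mapping.keys (?f S) \<subseteq> Poly_Mapping.keys p" if "finite S" "S \<subseteq> Poly_Mapping.keys p" for S
    using that
  proof (induction S rule: finite_induct)
    case (insert k S)
    have "Poly_Mapping.keys (Poly_Mapping.single k (Poly_Mapping.lookup p k)) \<subseteq> Poly_Mapping.keys p"
      using insert.prems by simp
    then show ?case
      using insert keys_add[of "Poly_Mapping.single k (Poly_Mapping.lookup p k)" "?f S"]
      by (auto intro!: assms)
  qed (simp add: assms)
  from this[of "Poly_Mapping.keys p"] show ?thesis by (simp add: poly_mapping_sum_single)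
qed

lemma keys_minus_subset:
  "Poly_Mapping.keys (p - q) \<subseteq> Poly_Mapping.keys p \<union> Poly_Mapping.keys (q :: 'a \<Rightarrow>\<^sub>0 'b::ab_group_add)"
  by (auto simp: in_keys_iff lookup_minus)

lemma free_algebra_mult: "p \<otimes>\<^bsub>free_algebra S\<^esub> q = p * q"
proof -
  have "p * q = (\<Sum>v\<in>Poly_Mapping.keys p. Poly_Mapping.single v (Poly_Mapping.lookup p v)) *
      (\<Sum>w\<in>Poly_Mapping.keys q. Poly_Mapping.single w (Poly_Mapping.lookup q w))"
    by (simp add: poly_mapping_sum_single)
  also have "\<dots> = (\<Sum>v\<in>Poly_Mapping.keys p. \<Sum>w\<in>Poly_Mapping.keys q.
        Poly_Mapping.single (v @ w) (Poly_Mapping.lookup p v * Poly_Mapping.lookup q w))"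
    by (simp add: sum_product mult_single plus_list_def)
  finally show ?thesis by (simp add: free_algebra_def)
qed

lemma free_algebra_simps [simp]:
  "carrier (free_algebra S) = {p. Poly_Mapping.keys p \<subseteq> lists S}"
  "\<one>\<^bsub>free_algebra S\<^esub> = 1" "\<zero>\<^bsub>free_algebra S\<^esub> = 0" "p \<oplus>\<^bsub>free_algebra S\<^esub> q = p + q"
  "p \<otimes>\<^bsub>free_algebra S\<^esub> q = p * q"
  by (simp_all add: free_algebra_mult) (simp_all add: free_algebra_def flip: zero_list_def)

lemma ring_free_algebra: "ring (free_algebra S)"
proof (rule ringI)
  show "abelian_group (free_algebra S)"
  proof (rule abelian_groupI)
    show "\<exists>y\<in>carrier (free_algebra S). y \<oplus>\<^bsub>free_algebra S\<^esub> x = \<zero>\<^bsub>free_algebra S\<^esub>"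
      if "x \<in> carrier (free_algebra S)" for x
      by (rule bexI[of _ "- x"]) (use that in auto)
  qed (auto simp: add.assoc add.commute dest: subsetD[OF Poly_Mapping.keys_add])
  show "Group.monoid (free_algebra S)"
  proof (rule Group.monoidI)
    show "p \<otimes>\<^bsub>free_algebra S\<^esub> q \<in> carrier (free_algebra S)"
      if "p \<in> carrier (free_algebra S)" "q \<in> carrier (free_algebra S)" for p q
      using that keys_mult[of p q] by (fastforce simp: plus_list_def)
  qed (auto simp: mult.assoc zero_list_def)
qed (auto simp: algebra_simps)

lemma free_algebra_minus:
  assumes "p \<in> carrier (free_algebra S)" "q \<in> carrier (free_algebra S)"
  shows "p \<ominus>\<^bsub>free_algebra S\<^esub> q = p - q"
proof -
  interpret ring "free_algebra S" by (rule ring_free_algebra)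
  have "\<ominus>\<^bsub>free_algebra S\<^esub> q = - q"
    by (rule minus_equality) (use assms in auto)
  then show ?thesis by (simp add: a_minus_def)
qed

lemma word_action_eq:
  assumes "\<And>e. scl 0 e = 0" "\<And>c d e. scl (c + d) e = scl c e + scl d e"
  shows "word_action scl \<rho> (p + q) m = word_action scl \<rho> p m + word_action scl \<rho> q m"
    and "word_action scl \<rho> (Poly_Mapping.single w c) m = scl c (foldr \<rho> w m)"
    and "word_action scl \<rho> 0 m = 0"
proof -
  show "word_action scl \<rho> (p + q) m = word_action scl \<rho> p m + word_action scl \<rho> q m"
    unfolding word_action_def by (rule setsum_keys_plus_distrib) (use assms in auto)
  show "word_action scl \<rho> (Poly_Mapping.single w c) m = scl c (foldr \<rho> w m)"
    by (cases "c = 0") (simp_all add: word_action_def assms)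
qed (simp add: word_action_def)

text \<open>
  The common setting of the two enveloping algebras of an induced module, that of a Lie algebra and that of a
  subalgebra.
\<close>

locale lie_subset =
  fixes sclL :: "complex \<Rightarrow> 'l \<Rightarrow> 'l::ab_group_add" and brL :: "'l \<Rightarrow> 'l \<Rightarrow> 'l" and S :: "'l set"
  assumes S_add: "x \<in> S \<Longrightarrow> y \<in> S \<Longrightarrow> x + y \<in> S"
    and S_scl: "x \<in> S \<Longrightarrow> sclL c x \<in> S"
    and S_br: "x \<in> S \<Longrightarrow> y \<in> S \<Longrightarrow> brL x y \<in> S"
begin

sublocale F: ring "free_algebra S" by (rule ring_free_algebra)

lemma relations_carrier: "enveloping_relations sclL brL S \<subseteq> carrier (free_algebra S)"
proof -
  have minus: "Poly_Mapping.keys (p - q) \<subseteq> lists S" if "Poly_Mapping.keys p \<subseteq> lists S" "Poly_Mapping.keys q \<subseteq> lists S"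
    for p q :: "'l list \<Rightarrow>\<^sub>0 complex"
    using that keys_minus_subset[of p q] by blast
  have single: "Poly_Mapping.keys (Poly_Mapping.single w c) \<subseteq> lists S" if "w \<in> lists S" for w and c :: complex
    using that by simp
  show ?thesis
  proof
    fix r assume "r \<in> enveloping_relations sclL brL S"
    then consider (add) x y where "r = word [x + y] - word [x] - word [y]" "x \<in> S" "y \<in> S"
      | (scl) c x where "r = word [sclL c x] - Poly_Mapping.single [x] c" "x \<in> S"
      | (br) x y where "r = word [x, y] - word [y, x] - word [brL x y]" "x \<in> S" "y \<in> S"
      unfolding enveloping_relations_def by blast
    then have "Poly_Mapping.keys r \<subseteq> lists S"
      by cases (simp_all only:, (intro minus single; simp add: S_add S_scl S_br)+)
    then show "r \<in> carrier (free_algebra S)" by simp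
  qed
qed

lemma ideal_enveloping: "ideal (enveloping_ideal sclL brL S) (free_algebra S)"
  unfolding enveloping_ideal_def by (rule F.genideal_ideal[OF relations_carrier])

lemma ring_enveloping: "ring (enveloping_algebra sclL brL S)"
  unfolding enveloping_algebra_def by (rule ideal.quotient_is_ring[OF ideal_enveloping])

lemma class_hom: "enveloping_class sclL brL S \<in> ring_hom (free_algebra S) (enveloping_algebra sclL brL S)"
  unfolding enveloping_algebra_def enveloping_class_def
  using ideal.rcos_ring_hom[OF ideal_enveloping] by simp

lemma enveloping_carrier:
  "C \<in> carrier (enveloping_algebra sclL brL S) \<longleftrightarrow>
     (\<exists>p. Poly_Mapping.keys p \<subseteq> lists S \<and> C = enveloping_class sclL brL S p)"
  by (auto simp: enveloping_algebra_def FactRing_def A_RCOSETS_def' enveloping_class_def)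

lemma class_eq: "enveloping_class sclL brL S p = {i + p | i. i \<in> enveloping_ideal sclL brL S}"
  by (auto simp: enveloping_class_def a_r_coset_def')

lemma class_eqI:
  assumes "Poly_Mapping.keys p \<subseteq> lists S" "Poly_Mapping.keys q \<subseteq> lists S" "p - q \<in> enveloping_ideal sclL brL S"
  shows "enveloping_class sclL brL S p = enveloping_class sclL brL S q"
  using F.quotient_eq_iff_same_a_r_cos[OF ideal_enveloping, of p q] assms
  by (simp add: enveloping_class_def free_algebra_minus)

lemma ideal_minimal:
  assumes "ideal J (free_algebra S)" "enveloping_relations sclL brL S \<subseteq> J"
  shows "enveloping_ideal sclL brL S \<subseteq> J"
  unfolding enveloping_ideal_def by (rule F.genideal_minimal[OF assms])

lemma relation_in_ideal: "r \<in> enveloping_relations sclL brL S \<Longrightarrow> r \<in> enveloping_ideal sclL brL S"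
  unfolding enveloping_ideal_def using F.genideal_self[OF relations_carrier] by blast

lemma zero_in_ideal: "0 \<in> enveloping_ideal sclL brL S"
  using additive_subgroup.zero_closed[OF ideal.axioms(1)[OF ideal_enveloping]] by simp

end

text \<open>
  The action is only required to behave well on a subset \<open>E\<close>, because truncated families of fields form a subset of a
  function type.
\<close>

locale lie_representation = lie_subset +
  fixes scl :: "complex \<Rightarrow> 'n \<Rightarrow> 'n::ab_group_add" and \<rho> :: "'a \<Rightarrow> 'n \<Rightarrow> 'n" and E :: "'n set"
  assumes vs: "vector_space scl"
    and E_0: "0 \<in> E" and E_add: "e \<in> E \<Longrightarrow> e' \<in> E \<Longrightarrow> e + e' \<in> E" and E_scl: "e \<in> E \<Longrightarrow> scl c e \<in> E"
    and E_act: "x \<in> S \<Longrightarrow> e \<in> E \<Longrightarrow> \<rho> x e \<in> E"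
    and act_add: "x \<in> S \<Longrightarrow> e \<in> E \<Longrightarrow> e' \<in> E \<Longrightarrow> \<rho> x (e + e') = \<rho> x e + \<rho> x e'"
    and act_scl: "x \<in> S \<Longrightarrow> e \<in> E \<Longrightarrow> \<rho> x (scl c e) = scl c (\<rho> x e)"
    and add_act: "x \<in> S \<Longrightarrow> y \<in> S \<Longrightarrow> e \<in> E \<Longrightarrow> \<rho> (x + y) e = \<rho> x e + \<rho> y e"
    and scl_act: "x \<in> S \<Longrightarrow> e \<in> E \<Longrightarrow> \<rho> (sclL c x) e = scl c (\<rho> x e)"
    and br_act: "x \<in> S \<Longrightarrow> y \<in> S \<Longrightarrow> e \<in> E \<Longrightarrow> \<rho> (brL x y) e = \<rho> x (\<rho> y e) - \<rho> y (\<rho> x e)"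
begin

sublocale V: vector_space scl by (rule vs)

lemmas wa = word_action_eq[of scl, OF V.scale_zero_left V.scale_left_distrib]

lemma foldr_E: "w \<in> lists S \<Longrightarrow> e \<in> E \<Longrightarrow> foldr \<rho> w e \<in> E"
  by (induction w) (auto simp: E_act)

lemma foldr_add: "w \<in> lists S \<Longrightarrow> e \<in> E \<Longrightarrow> e' \<in> E \<Longrightarrow> foldr \<rho> w (e + e') = foldr \<rho> w e + foldr \<rho> w e'"
  by (induction w) (auto simp: act_add foldr_E)

lemma foldr_scl: "w \<in> lists S \<Longrightarrow> e \<in> E \<Longrightarrow> foldr \<rho> w (scl c e) = scl c (foldr \<rho> w e)"
  by (induction w) (auto simp: act_scl foldr_E)

lemma word_action_E:
  assumes "Poly_Mapping.keys p \<subseteq> lists S" "e \<in> E"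
  shows "word_action scl \<rho> p e \<in> E"
proof (induction p rule: poly_mapping_single_induct)
  case (single k c)
  then show ?case using assms by (simp add: wa E_scl foldr_E subset_iff)
qed (auto simp: wa E_0 E_add)

lemma word_action_add:
  assumes "Poly_Mapping.keys p \<subseteq> lists S" "e \<in> E" "e' \<in> E"
  shows "word_action scl \<rho> p (e + e') = word_action scl \<rho> p e + word_action scl \<rho> p e'"
proof (induction p rule: poly_mapping_single_induct)
  case (single k c)
  then show ?case using assms by (auto simp: wa foldr_add subset_iff V.scale_right_distrib)
qed (simp_all add: wa)

lemma foldr_0: "w \<in> lists S \<Longrightarrow> foldr \<rho> w 0 = 0"
  using foldr_add[OF _ E_0 E_0, of w] by simp

lemma word_action_0: "Poly_Mapping.keys p \<subseteq> lists S \<Longrightarrow> word_action scl \<rho> p 0 = 0"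
  using word_action_add[OF _ E_0 E_0, of p] by simp

lemma word_action_diff:
  "word_action scl \<rho> (p - q) e = word_action scl \<rho> p e - word_action scl \<rho> q e"
  using wa(1)[of \<rho> "p - q" q e] by (simp add: algebra_simps)

lemma word_action_mult:
  assumes "Poly_Mapping.keys p \<subseteq> lists S" "Poly_Mapping.keys q \<subseteq> lists S" "e \<in> E"
  shows "word_action scl \<rho> (p * q) e = word_action scl \<rho> p (word_action scl \<rho> q e)"
proof -
  have word_mult: "word_action scl \<rho> (Poly_Mapping.single v c * q) e =
      word_action scl \<rho> (Poly_Mapping.single v c) (word_action scl \<rho> q e)" if v: "v \<in> lists S" for v c
  proof (induction q rule: poly_mapping_single_induct)
    case zero
    show ?case using v by (simp add: wa foldr_0)
  next
    case (single k d)
    then show ?case using assms v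
      by (auto simp: wa mult_single plus_list_def foldr_scl foldr_E subset_iff)
  next
    case (add q1 q2)
    then have "word_action scl \<rho> q1 e \<in> E" "word_action scl \<rho> q2 e \<in> E"
      using assms by (auto intro!: word_action_E)
    with add v show ?case
      by (simp add: distrib_left wa(1) word_action_add del: keys_single)
        (simp add: wa foldr_add V.scale_right_distrib)
  qed
  show ?thesis
  proof (induction p rule: poly_mapping_single_induct)
    case (single k c)
    then show ?case using assms(1) by (intro word_mult) auto
  qed (simp_all add: wa distrib_right)
qed

text \<open>
  The elements that annihilate \<open>E\<close> form an ideal which contains the relations.
\<close>

lemma word_action_ideal:
  assumes "p \<in> enveloping_ideal sclL brL S" "e \<in> E"
  shows "word_action scl \<rho> p e = 0"
proof -
  let ?J = "{p. Poly_Mapping.keys p \<subseteq> lists S \<and> (\<forall>e\<in>E. word_action scl \<rho> p e = 0)}"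
  have neg: "a_inv (free_algebra S) p = - p" if "p \<in> carrier (free_algebra S)" for p
    by (rule F.minus_equality) (use that in auto)
  have "enveloping_ideal sclL brL S \<subseteq> ?J"
  proof (rule ideal_minimal)
    show "ideal ?J (free_algebra S)"
    proof (rule idealI[OF ring_free_algebra])
      show "subgroup ?J (add_monoid (free_algebra S))"
      proof
        show "inv\<^bsub>add_monoid (free_algebra S)\<^esub> p \<in> ?J" if "p \<in> ?J" for p
          using that neg[of p] word_action_diff[of 0 p] by (simp add: a_inv_def wa)
        show "p \<otimes>\<^bsub>add_monoid (free_algebra S)\<^esub> q \<in> ?J" if "p \<in> ?J" "q \<in> ?J" for p q
          using that subset_trans[OF keys_add[of p q]] by (simp add: wa)
      qed (auto simp: wa)
      have mult: "Poly_Mapping.keys (p * q) \<subseteq> lists S" if "Poly_Mapping.keys p \<subseteq> lists S" "Poly_Mapping.keys q \<subseteq> lists S"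
        for p q :: "'a list \<Rightarrow>\<^sub>0 complex"
        using F.m_closed[of p q] that by simp
      show "q \<otimes>\<^bsub>free_algebra S\<^esub> p \<in> ?J" if "p \<in> ?J" "q \<in> carrier (free_algebra S)" for p q
        using that by (simp add: mult word_action_mult word_action_0)
      show "p \<otimes>\<^bsub>free_algebra S\<^esub> q \<in> ?J" if "p \<in> ?J" "q \<in> carrier (free_algebra S)" for p q
        using that by (simp add: mult word_action_mult word_action_E)
    qed
    have "word_action scl \<rho> p e = 0" if "p \<in> enveloping_relations sclL brL S" "e \<in> E" for p e
      using that unfolding enveloping_relations_def
      by (auto simp: word_action_diff wa add_act scl_act br_act)
    then show "enveloping_relations sclL brL S \<subseteq> ?J"
      using relations_carrier unfolding free_algebra_simps by blast
  qed
  with assms show ?thesis by blast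
qed

lemma enveloping_action_class:
  assumes "e \<in> E"
  shows "enveloping_action scl \<rho> (enveloping_class sclL brL S p) e = word_action scl \<rho> p e"
proof -
  have "(\<lambda>p. word_action scl \<rho> p e) ` enveloping_class sclL brL S p = {word_action scl \<rho> p e}"
    using zero_in_ideal assms by (auto simp: class_eq wa word_action_ideal image_iff)
  then show ?thesis by (simp add: enveloping_action_def)
qed

end

text \<open>
  This makes the map between the enveloping algebras of the subalgebra and of the whole algebra well defined.
\<close>

lemma enveloping_ideal_mono:
  fixes S :: "'l::ab_group_add set"
  assumes "lie_subset sclL brL S" "lie_subset sclL brL UNIV"
  shows "enveloping_ideal sclL brL S \<subseteq> enveloping_ideal sclL brL UNIV"
proof -
  interpret S: lie_subset sclL brL S by fact
  interpret T: lie_subset sclL brL UNIV by fact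
  let ?I = "enveloping_ideal sclL brL UNIV"
  let ?J = "{p. Poly_Mapping.keys p \<subseteq> lists S} \<inter> ?I"
  interpret I: ideal ?I "free_algebra UNIV" by (rule T.ideal_enveloping)
  have "enveloping_ideal sclL brL S \<subseteq> ?J"
  proof (rule S.ideal_minimal)
    have neg: "a_inv (free_algebra S) p = - p" if "p \<in> carrier (free_algebra S)" for p
      by (rule S.F.minus_equality) (use that in auto)
    have neg': "a_inv (free_algebra UNIV) p = - p" for p :: "'l list \<Rightarrow>\<^sub>0 complex"
      by (rule T.F.minus_equality) auto
    show "ideal ?J (free_algebra S)"
    proof (rule idealI[OF ring_free_algebra])
      show "subgroup ?J (add_monoid (free_algebra S))"
      proof
        show "inv\<^bsub>add_monoid (free_algebra S)\<^esub> p \<in> ?J" if "p \<in> ?J" for p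
        proof -
          have "- p \<in> ?I" using that I.a_inv_closed[of p] by (simp only: neg' Int_iff)
          then show ?thesis using that neg[of p] by (simp add: a_inv_def)
        qed
        show "x \<otimes>\<^bsub>add_monoid (free_algebra S)\<^esub> y \<in> ?J" if "x \<in> ?J" "y \<in> ?J" for x y
          using that I.a_closed[of x y] subset_trans[OF keys_add[of x y]] by simp
      qed (use T.zero_in_ideal in auto)
      show "q \<otimes>\<^bsub>free_algebra S\<^esub> p \<in> ?J" if "p \<in> ?J" "q \<in> carrier (free_algebra S)" for p q
        using that S.F.m_closed[of q p] I.I_l_closed[of p q] by simp
      show "p \<otimes>\<^bsub>free_algebra S\<^esub> q \<in> ?J" if "p \<in> ?J" "q \<in> carrier (free_algebra S)" for p q
        using that S.F.m_closed[of p q] I.I_r_closed[of p q] by simp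
    qed
    have "enveloping_relations sclL brL S \<subseteq> enveloping_relations sclL brL UNIV"
      unfolding enveloping_relations_def by blast
    then show "enveloping_relations sclL brL S \<subseteq> ?J"
      using S.relations_carrier T.relation_in_ideal unfolding free_algebra_simps by blast
  qed
  then show ?thesis by blast
qed

lemma enveloping_map_class:
  assumes "lie_subset sclL brL S" "lie_subset sclL brL UNIV"
  shows "enveloping_map sclL brL UNIV (enveloping_class sclL brL S p) = enveloping_class sclL brL UNIV p"
proof -
  interpret S: lie_subset sclL brL S by fact
  interpret T: lie_subset sclL brL UNIV by fact
  have "enveloping_class sclL brL UNIV (i + p) = enveloping_class sclL brL UNIV p"
    if "i \<in> enveloping_ideal sclL brL S" for i
    by (rule T.class_eqI) (use that enveloping_ideal_mono[OF assms] in auto)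
  then have "enveloping_class sclL brL UNIV ` enveloping_class sclL brL S p = {enveloping_class sclL brL UNIV p}"
    using S.zero_in_ideal by (auto simp: S.class_eq image_iff intro!: exI[of _ 0])
  then show ?thesis by (simp add: enveloping_map_def)
qed

section \<open>Extension of scalars\<close>

text \<open>
  The tensor product \<open>A \<otimes>\<^sub>R 'n\<close>, with \<open>R\<close> acting on \<open>A\<close> from the right through \<open>i\<close>.
\<close>

locale scalar_extension = A: ring A for A :: "('a, 'y) ring_scheme" +
  fixes R :: "('r, 'x) ring_scheme" and i :: "'r \<Rightarrow> 'a" and act :: "'r \<Rightarrow> 'n \<Rightarrow> 'n::ab_group_add"
  assumes i_closed: "x \<in> carrier R \<Longrightarrow> i x \<in> carrier A"
begin

abbreviation FA :: "('a \<times> 'n \<Rightarrow>\<^sub>0 int) monoid" where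
  "FA \<equiv> free_Abelian_group (carrier A \<times> UNIV)"
abbreviation N where "N \<equiv> tensor_subgroup R A i act"
abbreviation T where "T \<equiv> tensor_group R A i act"
abbreviation cls where "cls \<equiv> tensor_class R A i act"

sublocale FA: comm_group FA by (rule abelian_free_Abelian_group)

lemma relations_closed: "tensor_relations R A i act \<subseteq> carrier FA"
proof
  fix f assume "f \<in> tensor_relations R A i act"
  then have "\<exists>a b c. f = frag_of a - frag_of b - frag_of c \<and> {a, b, c} \<subseteq> carrier A \<times> UNIV \<or>
      f = frag_of a - frag_of b \<and> {a, b} \<subseteq> carrier A \<times> UNIV"
    unfolding tensor_relations_def by (fastforce simp: i_closed)
  then obtain a b c where "f = frag_of a - frag_of b - frag_of c \<and> {a, b, c} \<subseteq> carrier A \<times> UNIV \<or>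
      f = frag_of a - frag_of b \<and> {a, b} \<subseteq> carrier A \<times> UNIV" by blast
  then show "f \<in> carrier FA"
    using keys_minus_subset[of "frag_of a - frag_of b" "frag_of c"] keys_minus_subset[of "frag_of a" "frag_of b"]
    by (auto simp: keys_frag_of)
qed

lemma relation_keys: "f \<in> tensor_relations R A i act \<Longrightarrow> Poly_Mapping.keys f \<subseteq> carrier A \<times> UNIV"
  using subsetD[OF relations_closed, of f] by (simp only: carrier_free_Abelian_group_iff)

lemma N_subgroup: "subgroup N FA"
  unfolding tensor_subgroup_def by (rule FA.generate_is_subgroup[OF relations_closed])

lemma N_normal: "N \<lhd> FA"
  by (rule FA.subgroup_imp_normal[OF N_subgroup])

lemma comm_group_T: "comm_group T"
  unfolding tensor_group_def by (rule FA.abelian_FactGroup[OF N_subgroup])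

lemma N_0: "0 \<in> N" using subgroup.one_closed[OF N_subgroup] by simp

lemma cls_eq: "cls f = {n + f | n. n \<in> N}"
  by (auto simp: tensor_class_def r_coset_def)

lemma carrier_T: "C \<in> carrier T \<longleftrightarrow> (\<exists>f. Poly_Mapping.keys f \<subseteq> carrier A \<times> UNIV \<and> C = cls f)"
  unfolding tensor_group_def carrier_FactGroup tensor_class_def by (simp add: image_iff Bex_def)

lemma cls_add:
  assumes "Poly_Mapping.keys f \<subseteq> carrier A \<times> UNIV" "Poly_Mapping.keys g \<subseteq> carrier A \<times> UNIV"
  shows "cls f \<otimes>\<^bsub>T\<^esub> cls g = cls (f + g)"
  using normal.rcos_sum[OF N_normal, of f g] assms by (simp add: tensor_group_def tensor_class_def)

lemma one_T: "\<one>\<^bsub>T\<^esub> = cls 0"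
  by (simp add: tensor_group_def cls_eq)

lemma cls_eqI:
  assumes "Poly_Mapping.keys g \<subseteq> carrier A \<times> UNIV" "f - g \<in> N"
  shows "cls f = cls g"
proof -
  have "f \<in> N #>\<^bsub>FA\<^esub> g" using assms(2) by (auto simp: r_coset_def intro!: bexI[of _ "f - g"])
  from FA.repr_independence[OF this _ N_subgroup] show ?thesis using assms(1) by (simp add: tensor_class_def)
qed

lemma relation_N: "f \<in> tensor_relations R A i act \<Longrightarrow> f \<in> N"
  unfolding tensor_subgroup_def by (rule generate.incl)

definition ten :: "'a \<Rightarrow> 'n \<Rightarrow> ('a \<times> 'n \<Rightarrow>\<^sub>0 int) set" where
  "ten u m = cls (frag_of (u, m))"

lemma ten_closed: "u \<in> carrier A \<Longrightarrow> ten u m \<in> carrier T"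
  by (auto simp: ten_def carrier_T keys_frag_of intro!: exI[of _ "frag_of (u, m)"])

lemma ten_sum:
  assumes "u \<in> carrier A" "u' \<in> carrier A"
  shows "ten u m \<otimes>\<^bsub>T\<^esub> ten u' m' = cls (frag_of (u, m) + frag_of (u', m'))"
  unfolding ten_def by (rule cls_add) (use assms in \<open>simp_all add: keys_frag_of\<close>)

lemma keys_frag_sum:
  assumes "u \<in> carrier A" "u' \<in> carrier A"
  shows "Poly_Mapping.keys (frag_of (u, m) + frag_of (u', m')) \<subseteq> carrier A \<times> (UNIV :: 'n set)"
  using assms keys_add[of "frag_of (u, m)" "frag_of (u', m')"] by (auto simp: keys_frag_of)

lemma ten_add_left:
  assumes "u \<in> carrier A" "u' \<in> carrier A"
  shows "ten (u \<oplus>\<^bsub>A\<^esub> u') m = ten u m \<otimes>\<^bsub>T\<^esub> ten u' m"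
  unfolding ten_sum[OF assms] unfolding ten_def
proof (rule cls_eqI[OF keys_frag_sum[OF assms]])
  have "frag_of (u \<oplus>\<^bsub>A\<^esub> u', m) - frag_of (u, m) - frag_of (u', m) \<in> N"
    by (rule relation_N) (use assms in \<open>auto simp: tensor_relations_def\<close>)
  then show "frag_of (u \<oplus>\<^bsub>A\<^esub> u', m) - (frag_of (u, m) + frag_of (u', m)) \<in> N"
    by (simp add: diff_diff_eq)
qed

lemma ten_add_right:
  assumes "u \<in> carrier A"
  shows "ten u (m + m') = ten u m \<otimes>\<^bsub>T\<^esub> ten u m'"
  unfolding ten_sum[OF assms assms] unfolding ten_def
proof (rule cls_eqI[OF keys_frag_sum[OF assms assms]])
  have "frag_of (u, m + m') - frag_of (u, m) - frag_of (u, m') \<in> N"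
    by (rule relation_N) (use assms in \<open>auto simp: tensor_relations_def\<close>)
  then show "frag_of (u, m + m') - (frag_of (u, m) + frag_of (u, m')) \<in> N"
    by (simp add: diff_diff_eq)
qed

lemma ten_balanced:
  assumes "u \<in> carrier A" "x \<in> carrier R"
  shows "ten (u \<otimes>\<^bsub>A\<^esub> i x) m = ten u (act x m)"
  unfolding ten_def
proof (rule cls_eqI)
  show "frag_of (u \<otimes>\<^bsub>A\<^esub> i x, m) - frag_of (u, act x m) \<in> N"
    by (rule relation_N) (use assms in \<open>auto simp: tensor_relations_def\<close>)
qed (use assms in \<open>simp add: keys_frag_of\<close>)

lemma ten_zero_right:
  assumes "u \<in> carrier A" shows "ten u 0 = \<one>\<^bsub>T\<^esub>"
proof -
  interpret T: comm_group T by (rule comm_group_T)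
  show ?thesis using ten_add_right[OF assms, of 0 0] ten_closed[OF assms, of 0] by simp
qed

text \<open>
  Negatives need no case of their own, since \<open>- (u \<otimes> m) = u \<otimes> (- m)\<close>.
\<close>

lemma ten_induct [consumes 1, case_names ten mult]:
  assumes "C \<in> carrier T"
    and ten: "\<And>u m. u \<in> carrier A \<Longrightarrow> P (ten u m)"
    and mult: "\<And>x y. x \<in> carrier T \<Longrightarrow> y \<in> carrier T \<Longrightarrow> P x \<Longrightarrow> P y \<Longrightarrow> P (x \<otimes>\<^bsub>T\<^esub> y)"
  shows "P C"
proof -
  interpret T: comm_group T by (rule comm_group_T)
  let ?D = "\<lambda>f. Poly_Mapping.keys f \<subseteq> carrier A \<times> UNIV \<and> P (cls f) \<and> P (cls (- f))"
  obtain f where f: "Poly_Mapping.keys f \<subseteq> carrier A \<times> UNIV" "C = cls f"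
    using assms(1) carrier_T by blast
  have P0: "P (cls 0)" using ten[OF A.one_closed, of 0] by (simp add: ten_zero_right one_T)
  have "?D f"
    using f(1)
  proof (induction f rule: frag_induction)
    case zero
    show ?case using P0 by simp
  next
    case (one z)
    obtain u m where z: "z = (u, m)" "u \<in> carrier A" using one by (cases z) auto
    have "cls (- frag_of z) = ten u (- m)"
    proof -
      have k: "Poly_Mapping.keys (frag_of z) \<subseteq> carrier A \<times> UNIV" using one by (simp add: keys_frag_of)
      have kc: "cls (- frag_of z) \<in> carrier T"
        unfolding carrier_T by (rule exI[of _ "- frag_of z"]) (use k in simp)
      have "ten u (- m) \<otimes>\<^bsub>T\<^esub> ten u m = \<one>\<^bsub>T\<^esub>"
        using ten_add_right[OF z(2), of "- m" m] by (simp add: ten_zero_right z(2))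
      moreover have "cls (- frag_of z) \<otimes>\<^bsub>T\<^esub> ten u m = \<one>\<^bsub>T\<^esub>"
        using cls_add[of "- frag_of z" "frag_of z"] k by (simp add: z one_T ten_def)
      ultimately show ?thesis
        using T.inv_equality[of "cls (- frag_of z)" "ten u m"] T.inv_equality[of "ten u (- m)" "ten u m"]
          kc ten_closed[OF z(2)] by simp
    qed
    then show ?case using ten z one by (simp add: ten_def keys_frag_of)
  next
    case (diff a b)
    have in_T: "cls g \<in> carrier T" if "Poly_Mapping.keys g \<subseteq> carrier A \<times> UNIV" for g
      using that carrier_T by blast
    have "P (cls a \<otimes>\<^bsub>T\<^esub> cls (- b))" "P (cls (- a) \<otimes>\<^bsub>T\<^esub> cls b)"
      using diff by (auto intro!: mult in_T)
    moreover have "Poly_Mapping.keys (a - b) \<subseteq> carrier A \<times> UNIV"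
      using keys_minus_subset[of a b] diff by blast
    ultimately show ?case using diff by (simp add: cls_add)
  qed
  then show ?thesis using f by simp
qed

text \<open>
  For balanced \<open>h\<close> the map is constant on every coset, which is why its value there can be read off from the image.
\<close>

definition ten_lift :: "(complex \<Rightarrow> 'e \<Rightarrow> 'e) \<Rightarrow> ('a \<Rightarrow> 'n \<Rightarrow> 'e::ab_group_add) \<Rightarrow> ('a \<times> 'n \<Rightarrow>\<^sub>0 int) set \<Rightarrow> 'e" where
  "ten_lift scl h C = the_elem ((\<lambda>f. \<Sum>z\<in>Poly_Mapping.keys f. scl (of_int (Poly_Mapping.lookup f z)) (h (fst z) (snd z))) ` C)"

lemma ten_lift:
  assumes "vector_space scl"
    and h_left: "\<And>u u' m. u \<in> carrier A \<Longrightarrow> u' \<in> carrier A \<Longrightarrow> h (u \<oplus>\<^bsub>A\<^esub> u') m = h u m + h u' m"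
    and h_right: "\<And>u m m'. u \<in> carrier A \<Longrightarrow> h u (m + m') = h u m + h u m'"
    and h_bal: "\<And>u x m. u \<in> carrier A \<Longrightarrow> x \<in> carrier R \<Longrightarrow> h (u \<otimes>\<^bsub>A\<^esub> i x) m = h u (act x m)"
  shows "u \<in> carrier A \<Longrightarrow> ten_lift scl h (ten u m) = h u m"
    and "x \<in> carrier T \<Longrightarrow> y \<in> carrier T \<Longrightarrow> ten_lift scl h (x \<otimes>\<^bsub>T\<^esub> y) = ten_lift scl h x + ten_lift scl h y"
proof -
  interpret E: vector_space scl by fact
  define Psi where "Psi f = (\<Sum>z\<in>Poly_Mapping.keys f. scl (of_int (Poly_Mapping.lookup f z)) (h (fst z) (snd z)))" for f
  have Psi_add: "Psi (f + g) = Psi f + Psi g" for f g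
    unfolding Psi_def by (rule setsum_keys_plus_distrib) (auto simp: E.scale_left_distrib)
  have Psi_diff: "Psi (f - g) = Psi f - Psi g" for f g
    using Psi_add[of "f - g" g] by (simp add: algebra_simps)
  have Psi_0: "Psi 0 = 0" by (simp add: Psi_def)
  have Psi_of: "Psi (frag_of (u, m)) = h u m" for u m
    by (simp add: Psi_def keys_frag_of)
  have rel: "Psi f = 0" if "f \<in> tensor_relations R A i act" for f
    using that unfolding tensor_relations_def
    by (auto simp: Psi_diff Psi_of h_left h_right h_bal)
  have Psi_N: "Psi f = 0" if "f \<in> N" for f
    using that unfolding tensor_subgroup_def
  proof (induction rule: generate.induct)
    case (inv f)
    have "inv\<^bsub>FA\<^esub> f = - f"
      by (rule inv_free_Abelian_group) (rule relation_keys[OF inv])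
    then show ?case using rel[OF inv] Psi_diff[of 0 f] by (simp add: Psi_0)
  qed (simp_all add: Psi_0 rel Psi_add)
  have ten_lift_cls: "ten_lift scl h (cls f) = Psi f" for f
  proof -
    have "Psi ` cls f = {Psi f}" using N_0 by (auto simp: cls_eq Psi_add Psi_N image_iff intro!: exI[of _ 0])
    then show ?thesis by (simp add: ten_lift_def Psi_def)
  qed
  show "u \<in> carrier A \<Longrightarrow> ten_lift scl h (ten u m) = h u m"
    by (simp add: ten_def ten_lift_cls Psi_of)
  show "x \<in> carrier T \<Longrightarrow> y \<in> carrier T \<Longrightarrow> ten_lift scl h (x \<otimes>\<^bsub>T\<^esub> y) = ten_lift scl h x + ten_lift scl h y"
    by (auto simp: carrier_T cls_add ten_lift_cls Psi_add)
qed

abbreviation lact where "lact \<equiv> tensor_left_action R A i act"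

text \<open>
  Left multiplication maps relations to relations, hence acts on cosets.
\<close>

lemma left_action:
  assumes a: "a \<in> carrier A"
  shows "u \<in> carrier A \<Longrightarrow> lact a (ten u m) = ten (a \<otimes>\<^bsub>A\<^esub> u) m"
    and "x \<in> carrier T \<Longrightarrow> y \<in> carrier T \<Longrightarrow> lact a (x \<otimes>\<^bsub>T\<^esub> y) = lact a x \<otimes>\<^bsub>T\<^esub> lact a y"
    and "x \<in> carrier T \<Longrightarrow> lact a x \<in> carrier T"
proof -
  define L where "L = frag_extend (\<lambda>(u, m :: 'n). frag_of (a \<otimes>\<^bsub>A\<^esub> u, m))"
  have L_of: "L (frag_of (u, m)) = frag_of (a \<otimes>\<^bsub>A\<^esub> u, m)" for u m by (simp add: L_def)
  have L_0: "L 0 = 0" by (simp add: L_def)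
  have L_add: "L (f + g) = L f + L g" for f g by (simp add: L_def frag_extend_add)
  have L_diff: "L (f - g) = L f - L g" for f g by (simp add: L_def frag_extend_diff)
  have L_keys: "Poly_Mapping.keys (L f) \<subseteq> carrier A \<times> UNIV" if "Poly_Mapping.keys f \<subseteq> carrier A \<times> UNIV" for f
  proof -
    have "Poly_Mapping.keys (L f) \<subseteq> (\<Union>x\<in>Poly_Mapping.keys f. Poly_Mapping.keys ((\<lambda>(u, m). frag_of (a \<otimes>\<^bsub>A\<^esub> u, m)) x))"
      unfolding L_def by (rule keys_frag_extend)
    also have "\<dots> \<subseteq> carrier A \<times> UNIV" using that a by (auto simp: keys_frag_of)
    finally show ?thesis .
  qed
  have rel: "L f \<in> tensor_relations R A i act" if "f \<in> tensor_relations R A i act" for f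
  proof -
    consider (1) u u' m where "f = frag_of (u \<oplus>\<^bsub>A\<^esub> u', m) - frag_of (u, m) - frag_of (u', m)" "u \<in> carrier A" "u' \<in> carrier A"
      | (2) u m m' where "f = frag_of (u, m + m') - frag_of (u, m) - frag_of (u, m')" "u \<in> carrier A"
      | (3) u x m where "f = frag_of (u \<otimes>\<^bsub>A\<^esub> i x, m) - frag_of (u, act x m)" "u \<in> carrier A" "x \<in> carrier R"
      using \<open>f \<in> tensor_relations R A i act\<close> unfolding tensor_relations_def by blast
    then show ?thesis
    proof cases
      case 1
      then have "L f = frag_of (a \<otimes>\<^bsub>A\<^esub> u \<oplus>\<^bsub>A\<^esub> a \<otimes>\<^bsub>A\<^esub> u', m) - frag_of (a \<otimes>\<^bsub>A\<^esub> u, m) - frag_of (a \<otimes>\<^bsub>A\<^esub> u', m)"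
        using a by (simp add: L_diff L_of A.r_distr)
      with 1 a show ?thesis unfolding tensor_relations_def by blast
    next
      case 2
      then have "L f = frag_of (a \<otimes>\<^bsub>A\<^esub> u, m + m') - frag_of (a \<otimes>\<^bsub>A\<^esub> u, m) - frag_of (a \<otimes>\<^bsub>A\<^esub> u, m')"
        by (simp add: L_diff L_of)
      with 2 a show ?thesis unfolding tensor_relations_def by blast
    next
      case 3
      then have "L f = frag_of ((a \<otimes>\<^bsub>A\<^esub> u) \<otimes>\<^bsub>A\<^esub> i x, m) - frag_of (a \<otimes>\<^bsub>A\<^esub> u, act x m)"
        using a by (simp add: L_diff L_of A.m_assoc i_closed)
      with 3 a show ?thesis unfolding tensor_relations_def by blast
    qed
  qed
  have L_N: "L f \<in> N" if "f \<in> N" for f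
    using that unfolding tensor_subgroup_def
  proof (induction rule: generate.induct)
    case one
    show ?case using generate.one[of FA "tensor_relations R A i act"] by (simp only: one_free_Abelian_group L_0)
  next
    case (incl f)
    then show ?case by (intro generate.incl rel)
  next
    case (inv f)
    have "inv\<^bsub>FA\<^esub> f = - f"
      by (rule inv_free_Abelian_group) (rule relation_keys[OF inv])
    moreover have "inv\<^bsub>FA\<^esub> (L f) = - L f"
      by (rule inv_free_Abelian_group) (rule relation_keys[OF rel[OF inv]])
    moreover have "L (- f) = - L f" using L_diff[of 0 f] by (simp add: L_0)
    ultimately have "L (inv\<^bsub>FA\<^esub> f) = inv\<^bsub>FA\<^esub> (L f)" by (simp only:)
    then show ?case using generate.inv[OF rel[OF inv], of FA] by (simp only:)
  next
    case (eng f g)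
    then show ?case using generate.eng[of "L f" FA _ "L g"] by (simp only: L_add mult_free_Abelian_group)
  qed
  have lact_cls: "lact a (cls f) = cls (L f)" if "Poly_Mapping.keys f \<subseteq> carrier A \<times> UNIV" for f
  proof -
    have "cls (L (n + f)) = cls (L f)" if "n \<in> N" for n
      by (rule cls_eqI) (use L_N[OF that] L_keys \<open>Poly_Mapping.keys f \<subseteq> _\<close> in \<open>auto simp: L_add\<close>)
    then have "(\<lambda>f. cls (L f)) ` cls f = {cls (L f)}"
      using N_0 by (auto simp: cls_eq[of f] image_iff intro!: exI[of _ 0])
    then show ?thesis by (simp add: tensor_left_action_def L_def)
  qed
  show "u \<in> carrier A \<Longrightarrow> lact a (ten u m) = ten (a \<otimes>\<^bsub>A\<^esub> u) m"
    by (simp add: ten_def lact_cls keys_frag_of L_of)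
  show "x \<in> carrier T \<Longrightarrow> lact a x \<in> carrier T"
  proof -
    assume "x \<in> carrier T"
    then obtain f where "Poly_Mapping.keys f \<subseteq> carrier A \<times> UNIV" "x = cls f" unfolding carrier_T by blast
    with L_keys show ?thesis unfolding carrier_T by (intro exI[of _ "L f"]) (simp add: lact_cls)
  qed
  show "x \<in> carrier T \<Longrightarrow> y \<in> carrier T \<Longrightarrow> lact a (x \<otimes>\<^bsub>T\<^esub> y) = lact a x \<otimes>\<^bsub>T\<^esub> lact a y"
  proof -
    assume "x \<in> carrier T" "y \<in> carrier T"
    then obtain f g where fg: "Poly_Mapping.keys f \<subseteq> carrier A \<times> UNIV" "x = cls f"
      "Poly_Mapping.keys g \<subseteq> carrier A \<times> UNIV" "y = cls g" unfolding carrier_T by blast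
    then have "Poly_Mapping.keys (f + g) \<subseteq> carrier A \<times> UNIV" using keys_add[of f g] by blast
    with fg show ?thesis by (simp add: cls_add lact_cls L_keys L_add)
  qed
qed

end

section \<open>The toroidal Lie algebra and its induced module\<close>

lemma toroidal_induct [case_names monomial central add]:
  fixes x :: "('g::ab_group_add, 'r::finite) toroidal"
  assumes "\<And>a i. i \<in> Poly_Mapping.keys (fst x) \<Longrightarrow> P (monomial a (fst i) (snd i))" "\<And>c. P (0, c)"
    and "\<And>x y. P x \<Longrightarrow> P y \<Longrightarrow> P (x + y)"
  shows "P x"
proof -
  have "P (fst x, 0)"
  proof (rule poly_mapping_single_induct[where P = "\<lambda>f. P (f, 0)"])
    show "P (Poly_Mapping.single k c, 0)" if "k \<in> Poly_Mapping.keys (fst x)" for k c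
      using assms(1)[OF that, of c] by (simp add: monomial_def)
    show "P (q + q', 0)" if "P (q, 0)" "P (q', 0)" for q q'
      using assms(3)[OF that] by simp
  qed (rule assms(2))
  from assms(3)[OF this assms(2)[of "snd x"]] show ?thesis by simp
qed

lemma toroidal_plus_iff:
  "x \<in> toroidal_plus \<longleftrightarrow> (\<forall>i. fst i < 0 \<longrightarrow> Poly_Mapping.lookup (fst x) i = 0)"
proof -
  have "(i \<in> Poly_Mapping.keys (fst x) \<longrightarrow> fst i \<ge> 0) = (fst i < 0 \<longrightarrow> Poly_Mapping.lookup (fst x) i = 0)" for i
    by (auto simp: in_keys_iff)
  moreover have "x \<in> toroidal_plus \<longleftrightarrow> (\<forall>i. i \<in> Poly_Mapping.keys (fst x) \<longrightarrow> fst i \<ge> 0)"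
    by (cases x) (simp only: toroidal_plus_def mem_Collect_eq prod.case fst_conv Ball_def)
  ultimately show ?thesis by (simp only:)
qed

context complex_lie_algebra_form
begin

lemma bracket_add_left: "bracket (a + b) c = bracket a c + bracket b c"
  and bracket_add_right: "bracket a (b + c) = bracket a b + bracket a c"
  and bracket_scale_left: "bracket (scale s a) c = scale s (bracket a c)"
  and bracket_scale_right: "bracket a (scale s c) = scale s (bracket a c)"
  and form_add_left: "form (a + b) c = form a c + form b c"
  and form_add_right: "form a (b + c) = form a b + form a c"
  and form_scale_left: "form (scale s a) c = s * form a c"
  and form_scale_right: "form a (scale s c) = s * form a c"
  using bracket_linear_left bracket_linear_right form_linear_left form_linear_right
  unfolding Vector_Spaces.linear_def module_hom_def module_hom_axioms_def by auto

lemma bracket_0 [simp]: "bracket 0 a = 0" "bracket a 0 = 0" "form 0 a = 0" "form a 0 = 0"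
  using bracket_scale_left[of 0 0 a] bracket_scale_right[of a 0 0] form_scale_left[of 0 0 a]
    form_scale_right[of a 0 0] by simp_all

lemma bracket_anti: "bracket a b = - bracket b a"
proof -
  have "0 = bracket (a + b) (a + b)" by (simp only: bracket_self)
  also have "\<dots> = bracket a b + bracket b a"
    by (simp only: bracket_add_left bracket_add_right) (simp add: bracket_self)
  finally show ?thesis by (simp add: eq_neg_iff_add_eq_0)
qed

lemma bracket_minus: "bracket a (- b) = - bracket a b"
  using bracket_add_right[of a "- b" b] by (simp add: eq_neg_iff_add_eq_0)

lemma form_minus: "form (- a) b = - form a b"
  using form_add_left[of "- a" a b] by (simp add: eq_neg_iff_add_eq_0)

abbreviation tscale where "tscale \<equiv> toroidal_scale scale"
abbreviation tbracket where "tbracket \<equiv> toroidal_bracket bracket form"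
abbreviation bscale where "bscale \<equiv> base_scale scale"
abbreviation bact where "bact \<equiv> base_action scale bracket form"

lemma tbracket_add_left: "tbracket (x + y) z = tbracket x z + tbracket y z"
proof -
  have "(\<Sum>i\<in>Poly_Mapping.keys (fst x + fst y). \<Sum>j\<in>Poly_Mapping.keys (fst z).
        Poly_Mapping.single (i + j)
          (bracket (Poly_Mapping.lookup (fst x + fst y) i) (Poly_Mapping.lookup (fst z) j))) =
    (\<Sum>i\<in>Poly_Mapping.keys (fst x). \<Sum>j\<in>Poly_Mapping.keys (fst z).
        Poly_Mapping.single (i + j) (bracket (Poly_Mapping.lookup (fst x) i) (Poly_Mapping.lookup (fst z) j)))
    + (\<Sum>i\<in>Poly_Mapping.keys (fst y). \<Sum>j\<in>Poly_Mapping.keys (fst z).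
        Poly_Mapping.single (i + j) (bracket (Poly_Mapping.lookup (fst y) i) (Poly_Mapping.lookup (fst z) j)))"
    by (rule setsum_keys_plus_distrib) (simp_all add: bracket_add_left single_add sum.distrib)
  moreover have "(\<Sum>i\<in>Poly_Mapping.keys (fst x + fst y). \<Sum>j\<in>Poly_Mapping.keys (fst z).
        if i + j = 0 then of_int (fst i) * form (Poly_Mapping.lookup (fst x + fst y) i) (Poly_Mapping.lookup (fst z) j) else 0) =
    (\<Sum>i\<in>Poly_Mapping.keys (fst x). \<Sum>j\<in>Poly_Mapping.keys (fst z).
        if i + j = 0 then of_int (fst i) * form (Poly_Mapping.lookup (fst x) i) (Poly_Mapping.lookup (fst z) j) else 0)
    + (\<Sum>i\<in>Poly_Mapping.keys (fst y). \<Sum>j\<in>Poly_Mapping.keys (fst z).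
        if i + j = 0 then of_int (fst i) * form (Poly_Mapping.lookup (fst y) i) (Poly_Mapping.lookup (fst z) j) else 0)"
  proof (rule setsum_keys_plus_distrib)
    fix k
    show "(\<Sum>j\<in>Poly_Mapping.keys (fst z). if k + j = 0
       then of_int (fst k) * form (Poly_Mapping.lookup (fst x) k + Poly_Mapping.lookup (fst y) k) (Poly_Mapping.lookup (fst z) j) else 0) =
      (\<Sum>j\<in>Poly_Mapping.keys (fst z). if k + j = 0 then of_int (fst k) * form (Poly_Mapping.lookup (fst x) k) (Poly_Mapping.lookup (fst z) j) else 0) +
      (\<Sum>j\<in>Poly_Mapping.keys (fst z). if k + j = 0 then of_int (fst k) * form (Poly_Mapping.lookup (fst y) k) (Poly_Mapping.lookup (fst z) j) else 0)"
      unfolding sum.distrib[symmetric] by (rule sum.cong) (simp_all add: form_add_left algebra_simps)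
  qed (simp cong: if_cong)
  ultimately show ?thesis unfolding toroidal_bracket_def fst_add by simp
qed

lemma tbracket_add_right: "tbracket z (x + y) = tbracket z x + tbracket z y"
proof -
  have A: "(\<Sum>j\<in>Poly_Mapping.keys (fst x + fst y).
        Poly_Mapping.single (i + j) (bracket (Poly_Mapping.lookup (fst z) i) (Poly_Mapping.lookup (fst x + fst y) j))) =
    (\<Sum>j\<in>Poly_Mapping.keys (fst x).
        Poly_Mapping.single (i + j) (bracket (Poly_Mapping.lookup (fst z) i) (Poly_Mapping.lookup (fst x) j)))
    + (\<Sum>j\<in>Poly_Mapping.keys (fst y).
        Poly_Mapping.single (i + j) (bracket (Poly_Mapping.lookup (fst z) i) (Poly_Mapping.lookup (fst y) j)))" for i
    by (rule setsum_keys_plus_distrib) (simp_all add: bracket_add_right single_add)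
  have B: "(\<Sum>j\<in>Poly_Mapping.keys (fst x + fst y).
        if i + j = 0 then of_int (fst i) * form (Poly_Mapping.lookup (fst z) i) (Poly_Mapping.lookup (fst x + fst y) j) else 0) =
    (\<Sum>j\<in>Poly_Mapping.keys (fst x).
        if i + j = 0 then of_int (fst i) * form (Poly_Mapping.lookup (fst z) i) (Poly_Mapping.lookup (fst x) j) else 0)
    + (\<Sum>j\<in>Poly_Mapping.keys (fst y).
        if i + j = 0 then of_int (fst i) * form (Poly_Mapping.lookup (fst z) i) (Poly_Mapping.lookup (fst y) j) else 0)" for i
    by (rule setsum_keys_plus_distrib) (simp_all add: form_add_right algebra_simps)
  show ?thesis
    unfolding toroidal_bracket_def fst_add A B sum.distrib by simp
qed

lemma tscale_add: "tscale c (x + y) = tscale c x + tscale c y"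
proof -
  have "(\<Sum>i\<in>Poly_Mapping.keys (fst x + fst y). Poly_Mapping.single i (scale c (Poly_Mapping.lookup (fst x + fst y) i))) =
    (\<Sum>i\<in>Poly_Mapping.keys (fst x). Poly_Mapping.single i (scale c (Poly_Mapping.lookup (fst x) i))) +
    (\<Sum>i\<in>Poly_Mapping.keys (fst y). Poly_Mapping.single i (scale c (Poly_Mapping.lookup (fst y) i)))"
    by (rule setsum_keys_plus_distrib) (simp_all add: scale_right_distrib single_add)
  then show ?thesis by (simp add: toroidal_scale_def distrib_left)
qed

lemma tscale_monomial: "tscale c (monomial a n m) = monomial (scale c a) n m"
  by (cases "a = 0") (simp_all add: toroidal_scale_def monomial_def zero_prod_def)

lemma tscale_scalar: "tscale c (0, d) = (0, c * d)"
  by (simp add: toroidal_scale_def)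

lemma tbracket_scalar [simp]: "tbracket (0, c) x = 0" "tbracket x (0, c) = 0"
  by (simp_all add: toroidal_bracket_def zero_prod_def)

lemma lie_subset_UNIV: "lie_subset tscale tbracket UNIV"
  by unfold_locales auto

lemma lie_subset_plus: "lie_subset tscale tbracket (toroidal_plus :: ('a, 'r::finite) toroidal set)"
proof
  fix x y :: "('a, 'r) toroidal" assume x: "x \<in> toroidal_plus"
  show "tscale c x \<in> toroidal_plus" for c
    using x unfolding toroidal_plus_iff toroidal_scale_def
    by (auto simp: lookup_sum lookup_single when_def intro!: sum.neutral)
  assume y: "y \<in> toroidal_plus"
  show "x + y \<in> toroidal_plus"
    using x y by (simp add: toroidal_plus_iff lookup_add)
  show "tbracket x y \<in> toroidal_plus"
    unfolding toroidal_plus_iff toroidal_bracket_def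
  proof (intro allI impI)
    fix i :: "int \<times> (int ^ 'r)" assume i: "fst i < 0"
    have "Poly_Mapping.lookup (Poly_Mapping.single (k + j)
        (bracket (Poly_Mapping.lookup (fst x) k) (Poly_Mapping.lookup (fst y) j))) i = 0"
      if "k \<in> Poly_Mapping.keys (fst x)" "j \<in> Poly_Mapping.keys (fst y)" for k j
    proof -
      have "fst k \<ge> 0" "fst j \<ge> 0" using x y that by (auto simp: toroidal_plus_def)
      with i have "k + j \<noteq> i" by auto
      then show ?thesis by (simp add: lookup_single)
    qed
    then show "Poly_Mapping.lookup (fst (\<Sum>i\<in>Poly_Mapping.keys (fst x). \<Sum>j\<in>Poly_Mapping.keys (fst y).
        Poly_Mapping.single (i + j) (bracket (Poly_Mapping.lookup (fst x) i) (Poly_Mapping.lookup (fst y) j)),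
        \<Sum>i\<in>Poly_Mapping.keys (fst x). \<Sum>j\<in>Poly_Mapping.keys (fst y).
        if i + j = 0 then of_int (fst i) * form (Poly_Mapping.lookup (fst x) i) (Poly_Mapping.lookup (fst y) j) else 0)) i = 0"
      by (simp add: lookup_sum)
  qed
qed

lemma vector_space_bscale: "vector_space bscale"
  by unfold_locales (auto simp: base_scale_def scale_right_distrib scale_left_distrib algebra_simps)

lemma bact_add_left: "bact l (x + y) v = bact l x v + bact l y v"
proof -
  let ?f = "\<lambda>i a. if fst i = 0 then (bracket a (fst v), 0)
        else if fst i = 1 then (0, form a (fst v) * l) else (0 :: 'a \<times> complex)"
  have "(\<Sum>i\<in>Poly_Mapping.keys (fst x + fst y). ?f i (Poly_Mapping.lookup (fst x + fst y) i)) =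
    (\<Sum>i\<in>Poly_Mapping.keys (fst x). ?f i (Poly_Mapping.lookup (fst x) i)) +
    (\<Sum>i\<in>Poly_Mapping.keys (fst y). ?f i (Poly_Mapping.lookup (fst y) i))"
    by (rule setsum_keys_plus_distrib[where f = ?f]) (auto simp: bracket_add_left form_add_left algebra_simps zero_prod_def)
  then show ?thesis
    unfolding base_action_def fst_add snd_add by (simp add: base_scale_def scale_left_distrib algebra_simps)
qed

lemma bact_scalar: "bact l (0, c) v = bscale (c * l) v"
  by (simp add: base_action_def)

lemma bact_monomial: "bact l (monomial a k m) v =
    (if k = 0 then (bracket a (fst v), 0) else if k = 1 then (0, form a (fst v) * l) else 0)"
  using base_action_monomial[OF complex_lie_algebra_form_axioms, of l a k m "fst v" "snd v"] by simp

lemma bact_add_right: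
  fixes x :: "('a, 'r::finite) toroidal"
  shows "bact l x (v + w) = bact l x v + bact l x w"
proof (induction x rule: toroidal_induct)
  case (monomial a i)
  show ?case by (simp add: bact_monomial bracket_add_right form_add_right distrib_right)
next
  case (central c)
  show ?case by (simp add: bact_scalar base_scale_def scale_right_distrib distrib_left)
next
  case (add x y)
  then show ?case by (simp only: bact_add_left ac_simps)
qed

lemma bact_0: "bact l 0 v = 0"
  using bact_scalar[of l 0 v] by (simp add: base_scale_def zero_prod_def)

lemma bscale_add: "bscale c (v + w) = bscale c v + bscale c w"
  by (simp add: base_scale_def scale_right_distrib distrib_left)

lemma bact_scale_right:
  fixes x :: "('a, 'r::finite) toroidal"
  shows "bact l x (bscale c v) = bscale c (bact l x v)"
proof (induction x rule: toroidal_induct)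
  case (monomial a i)
  show ?case by (simp add: bact_monomial bracket_scale_right form_scale_right base_scale_def zero_prod_def)
next
  case (central d)
  show ?case by (simp add: bact_scalar base_scale_def ac_simps)
next
  case (add x y)
  then show ?case by (simp only: bact_add_left bscale_add)
qed

lemma bact_scale_left:
  fixes x :: "('a, 'r::finite) toroidal"
  shows "bact l (tscale c x) v = bscale c (bact l x v)"
proof (induction x rule: toroidal_induct)
  case (monomial a i)
  show ?case
    by (simp add: bact_monomial tscale_monomial bracket_scale_left form_scale_left base_scale_def zero_prod_def)
next
  case (central d)
  show ?case by (simp add: bact_scalar tscale_scalar base_scale_def ac_simps)
next
  case (add x y)
  then show ?case by (simp only: bact_add_left bscale_add tscale_add)
qed

text \<open>
  On monomials, the case \<open>k = 0\<close> is the Jacobi identity and the case \<open>k = 1\<close> the invariance of the form. The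
  central term of the bracket does not contribute, since for nonnegative exponents \<open>m\<^sub>0 + n\<^sub>0 = 0\<close> forces \<open>m\<^sub>0 = 0\<close>.
\<close>

lemma bact_bracket:
  fixes x y :: "('a, 'r::finite) toroidal"
  assumes "x \<in> toroidal_plus" "y \<in> toroidal_plus"
  shows "bact l (tbracket x y) v = bact l x (bact l y v) - bact l y (bact l x v)"
proof (induction x rule: toroidal_induct)
  case (monomial a i)
  then have i: "fst i \<ge> 0" using assms(1) by (auto simp: toroidal_plus_def)
  show ?case
  proof (induction y rule: toroidal_induct)
    case (monomial b j)
    then have j: "fst j \<ge> 0" using assms(2) by (auto simp: toroidal_plus_def)
    have jac: "bracket (bracket a b) c = bracket a (bracket b c) - bracket b (bracket a c)" for c
    proof -
      have "bracket b (bracket c a) = - bracket b (bracket a c)"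
        unfolding bracket_anti[of c a] by (rule bracket_minus)
      then have "bracket a (bracket b c) - bracket b (bracket a c) - bracket (bracket a b) c = 0"
        using jacobi_identity[of a b c] unfolding bracket_anti[of c "bracket a b"] by simp
      then show ?thesis by simp
    qed
    have inv: "form a (bracket b c) = form (bracket a b) c" "form b (bracket a c) = - form (bracket a b) c" for c
    proof -
      show "form a (bracket b c) = form (bracket a b) c" by (rule form_invariant[symmetric])
      have "form b (bracket a c) = form (- bracket a b) c"
        unfolding bracket_anti[of a b] by (simp add: form_invariant)
      then show "form b (bracket a c) = - form (bracket a b) c" by (simp add: form_minus)
    qed
    have "(if fst i + fst j = 0 \<and> snd i + snd j = 0 then of_int (fst i) * form a b else 0) = 0"
      using i j by auto
    then have "tbracket (monomial a (fst i) (snd i)) (monomial b (fst j) (snd j)) =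
        monomial (bracket a b) (fst i + fst j) (snd i + snd j) + (0, 0)"
      using toroidal_bracket_monomial[OF complex_lie_algebra_form_axioms, of a "fst i" "snd i" b "fst j" "snd j"] by simp
    then have br: "tbracket (monomial a (fst i) (snd i)) (monomial b (fst j) (snd j)) =
        monomial (bracket a b) (fst i + fst j) (snd i + snd j)"
      by (simp add: zero_prod_def[symmetric])
    show ?case
      unfolding br bact_monomial using i j by (auto simp: jac inv zero_prod_def)
  next
    case (add y y')
    then show ?case by (simp add: tbracket_add_right bact_add_left bact_add_right)
  qed (simp add: bact_scalar bact_scale_right bact_0)
next
  case (add x x')
  then show ?case by (simp add: tbracket_add_left bact_add_left bact_add_right)
qed (simp add: bact_scalar bact_scale_right bact_0)

lemma lie_representation_base:
  "lie_representation tscale tbracket (toroidal_plus :: ('a, 'r::finite) toroidal set) bscale (bact l) UNIV"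
  by (intro lie_representation.intro lie_representation_axioms.intro lie_subset_plus vector_space_bscale)
    (simp_all add: bact_add_left bact_add_right bact_scale_left bact_scale_right bact_bracket)

end

section \<open>The induced module\<close>

locale induced_representation = complex_lie_algebra_form scale bracket form
  for scale :: "complex \<Rightarrow> 'g::ab_group_add \<Rightarrow> 'g" and bracket form +
  fixes level :: complex and V :: "(complex, ('g, 'r::finite) induced) module"
  defines "V \<equiv> induced_module scale bracket form level"
begin

abbreviation UA :: "(('g, 'r) toroidal list \<Rightarrow>\<^sub>0 complex) set ring" where
  "UA \<equiv> U_toroidal scale bracket form TYPE(('g, 'r) toroidal)"
abbreviation UR :: "(('g, 'r) toroidal list \<Rightarrow>\<^sub>0 complex) set ring" where
  "UR \<equiv> U_toroidal_plus scale bracket form TYPE(('g, 'r) toroidal)"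

definition ucl :: "(('g, 'r) toroidal list \<Rightarrow>\<^sub>0 complex) \<Rightarrow> (('g, 'r) toroidal list \<Rightarrow>\<^sub>0 complex) set" where
  "ucl = enveloping_class tscale tbracket UNIV"

sublocale L: lie_subset tscale tbracket "UNIV :: ('g, 'r) toroidal set"
  by (rule lie_subset_UNIV)

sublocale P: lie_representation tscale tbracket "toroidal_plus :: ('g, 'r) toroidal set" bscale "bact level" UNIV
  by (rule lie_representation_base)

lemma ucl_hom: "ucl p \<in> carrier UA" "ucl p \<otimes>\<^bsub>UA\<^esub> ucl q = ucl (p * q)" "ucl p \<oplus>\<^bsub>UA\<^esub> ucl q = ucl (p + q)" "\<one>\<^bsub>UA\<^esub> = ucl 1"
  using ring_hom_memE[OF L.class_hom] by (simp_all add: ucl_def U_toroidal_def)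

lemma carrier_UA: "C \<in> carrier UA \<longleftrightarrow> (\<exists>p. C = ucl p)"
  by (simp add: U_toroidal_def L.enveloping_carrier ucl_def)

lemma carrier_UR: "C \<in> carrier UR \<longleftrightarrow> (\<exists>q. Poly_Mapping.keys q \<subseteq> lists toroidal_plus \<and>
    C = enveloping_class tscale tbracket toroidal_plus q)"
  by (simp add: U_toroidal_plus_def P.enveloping_carrier)

lemma i_class: "enveloping_map tscale tbracket UNIV (enveloping_class tscale tbracket toroidal_plus q) =
    ucl (q :: ('g, 'r) toroidal list \<Rightarrow>\<^sub>0 complex)"
  unfolding ucl_def by (rule enveloping_map_class[OF lie_subset_plus lie_subset_UNIV])

sublocale T: scalar_extension UA UR "enveloping_map tscale tbracket UNIV" "enveloping_action bscale (bact level)"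
proof (rule scalar_extension.intro)
  show "ring UA" unfolding U_toroidal_def by (rule L.ring_enveloping)
  show "scalar_extension_axioms UA UR (enveloping_map tscale tbracket UNIV)"
    by unfold_locales (auto simp: carrier_UR i_class ucl_hom)
qed

definition tens :: "(('g, 'r) toroidal list \<Rightarrow>\<^sub>0 complex) \<Rightarrow> 'g \<times> complex \<Rightarrow> ('g, 'r) induced" where
  "tens p m = T.ten (ucl p) m"

definition act :: "(('g, 'r) toroidal list \<Rightarrow>\<^sub>0 complex) \<Rightarrow> ('g, 'r) induced \<Rightarrow> ('g, 'r) induced" where
  "act p = T.lact (ucl p)"

lemma V_simps:
  "carrier V = carrier T.T" "x \<oplus>\<^bsub>V\<^esub> y = x \<otimes>\<^bsub>T.T\<^esub> y" "\<zero>\<^bsub>V\<^esub> = \<one>\<^bsub>T.T\<^esub>"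
  "c \<odot>\<^bsub>V\<^esub> x = act (Poly_Mapping.single [] c) x"
  by (simp_all add: V_def induced_module_def Let_def act_def ucl_def induced_left_action_def)

lemma induced_action_eq: "induced_action scale bracket form level x v = act (word [x]) v"
  by (simp add: induced_action_def act_def ucl_def induced_left_action_def)

lemma vacuum_eq: "induced_vacuum scale bracket form level = tens 1 (0, 1)"
  by (simp add: induced_vacuum_def induced_class_def tens_def T.ten_def ucl_hom)

lemma embed_eq: "induced_embed scale bracket form level a = tens 1 (a, 0)"
  by (simp add: induced_embed_def induced_class_def tens_def T.ten_def ucl_hom)

lemma abelian_group_V: "abelian_group V"
proof -
  interpret G: comm_group T.T by (rule T.comm_group_T)
  show ?thesis
  proof (rule abelian_groupI)
    show "\<exists>y\<in>carrier V. y \<oplus>\<^bsub>V\<^esub> x = \<zero>\<^bsub>V\<^esub>" if "x \<in> carrier V" for x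
      using that by (intro bexI[of _ "inv\<^bsub>T.T\<^esub> x"]) (simp_all add: V_simps)
  qed (simp_all add: V_simps G.m_ac)
qed

sublocale VG: abelian_group V by (rule abelian_group_V)

lemma tens_closed [simp]: "tens p m \<in> carrier V"
  by (simp add: tens_def T.ten_closed ucl_hom V_simps)

lemma tens_add_left: "tens (p + q) m = tens p m \<oplus>\<^bsub>V\<^esub> tens q m"
  using T.ten_add_left[of "ucl p" "ucl q" m] by (simp add: tens_def ucl_hom V_simps)

lemma tens_add_right: "tens p (m + m') = tens p m \<oplus>\<^bsub>V\<^esub> tens p m'"
  using T.ten_add_right[of "ucl p" m m'] by (simp add: tens_def ucl_hom V_simps)

lemma tens_balanced:
  assumes "Poly_Mapping.keys q \<subseteq> lists toroidal_plus"
  shows "tens (p * q) m = tens p (word_action bscale (bact level) q m)"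
proof -
  have "enveloping_class tscale tbracket toroidal_plus q \<in> carrier UR" using assms carrier_UR by blast
  from T.ten_balanced[OF ucl_hom(1) this, of p m] show ?thesis
    by (simp add: tens_def i_class ucl_hom P.enveloping_action_class)
qed

lemma V_induct [consumes 1, case_names tens add]:
  assumes "v \<in> carrier V" "\<And>p m. Q (tens p m)"
    and "\<And>x y. x \<in> carrier V \<Longrightarrow> y \<in> carrier V \<Longrightarrow> Q x \<Longrightarrow> Q y \<Longrightarrow> Q (x \<oplus>\<^bsub>V\<^esub> y)"
  shows "Q v"
proof -
  have "v \<in> carrier T.T" using assms(1) by (simp add: V_simps)
  then show ?thesis
  proof (induction v rule: T.ten_induct)
    case (ten C m)
    then obtain p where "C = ucl p" using carrier_UA by blast
    then show ?case using assms(2)[of p m] by (simp add: tens_def)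
  next
    case (mult x y)
    then show ?case using assms(3)[of x y] by (simp add: V_simps)
  qed
qed

lemma act_tt: "act p (tens q m) = tens (p * q) m"
  using T.left_action(1)[of "ucl p" "ucl q" m] by (simp add: act_def tens_def ucl_hom)

lemma act_add_right: "x \<in> carrier V \<Longrightarrow> y \<in> carrier V \<Longrightarrow> act p (x \<oplus>\<^bsub>V\<^esub> y) = act p x \<oplus>\<^bsub>V\<^esub> act p y"
  using T.left_action(2)[of "ucl p" x y] by (simp add: act_def ucl_hom V_simps)

lemma act_closed [simp]: "x \<in> carrier V \<Longrightarrow> act p x \<in> carrier V"
  using T.left_action(3)[of "ucl p" x] by (simp add: act_def ucl_hom V_simps)

lemma act_add_left: "x \<in> carrier V \<Longrightarrow> act (p + q) x = act p x \<oplus>\<^bsub>V\<^esub> act q x"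
proof (induction x rule: V_induct)
  case (tens r m)
  then show ?case by (simp add: act_tt distrib_right tens_add_left)
next
  case (add x y)
  then show ?case by (simp add: act_add_right VG.a_ac)
qed

lemma act_mult: "x \<in> carrier V \<Longrightarrow> act (p * q) x = act p (act q x)"
  by (induction x rule: V_induct) (simp_all add: act_tt act_add_right mult.assoc)

lemma act_one: "x \<in> carrier V \<Longrightarrow> act 1 x = x"
  by (induction x rule: V_induct) (simp_all add: act_tt act_add_right)

lemma act_cong: "p - q \<in> enveloping_ideal tscale tbracket UNIV \<Longrightarrow> act p = act q"
  unfolding act_def ucl_def by (subst L.class_eqI[of p q]) simp_all

lemma act_relation_add: "act (word [x + y]) = act (word [x] + word [y])"
  by (rule act_cong, rule L.relation_in_ideal)
    (unfold enveloping_relations_def diff_diff_eq[symmetric], blast)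

lemma act_relation_scale: "act (word [tscale c x]) = act (Poly_Mapping.single [x] c)"
  by (rule act_cong, rule L.relation_in_ideal) (unfold enveloping_relations_def, blast)

lemma act_relation_bracket: "act (word [x, y]) = act (word [y, x] + word [tbracket x y])"
  by (rule act_cong, rule L.relation_in_ideal)
    (unfold enveloping_relations_def diff_diff_eq[symmetric], blast)

lemma word_mult: "word v * word w = word (v @ w)"
  and single_mult: "Poly_Mapping.single [] c * Poly_Mapping.single w d = Poly_Mapping.single w (c * d)"
    "Poly_Mapping.single w d * Poly_Mapping.single [] c = Poly_Mapping.single w (d * c)"
  by (simp_all add: mult_single plus_list_def)

lemma word_Nil: "word [] = 1"
  by (simp only: zero_list_def[symmetric] single_one)

lemma module_V: "Module.module (ring_of_type_algebra :: complex ring) V"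
proof (rule moduleI)
  show "cring (ring_of_type_algebra :: complex ring)" by (rule cring_from_type_algebra)
  show "abelian_group V" by (rule abelian_group_V)
  show "(c \<oplus>\<^bsub>ring_of_type_algebra\<^esub> d) \<odot>\<^bsub>V\<^esub> x = c \<odot>\<^bsub>V\<^esub> x \<oplus>\<^bsub>V\<^esub> d \<odot>\<^bsub>V\<^esub> x" if "x \<in> carrier V" for c d x
    using that by (simp add: V_simps(4) ring_of_type_algebra_def single_add act_add_left)
  show "(c \<otimes>\<^bsub>ring_of_type_algebra\<^esub> d) \<odot>\<^bsub>V\<^esub> x = c \<odot>\<^bsub>V\<^esub> (d \<odot>\<^bsub>V\<^esub> x)" if "x \<in> carrier V" for c d x
    using act_mult[OF that, of "Poly_Mapping.single [] c" "Poly_Mapping.single [] d"]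
    by (simp add: V_simps(4) ring_of_type_algebra_def single_mult)
  show "\<one>\<^bsub>ring_of_type_algebra\<^esub> \<odot>\<^bsub>V\<^esub> x = x" if "x \<in> carrier V" for x
    using that by (simp add: V_simps(4) ring_of_type_algebra_def word_Nil act_one)
qed (simp_all add: V_simps(4) act_add_right)

sublocale V: Module.module "ring_of_type_algebra :: complex ring" V by (rule module_V)

abbreviation lie_act where "lie_act x \<equiv> act (word [x])"

lemma smult_closed [simp]: "x \<in> carrier V \<Longrightarrow> c \<odot>\<^bsub>V\<^esub> x \<in> carrier V"
  by (simp add: V_simps(4))

lemma lie_act_smult: "v \<in> carrier V \<Longrightarrow> lie_act x (c \<odot>\<^bsub>V\<^esub> v) = c \<odot>\<^bsub>V\<^esub> lie_act x v"
  by (simp add: V_simps(4) single_mult flip: act_mult)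

lemma lie_act_add: "v \<in> carrier V \<Longrightarrow> lie_act (x + y) v = lie_act x v \<oplus>\<^bsub>V\<^esub> lie_act y v"
  by (simp add: act_relation_add act_add_left)

lemma lie_act_tscale: "v \<in> carrier V \<Longrightarrow> lie_act (tscale c x) v = c \<odot>\<^bsub>V\<^esub> lie_act x v"
  by (simp add: act_relation_scale V_simps(4) single_mult flip: act_mult)

lemma lie_act_bracket:
  "v \<in> carrier V \<Longrightarrow> lie_act x (lie_act y v) = lie_act y (lie_act x v) \<oplus>\<^bsub>V\<^esub> lie_act (tbracket x y) v"
  using act_relation_bracket[of x y] by (simp add: act_add_left word_mult flip: act_mult)

lemma tens_one_base: "x \<in> toroidal_plus \<Longrightarrow> lie_act x (tens 1 m) = tens 1 (bact level x m)"
  using tens_balanced[of "word [x]" 1 m] by (simp add: act_tt P.wa base_scale_def)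

lemma tens_one_scale: "tens 1 (bscale c m) = c \<odot>\<^bsub>V\<^esub> tens 1 m"
  using tens_balanced[of "Poly_Mapping.single [] c" 1 m] by (simp add: V_simps(4) act_tt P.wa)

text \<open>
  Words span the enveloping algebra, and a word acts letter by letter.
\<close>

lemma V_generated [consumes 1, case_names tens add smult act]:
  assumes "v \<in> carrier V" and tens: "\<And>m. Q (tens 1 m)"
    and add: "\<And>x y. x \<in> carrier V \<Longrightarrow> y \<in> carrier V \<Longrightarrow> Q x \<Longrightarrow> Q y \<Longrightarrow> Q (x \<oplus>\<^bsub>V\<^esub> y)"
    and smult: "\<And>c x. x \<in> carrier V \<Longrightarrow> Q x \<Longrightarrow> Q (c \<odot>\<^bsub>V\<^esub> x)"
    and act: "\<And>y x. x \<in> carrier V \<Longrightarrow> Q x \<Longrightarrow> Q (lie_act y x)"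
  shows "Q v"
  using assms(1)
proof (induction v rule: V_induct)
  case (tens p m)
  have w: "Q (tens (word w) m)" for w
  proof (induction w)
    case Nil
    show ?case using assms(2) by (simp add: word_Nil)
  next
    case (Cons y w)
    have "tens (word (y # w)) m = lie_act y (tens (word w) m)" by (simp add: act_tt word_mult)
    with Cons show ?case by (simp add: assms(5))
  qed
  have s: "tens (Poly_Mapping.single w c) m = c \<odot>\<^bsub>V\<^esub> tens (word w) m" for w c
    by (simp add: V_simps(4) act_tt single_mult)
  show ?case
  proof (induction p rule: poly_mapping_single_induct)
    case zero
    have "tens 0 m = 0 \<odot>\<^bsub>V\<^esub> tens 1 m" using s[of "[]" 0] by (simp add: word_Nil)
    then show ?case using assms(2,4) by simp
  next
    case (single w c)
    show ?case by (subst s) (rule smult[OF tens_closed w])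
  next
    case (add p q)
    then show ?case by (simp add: tens_add_left assms(3))
  qed
qed (rule add)

text \<open>
  The central element is a scalar on the generators and commutes with the action.
\<close>

lemma lie_act_scalar: "v \<in> carrier V \<Longrightarrow> lie_act (0, c) v = (c * level) \<odot>\<^bsub>V\<^esub> v"
proof (induction v rule: V_generated)
  case (tens m)
  have "lie_act (0, c) (tens 1 m) = tens 1 (bact level ((0, c) :: ('g, 'r) toroidal) m)"
    by (rule tens_one_base) (simp add: toroidal_plus_def)
  then show ?case by (simp add: bact_scalar tens_one_scale)
next
  case (add x y)
  then show ?case by (simp add: act_add_right V.smult_r_distr ring_of_type_algebra_def)
next
  case (smult d x)
  then show ?case by (simp add: lie_act_smult) (simp add: V_simps(4) single_mult mult.commute flip: act_mult)
next
  case (act y x)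
  have "tscale 0 0 = (0 :: ('g, 'r) toroidal)"
    by (simp add: toroidal_scale_def zero_prod_def)
  then have "lie_act 0 x = \<zero>\<^bsub>V\<^esub>"
    using lie_act_tscale[OF act(1), of 0 0] V.smult_l_null[OF act_closed[OF act(1)]]
    by (simp add: ring_of_type_algebra_def)
  then have "lie_act (0, c) (lie_act y x) = lie_act y (lie_act (0, c) x)"
    using lie_act_bracket[OF act(1), of "(0, c)" y] act(1) by simp
  then show ?case using act by (simp add: lie_act_smult)
qed

text \<open>
  Frobenius reciprocity: \<open>(p, m) \<mapsto> p \<cdot> \<phi>(m)\<close> is balanced over the enveloping algebra of the subalgebra, and so
  factors through the tensor product.
\<close>

lemma universal:
  assumes "lie_representation tscale tbracket (UNIV :: ('g, 'r) toroidal set) scl \<rho> E"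
    and \<phi>_E: "\<And>m. \<phi> m \<in> E" and \<phi>_add: "\<And>m m'. \<phi> (m + m') = \<phi> m + \<phi> m'"
    and \<phi>_scale: "\<And>c m. \<phi> (bscale c m) = scl c (\<phi> m)"
    and \<phi>_act: "\<And>x m. x \<in> toroidal_plus \<Longrightarrow> \<rho> x (\<phi> m) = \<phi> (bact level x m)"
  obtains \<Phi> where "\<And>v. v \<in> carrier V \<Longrightarrow> \<Phi> v \<in> E"
    and "\<And>v w. v \<in> carrier V \<Longrightarrow> w \<in> carrier V \<Longrightarrow> \<Phi> (v \<oplus>\<^bsub>V\<^esub> w) = \<Phi> v + \<Phi> w"
    and "\<And>c v. v \<in> carrier V \<Longrightarrow> \<Phi> (c \<odot>\<^bsub>V\<^esub> v) = scl c (\<Phi> v)"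
    and "\<And>x v. v \<in> carrier V \<Longrightarrow> \<Phi> (lie_act x v) = \<rho> x (\<Phi> v)"
    and "\<And>m. \<Phi> (tens 1 m) = \<phi> m"
proof -
  interpret R: lie_representation tscale tbracket "UNIV :: ('g, 'r) toroidal set" scl \<rho> E by fact
  define h where "h C m = enveloping_action scl \<rho> C (\<phi> m)" for C m
  have h_ucl: "h (ucl p) m = word_action scl \<rho> p (\<phi> m)" for p m
    unfolding h_def ucl_def by (rule R.enveloping_action_class[OF \<phi>_E])
  have \<phi>_word: "\<phi> (word_action bscale (bact level) q m) = word_action scl \<rho> q (\<phi> m)"
    if "Poly_Mapping.keys q \<subseteq> lists toroidal_plus" for q m
  proof (induction q rule: poly_mapping_single_induct)
    case zero
    show ?case using \<phi>_scale[of 0 0] by (simp add: P.wa R.wa)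
  next
    case (single w c)
    have "foldr \<rho> w (\<phi> m) = \<phi> (foldr (bact level) w m)" if "w \<in> lists toroidal_plus" for w
      using that by (induction w) (auto simp: \<phi>_act)
    with single that show ?case by (auto simp: P.wa R.wa \<phi>_scale subset_iff)
  next
    case (add q q')
    then show ?case by (simp add: P.wa R.wa \<phi>_add)
  qed
  define \<Phi> where "\<Phi> = T.ten_lift scl h"
  have lift: "\<And>C m. C \<in> carrier UA \<Longrightarrow> \<Phi> (T.ten C m) = h C m"
    "\<And>x y. x \<in> carrier T.T \<Longrightarrow> y \<in> carrier T.T \<Longrightarrow> \<Phi> (x \<otimes>\<^bsub>T.T\<^esub> y) = \<Phi> x + \<Phi> y"
  proof -
    have 1: "h (C \<oplus>\<^bsub>UA\<^esub> D) m = h C m + h D m" if "C \<in> carrier UA" "D \<in> carrier UA" for C D m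
      using that by (auto simp: carrier_UA ucl_hom h_ucl R.wa)
    have 2: "h C (m + m') = h C m + h C m'" if "C \<in> carrier UA" for C m m'
      using that by (auto simp: carrier_UA h_ucl \<phi>_add R.word_action_add \<phi>_E)
    have 3: "h (C \<otimes>\<^bsub>UA\<^esub> enveloping_map tscale tbracket UNIV x) m = h C (enveloping_action bscale (bact level) x m)"
      if "C \<in> carrier UA" "x \<in> carrier UR" for C x m
      using that by (auto simp: carrier_UA carrier_UR i_class ucl_hom h_ucl P.enveloping_action_class \<phi>_word
         R.word_action_mult \<phi>_E)
    show "\<And>C m. C \<in> carrier UA \<Longrightarrow> \<Phi> (T.ten C m) = h C m"
      unfolding \<Phi>_def by (rule T.ten_lift(1)[OF R.vs 1 2 3])
    show "\<And>x y. x \<in> carrier T.T \<Longrightarrow> y \<in> carrier T.T \<Longrightarrow> \<Phi> (x \<otimes>\<^bsub>T.T\<^esub> y) = \<Phi> x + \<Phi> y"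
      unfolding \<Phi>_def by (rule T.ten_lift(2)[OF R.vs 1 2 3])
  qed
  have \<Phi>_tt: "\<Phi> (tens p m) = word_action scl \<rho> p (\<phi> m)" for p m
    by (simp add: tens_def lift(1) ucl_hom h_ucl)
  have \<Phi>_add: "\<Phi> (v \<oplus>\<^bsub>V\<^esub> w) = \<Phi> v + \<Phi> w" if "v \<in> carrier V" "w \<in> carrier V" for v w
    using lift(2) that by (simp add: V_simps)
  have \<Phi>_E: "\<Phi> v \<in> E" if "v \<in> carrier V" for v
    using that by (induction v rule: V_induct) (simp_all add: \<Phi>_tt \<Phi>_add R.word_action_E \<phi>_E R.E_add)
  have \<Phi>_act: "\<Phi> (act p v) = word_action scl \<rho> p (\<Phi> v)" if "v \<in> carrier V" for p v
    using that by (induction v rule: V_induct)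
      (simp_all add: act_tt \<Phi>_tt R.word_action_mult \<phi>_E act_add_right \<Phi>_add R.word_action_add \<Phi>_E)
  show ?thesis
  proof (rule that[of \<Phi>])
    show "\<Phi> (c \<odot>\<^bsub>V\<^esub> v) = scl c (\<Phi> v)" if "v \<in> carrier V" for c v
      using that by (simp add: V_simps(4) \<Phi>_act R.wa)
    show "\<Phi> (lie_act x v) = \<rho> x (\<Phi> v)" if "v \<in> carrier V" for x v
      using that by (simp add: \<Phi>_act R.wa)
    show "\<Phi> (tens 1 m) = \<phi> m" for m
      using \<Phi>_tt[of 1 m] R.wa(2)[of \<rho> "[]" 1 "\<phi> m"] by (simp add: word_Nil)
  qed (use \<Phi>_E \<Phi>_add in auto)
qed

end

section \<open>Complex modules as subspaces of a vector space type\<close>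

definition pscale :: "complex \<Rightarrow> ('v \<Rightarrow>\<^sub>0 complex) \<Rightarrow> 'v \<Rightarrow>\<^sub>0 complex" where
  "pscale c f = Poly_Mapping.map ((*) c) f"

lemma lookup_pscale: "Poly_Mapping.lookup (pscale c f) k = c * Poly_Mapping.lookup f k"
  by (simp add: pscale_def Poly_Mapping.map.rep_eq when_def)

lemma vector_space_pscale: "vector_space pscale"
  by unfold_locales (auto intro!: poly_mapping_eqI simp: lookup_pscale lookup_add algebra_simps)

text \<open>
  A complement of \<open>K\<close> is spanned by the vectors that extend a basis of \<open>K\<close> to a basis of the whole space.
\<close>

lemma projection_exists:
  assumes "vector_space scl" and K: "Modules.module.subspace scl K"
  obtains \<pi> where "Vector_Spaces.linear scl scl \<pi>" "\<And>x. \<pi> x = 0 \<longleftrightarrow> x \<in> K" "\<And>x. x - \<pi> x \<in> K"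
proof -
  interpret vector_space scl by fact
  interpret VP: vector_space_pair scl scl by unfold_locales
  obtain B where B: "B \<subseteq> K" "independent B" "K \<subseteq> span B"
    by (rule maximal_independent_subset[of K])
  obtain C where C: "B \<subseteq> C" "independent C" "UNIV \<subseteq> span C"
    by (rule maximal_independent_subset_extend[OF subset_UNIV B(2)])
  obtain \<pi> where \<pi>: "Vector_Spaces.linear scl scl \<pi>" "\<forall>x\<in>C. \<pi> x = (if x \<in> B then 0 else x)"
    using VP.linear_independent_extend[OF C(2), of "\<lambda>x. if x \<in> B then 0 else x"] by blast
  interpret P: Vector_Spaces.linear scl scl \<pi> by fact
  have diff: "x - \<pi> x \<in> K" for x
  proof -
    have "x \<in> span C" using C(3) by auto
    then show ?thesis
    proof (induction x rule: span_induct_alt)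
      case base
      show ?case using subspace_0[OF K] by (simp add: P.zero)
    next
      case (step c x y)
      have "x - \<pi> x \<in> K" using \<pi>(2) step(1) B(1) subspace_0[OF K] by auto
      then have "scl c (x - \<pi> x) + (y - \<pi> y) \<in> K"
        using step(2) by (intro subspace_add[OF K] subspace_scale[OF K])
      then show ?case by (simp add: P.add P.scale algebra_simps)
    qed
  qed
  have "\<pi> x = 0" if "x \<in> K" for x
  proof (rule P.eq_0_on_span[of B])
    show "x \<in> span B" using that B(3) by blast
  qed (use \<pi>(2) C(1) in auto)
  moreover have "x \<in> K" if "\<pi> x = 0" for x using diff[of x] that by simp
  ultimately have "\<pi> x = 0 \<longleftrightarrow> x \<in> K" for x by (rule iffI[rotated])
  then show ?thesis by (rule that[OF \<pi>(1) _ diff])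
qed

text \<open>
  The calculus of fields is developed on a vector space type, whereas the induced module is a carrier set. A
  module is the image of the free vector space on its own elements; the kernel of this surjection \<open>p\<close> has a complement,
  on which \<open>p\<close> is invertible. So the module is a direct summand of a vector space type, with inclusion \<open>i\<close>.
\<close>

lemma complex_module_embedding:
  fixes V :: "(complex, 'v, 'm) module_scheme"
  assumes "Module.module (ring_of_type_algebra :: complex ring) V"
  obtains i :: "'v \<Rightarrow> ('v \<Rightarrow>\<^sub>0 complex)" and p
  where "\<And>x. p x \<in> carrier V" "\<And>x y. p (x + y) = p x \<oplus>\<^bsub>V\<^esub> p y" "\<And>c x. p (pscale c x) = c \<odot>\<^bsub>V\<^esub> p x"
    "\<And>v. v \<in> carrier V \<Longrightarrow> p (i v) = v"
    "\<And>v w. v \<in> carrier V \<Longrightarrow> w \<in> carrier V \<Longrightarrow> i (v \<oplus>\<^bsub>V\<^esub> w) = i v + i w"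
    "\<And>c v. v \<in> carrier V \<Longrightarrow> i (c \<odot>\<^bsub>V\<^esub> v) = pscale c (i v)"
proof -
  interpret V: Module.module "ring_of_type_algebra :: complex ring" V by fact
  interpret S: vector_space pscale by (rule vector_space_pscale)
  note [simp] = ring_of_type_algebra_def
  have smult: "c \<odot>\<^bsub>V\<^esub> v \<in> carrier V" if "v \<in> carrier V" for c v
    using V.smult_closed[of c v] that by simp
  have null: "0 \<odot>\<^bsub>V\<^esub> v = \<zero>\<^bsub>V\<^esub>" if "v \<in> carrier V" for v
    using V.smult_l_null[OF that] by simp
  have dist: "(c + d) \<odot>\<^bsub>V\<^esub> v = c \<odot>\<^bsub>V\<^esub> v \<oplus>\<^bsub>V\<^esub> d \<odot>\<^bsub>V\<^esub> v" if "v \<in> carrier V" for c d v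
    using V.smult_l_distr[of c d v] that by simp
  have assoc: "(c * d) \<odot>\<^bsub>V\<^esub> v = c \<odot>\<^bsub>V\<^esub> (d \<odot>\<^bsub>V\<^esub> v)" if "v \<in> carrier V" for c d v
    using V.smult_assoc1[of c d v] that by simp
  have one: "1 \<odot>\<^bsub>V\<^esub> v = v" if "v \<in> carrier V" for v
    using V.smult_one[OF that] by simp
  define p where "p f = (\<Oplus>\<^bsub>V\<^esub>v\<in>Poly_Mapping.keys f \<inter> carrier V. Poly_Mapping.lookup f v \<odot>\<^bsub>V\<^esub> v)"
    for f :: "'v \<Rightarrow>\<^sub>0 complex"
  have p_eq: "p f = (\<Oplus>\<^bsub>V\<^esub>v\<in>S. Poly_Mapping.lookup f v \<odot>\<^bsub>V\<^esub> v)"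
    if "finite S" "Poly_Mapping.keys f \<inter> carrier V \<subseteq> S" "S \<subseteq> carrier V" for f S
    unfolding p_def
    by (rule V.add.finprod_mono_neutral_cong_left) (use that in \<open>auto simp: in_keys_iff null smult subset_iff\<close>)
  have p_closed: "p f \<in> carrier V" for f
    unfolding p_def by (rule V.finsum_closed) (auto intro: smult)
  have p_add: "p (f + g) = p f \<oplus>\<^bsub>V\<^esub> p g" for f g
  proof -
    let ?S = "(Poly_Mapping.keys f \<union> Poly_Mapping.keys g) \<inter> carrier V"
    have "p (f + g) = (\<Oplus>\<^bsub>V\<^esub>v\<in>?S. Poly_Mapping.lookup (f + g) v \<odot>\<^bsub>V\<^esub> v)"
      by (rule p_eq) (use keys_add[of f g] in auto)
    also have "\<dots> = (\<Oplus>\<^bsub>V\<^esub>v\<in>?S. Poly_Mapping.lookup f v \<odot>\<^bsub>V\<^esub> v \<oplus>\<^bsub>V\<^esub> Poly_Mapping.lookup g v \<odot>\<^bsub>V\<^esub> v)"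
      by (rule V.finsum_cong') (auto simp: lookup_add dist smult)
    also have "\<dots> = (\<Oplus>\<^bsub>V\<^esub>v\<in>?S. Poly_Mapping.lookup f v \<odot>\<^bsub>V\<^esub> v) \<oplus>\<^bsub>V\<^esub> (\<Oplus>\<^bsub>V\<^esub>v\<in>?S. Poly_Mapping.lookup g v \<odot>\<^bsub>V\<^esub> v)"
      by (rule V.finsum_addf) (auto simp: smult)
    also have "\<dots> = p f \<oplus>\<^bsub>V\<^esub> p g"
      by (subst (1 2) p_eq[of ?S, symmetric]) auto
    finally show ?thesis .
  qed
  have p_single: "p (Poly_Mapping.single v c) = c \<odot>\<^bsub>V\<^esub> v" if "v \<in> carrier V" for v c
    using p_eq[of "{v}" "Poly_Mapping.single v c"] that smult by (simp add: V.finsum_insert)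
  have p_0: "p 0 = \<zero>\<^bsub>V\<^esub>" by (simp add: p_def)
  have p_scale: "p (pscale c f) = c \<odot>\<^bsub>V\<^esub> p f" for c f
  proof (induction f rule: poly_mapping_single_induct)
    case zero
    then show ?case using V.smult_r_null[of c] by (simp add: p_0)
  next
    case (single v d)
    have "pscale c (Poly_Mapping.single v d) = Poly_Mapping.single v (c * d)"
      by (rule poly_mapping_eqI) (simp add: lookup_pscale lookup_single when_def)
    moreover have "p (Poly_Mapping.single v d) = \<zero>\<^bsub>V\<^esub>" if "v \<notin> carrier V" for d
    proof -
      have "Poly_Mapping.keys (Poly_Mapping.single v d) \<inter> carrier V = {}" using that by auto
      then show ?thesis by (simp add: p_def)
    qed
    ultimately show ?case
      using V.smult_r_null[of c] by (cases "v \<in> carrier V") (simp_all add: p_single assoc)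
  next
    case (add f g)
    then show ?case
      using V.smult_r_distr[of c "p f" "p g"] by (simp add: S.scale_right_distrib p_add p_closed)
  qed
  have p_diff: "p (f - g) = \<zero>\<^bsub>V\<^esub> \<longleftrightarrow> p f = p g" for f g
  proof -
    have "p f = p (f - g) \<oplus>\<^bsub>V\<^esub> p g" using p_add[of "f - g" g] by simp
    then show ?thesis using V.M.add.r_cancel_one[of "p g" "p (f - g)"] p_closed by auto
  qed
  let ?K = "{f. p f = \<zero>\<^bsub>V\<^esub>}"
  have "S.subspace ?K"
    unfolding S.subspace_def using V.smult_r_null by (auto simp: p_0 p_add p_scale)
  then obtain \<pi> where \<pi>: "Vector_Spaces.linear pscale pscale \<pi>"
    "\<And>x. \<pi> x = 0 \<longleftrightarrow> x \<in> ?K" "\<And>x. x - \<pi> x \<in> ?K"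
    using projection_exists[OF vector_space_pscale] by blast
  interpret P: Vector_Spaces.linear pscale pscale \<pi> by fact
  have \<pi>_eq: "\<pi> x = \<pi> y" if "p x = p y" for x y
    using \<pi>(2)[of "x - y"] that by (simp add: p_diff P.diff)
  have p_\<pi>: "p (\<pi> x) = p x" for x using \<pi>(3)[of x] by (simp add: p_diff)
  show ?thesis
  proof (rule that[of p "\<lambda>v. \<pi> (Poly_Mapping.single v 1)"])
    show "\<pi> (Poly_Mapping.single (v \<oplus>\<^bsub>V\<^esub> w) 1) = \<pi> (Poly_Mapping.single v 1) + \<pi> (Poly_Mapping.single w 1)"
      if "v \<in> carrier V" "w \<in> carrier V" for v w
      unfolding P.add[symmetric] by (rule \<pi>_eq) (use that in \<open>simp add: p_add p_single one\<close>)
    show "\<pi> (Poly_Mapping.single (c \<odot>\<^bsub>V\<^esub> v) 1) = pscale c (\<pi> (Poly_Mapping.single v 1))"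
      if "v \<in> carrier V" for c v
      unfolding P.scale[symmetric] by (rule \<pi>_eq) (use that in \<open>simp add: p_scale p_single one smult\<close>)
  qed (use p_closed p_add p_scale p_\<pi> p_single one in auto)
qed

section \<open>The field representation and the state-field correspondence\<close>

context induced_representation
begin

lemma tens_one_zero: "tens 1 0 = \<zero>\<^bsub>V\<^esub>"
  using T.ten_zero_right[of "ucl 1"] by (simp add: tens_def ucl_hom V_simps)

lemma zero_smult: "v \<in> carrier V \<Longrightarrow> 0 \<odot>\<^bsub>V\<^esub> v = \<zero>\<^bsub>V\<^esub>"
  using V.smult_l_null[of v] by (simp add: ring_of_type_algebra_def)

lemma smult_zero: "c \<odot>\<^bsub>V\<^esub> \<zero>\<^bsub>V\<^esub> = \<zero>\<^bsub>V\<^esub>"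
  using V.smult_r_null[of c] by (simp add: ring_of_type_algebra_def)

lemma act_zero: "act q \<zero>\<^bsub>V\<^esub> = \<zero>\<^bsub>V\<^esub>"
  using act_tt[of q 1 0] T.ten_zero_right[of "ucl q"] tens_one_zero by (simp add: tens_def ucl_hom V_simps)

text \<open>
  Induction on generation: on \<open>1 \<otimes> m\<close> exponents \<open>n \<ge> 2\<close> act as \<open>0\<close>, and
  \<open>a\<^sub>n b\<^sub>k v = b\<^sub>k a\<^sub>n v + [a, b]\<^sub>n\<^sub>+\<^sub>k v\<close> once \<open>n + k \<noteq> 0\<close>. The bound is uniform in the other exponents,
  and may depend on \<open>a\<close>.
\<close>

lemma restricted:
  assumes "v \<in> carrier V"
  shows "\<exists>N. \<forall>n\<ge>N. \<forall>m. lie_act (monomial a n m) v = \<zero>\<^bsub>V\<^esub>"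
proof -
  have "\<forall>a. \<exists>N. \<forall>n\<ge>N. \<forall>m. lie_act (monomial a n m) v = \<zero>\<^bsub>V\<^esub>"
    using assms
  proof (induction v rule: V_generated)
    case (tens b)
    have "lie_act (monomial a n m) (tens 1 b) = \<zero>\<^bsub>V\<^esub>" if "n \<ge> 2" for a n m
    proof -
      have "monomial a n m \<in> (toroidal_plus :: ('g, 'r) toroidal set)" using that by (simp add: toroidal_plus_def monomial_def)
      then show ?thesis using that by (simp add: tens_one_base bact_monomial tens_one_zero)
    qed
    then show ?case by blast
  next
    case (add x y)
    show ?case
    proof
      fix a
      obtain N1 N2 where "\<forall>n\<ge>N1. \<forall>m. lie_act (monomial a n m) x = \<zero>\<^bsub>V\<^esub>" "\<forall>n\<ge>N2. \<forall>m. lie_act (monomial a n m) y = \<zero>\<^bsub>V\<^esub>"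
        using add by meson
      then show "\<exists>N. \<forall>n\<ge>N. \<forall>m. lie_act (monomial a n m) (x \<oplus>\<^bsub>V\<^esub> y) = \<zero>\<^bsub>V\<^esub>"
        using add(1,2) by (intro exI[of _ "max N1 N2"]) (simp add: act_add_right)
    qed
  next
    case (smult c x)
    then show ?case by (simp add: lie_act_smult) (metis smult_zero)
  next
    case (act y x)
    have "\<forall>a. \<exists>N. \<forall>n\<ge>N. \<forall>m. lie_act (monomial a n m) (lie_act y x) = \<zero>\<^bsub>V\<^esub>"
    proof (induction y rule: toroidal_induct)
      case (monomial b i)
      show ?case
      proof
        fix a
        obtain N1 where N1: "\<forall>n\<ge>N1. \<forall>m. lie_act (monomial a n m) x = \<zero>\<^bsub>V\<^esub>" using act by meson
        obtain N2 where N2: "\<forall>n\<ge>N2. \<forall>m. lie_act (monomial (bracket a b) n m) x = \<zero>\<^bsub>V\<^esub>" using act by meson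
        have "lie_act (monomial a n m) (lie_act (monomial b (fst i) (snd i)) x) = \<zero>\<^bsub>V\<^esub>"
          if n: "n \<ge> N1" "n \<ge> N2 - fst i" "n \<ge> 1 - fst i" for n m
        proof -
          have "tbracket (monomial a n m) (monomial b (fst i) (snd i)) = monomial (bracket a b) (n + fst i) (m + snd i)"
            using toroidal_bracket_monomial[OF complex_lie_algebra_form_axioms, of a n m b "fst i" "snd i"] n
            by (simp add: zero_prod_def[symmetric])
          then show ?thesis
            using lie_act_bracket[OF act(1), of "monomial a n m" "monomial b (fst i) (snd i)"] N1 N2 n
            by (simp add: act_zero)
        qed
        then show "\<exists>N. \<forall>n\<ge>N. \<forall>m. lie_act (monomial a n m) (lie_act (monomial b (fst i) (snd i)) x) = \<zero>\<^bsub>V\<^esub>"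
          by (intro exI[of _ "max N1 (max (N2 - fst i) (1 - fst i))"]) simp
      qed
    next
      case (central c)
      then show ?case using act by (simp add: lie_act_scalar lie_act_smult) (metis smult_zero)
    next
      case (add y y')
      show ?case
      proof
        fix a
        obtain N1 N2 where "\<forall>n\<ge>N1. \<forall>m. lie_act (monomial a n m) (lie_act y x) = \<zero>\<^bsub>V\<^esub>"
          "\<forall>n\<ge>N2. \<forall>m. lie_act (monomial a n m) (lie_act y' x) = \<zero>\<^bsub>V\<^esub>"
          using add by meson
        then show "\<exists>N. \<forall>n\<ge>N. \<forall>m. lie_act (monomial a n m) (lie_act (y + y') x) = \<zero>\<^bsub>V\<^esub>"
          using act(1) by (intro exI[of _ "max N1 N2"]) (simp add: lie_act_add act_add_right)
      qed
    qed
    then show ?case .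
  qed
  then show ?thesis by blast
qed

end

locale induced_embedding = induced_representation scale bracket form level V
  for scale :: "complex \<Rightarrow> 'g::ab_group_add \<Rightarrow> 'g" and bracket form level
    and V :: "(complex, ('g, 'r::finite) induced) module" +
  fixes i :: "('g, 'r) induced \<Rightarrow> (('g, 'r) induced \<Rightarrow>\<^sub>0 complex)"
    and p :: "(('g, 'r) induced \<Rightarrow>\<^sub>0 complex) \<Rightarrow> ('g, 'r) induced"
  assumes p_closed [simp]: "p x \<in> carrier V" and p_add: "p (x + y) = p x \<oplus>\<^bsub>V\<^esub> p y"
    and p_scale: "p (pscale c x) = c \<odot>\<^bsub>V\<^esub> p x"
    and p_i [simp]: "v \<in> carrier V \<Longrightarrow> p (i v) = v"
    and i_add: "v \<in> carrier V \<Longrightarrow> w \<in> carrier V \<Longrightarrow> i (v \<oplus>\<^bsub>V\<^esub> w) = i v + i w"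
    and i_scale: "v \<in> carrier V \<Longrightarrow> i (c \<odot>\<^bsub>V\<^esub> v) = pscale c (i v)"
begin

text \<open>
  The sign is that of \<open>x\<^sup>-\<^sup>n\<close> in \<open>a(x\<^sub>0, x)\<close>: the coefficient of degree \<open>\<alpha>\<close> is the action of
  \<open>t\<^sup>-\<^sup>\<alpha>\<close>.
\<close>

definition cur :: "'g \<Rightarrow> int ^ 'r \<Rightarrow> int \<Rightarrow> (('g, 'r) induced \<Rightarrow>\<^sub>0 complex) \<Rightarrow> (('g, 'r) induced \<Rightarrow>\<^sub>0 complex)" where
  "cur a \<alpha> n x = i (lie_act (monomial a n (- \<alpha>)) (p x))"

lemma i_zero: "i \<zero>\<^bsub>V\<^esub> = 0"
  using i_add[of "\<zero>\<^bsub>V\<^esub>" "\<zero>\<^bsub>V\<^esub>"] by simp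

lemma p_zero: "p 0 = \<zero>\<^bsub>V\<^esub>"
  using p_i[of "\<zero>\<^bsub>V\<^esub>"] by (simp add: i_zero)

sublocale X: complex_vector_space pscale
  by (rule complex_vector_space.intro) (rule vector_space_pscale)

lemma lin_i_p:
  assumes "\<And>v w. v \<in> carrier V \<Longrightarrow> w \<in> carrier V \<Longrightarrow> f (v \<oplus>\<^bsub>V\<^esub> w) = f v \<oplus>\<^bsub>V\<^esub> f w"
    "\<And>c v. v \<in> carrier V \<Longrightarrow> f (c \<odot>\<^bsub>V\<^esub> v) = c \<odot>\<^bsub>V\<^esub> f v" "\<And>v. v \<in> carrier V \<Longrightarrow> f v \<in> carrier V"
  shows "X.lin (\<lambda>x. i (f (p x)))"
  using assms by (simp add: X.lin_def p_add p_scale i_add i_scale)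

lemma monomial_add: "monomial (a + b) n m = monomial a n m + (monomial b n m :: ('g, 'r) toroidal)"
  by (simp add: monomial_def single_add)

sublocale C: current_representation pscale scale bracket form level cur "\<lambda>x. i (p x)"
proof unfold_locales
  show "X.lin (cur a \<alpha> n)" for a \<alpha> n
    unfolding cur_def[abs_def] by (rule lin_i_p) (simp_all add: act_add_right lie_act_smult)
  show "X.lin (\<lambda>x. i (p x))"
    by (rule lin_i_p[where f = "\<lambda>v. v"]) simp_all
  show "\<exists>N. \<forall>n\<ge>N. \<forall>\<alpha>. cur a \<alpha> n w = 0" for a w
  proof -
    obtain N where "\<forall>n\<ge>N. \<forall>m. lie_act (monomial a n m) (p w) = \<zero>\<^bsub>V\<^esub>"
      using restricted[OF p_closed] by blast
    then show ?thesis by (intro exI[of _ N]) (simp add: cur_def i_zero)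
  qed
  show "cur (a + b) \<alpha> n w = cur a \<alpha> n w + cur b \<alpha> n w" for a b \<alpha> n w
    by (simp add: cur_def monomial_add lie_act_add i_add)
  show "cur (scale c a) \<alpha> n w = pscale c (cur a \<alpha> n w)" for c a \<alpha> n w
    using lie_act_tscale[of "p w" c "monomial a n (- \<alpha>)"]
    by (simp add: cur_def tscale_monomial i_scale)
  show "cur a \<alpha> k (cur b \<beta> r w) - cur b \<beta> r (cur a \<alpha> k w) =
       cur (bracket a b) (\<alpha> + \<beta>) (k + r) w
       + (if \<alpha> + \<beta> = 0 \<and> k + r = 0 then pscale (of_int k * form a b * level) (i (p w)) else 0)" for a \<alpha> k b \<beta> r w
  proof -
    let ?x = "monomial a k (- \<alpha>) :: ('g, 'r) toroidal" and ?y = "monomial b r (- \<beta>) :: ('g, 'r) toroidal"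
    let ?c = "if k + r = 0 \<and> - \<alpha> + - \<beta> = 0 then of_int k * form a b else 0"
    have eq: "- \<alpha> + - \<beta> = - (\<alpha> + \<beta>)" by simp
    have "tbracket ?x ?y = monomial (bracket a b) (k + r) (- \<alpha> + - \<beta>) + (0, ?c)"
      by (rule toroidal_bracket_monomial[OF complex_lie_algebra_form_axioms])
    then have "lie_act (tbracket ?x ?y) (p w) =
       lie_act (monomial (bracket a b) (k + r) (- (\<alpha> + \<beta>))) (p w) \<oplus>\<^bsub>V\<^esub> (?c * level) \<odot>\<^bsub>V\<^esub> p w"
      by (simp only: lie_act_add[OF p_closed] lie_act_scalar[OF p_closed] eq)
    then have "lie_act ?x (lie_act ?y (p w)) = lie_act ?y (lie_act ?x (p w)) \<oplus>\<^bsub>V\<^esub>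
       (lie_act (monomial (bracket a b) (k + r) (- (\<alpha> + \<beta>))) (p w) \<oplus>\<^bsub>V\<^esub> (?c * level) \<odot>\<^bsub>V\<^esub> p w)"
      using lie_act_bracket[OF p_closed, of ?x ?y w] by simp
    then have "cur a \<alpha> k (cur b \<beta> r w) = cur b \<beta> r (cur a \<alpha> k w) +
       (cur (bracket a b) (\<alpha> + \<beta>) (k + r) w + pscale (?c * level) (i (p w)))"
      by (simp add: cur_def i_add i_scale)
    moreover have "(- \<alpha> - \<beta> = 0) = (\<alpha> + \<beta> = 0)"
      by (metis add_uminus_conv_diff eq neg_equal_0_iff_equal)
    ultimately show ?thesis by (auto simp: mult.assoc)
  qed
qed (simp_all add: cur_def)

text \<open>
  The action of the toroidal Lie algebra on families of fields, by products with currents.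
\<close>

definition cur_rep :: "('g, 'r) toroidal \<Rightarrow> _" where
  "cur_rep x \<beta> = (\<Sum>j\<in>Poly_Mapping.keys (fst x). C.cur_act (fst j) (- snd j) (Poly_Mapping.lookup (fst x) j) \<beta>)
     + C.fscale (snd x * level) \<beta>"

lemma cur_act_left_add: "\<beta> \<in> C.tfields \<Longrightarrow> C.cur_act n \<alpha> (a + b) \<beta> = C.cur_act n \<alpha> a \<beta> + C.cur_act n \<alpha> b \<beta>"
  using C.cur_act_left_combine[of \<beta> n \<alpha> a 1 b] by (simp add: C.fscale_def)

lemma cur_act_left_0: "\<beta> \<in> C.tfields \<Longrightarrow> C.cur_act n \<alpha> 0 \<beta> = 0"
  using cur_act_left_add[of \<beta> n \<alpha> 0 0] by simp

lemma cur_act_left_scale: "\<beta> \<in> C.tfields \<Longrightarrow> C.cur_act n \<alpha> (scale c a) \<beta> = C.fscale c (C.cur_act n \<alpha> a \<beta>)"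
  using C.cur_act_left_combine[of \<beta> n \<alpha> 0 c a] by (simp add: cur_act_left_0)

sublocale F: vector_space C.fscale by (rule C.vector_space_fscale)

lemma cur_rep_monomial: "\<beta> \<in> C.tfields \<Longrightarrow> cur_rep (monomial a n m) \<beta> = C.cur_act n (- m) a \<beta>"
  by (cases "a = 0") (simp_all add: cur_rep_def monomial_def cur_act_left_0)

lemma cur_rep_scalar: "cur_rep (0, c) \<beta> = C.fscale (c * level) \<beta>"
  by (simp add: cur_rep_def)

lemma cur_rep_add_left:
  assumes "\<beta> \<in> C.tfields" shows "cur_rep (x + y) \<beta> = cur_rep x \<beta> + cur_rep y \<beta>"
proof -
  let ?f = "\<lambda>j a. C.cur_act (fst j) (- snd j) a \<beta>"
  have "(\<Sum>j\<in>Poly_Mapping.keys (fst x + fst y). ?f j (Poly_Mapping.lookup (fst x + fst y) j)) =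
    (\<Sum>j\<in>Poly_Mapping.keys (fst x). ?f j (Poly_Mapping.lookup (fst x) j)) +
    (\<Sum>j\<in>Poly_Mapping.keys (fst y). ?f j (Poly_Mapping.lookup (fst y) j))"
    by (rule setsum_keys_plus_distrib[where f = ?f]) (simp_all add: assms cur_act_left_0 cur_act_left_add)
  then show ?thesis
    unfolding cur_rep_def fst_add snd_add distrib_right F.scale_left_distrib by (simp add: add_ac)
qed

lemma lie_representation_fields:
  "lie_representation tscale tbracket (UNIV :: ('g, 'r) toroidal set) C.fscale cur_rep C.tfields"
proof (intro lie_representation.intro lie_representation_axioms.intro)
  show "lie_subset tscale tbracket (UNIV :: ('g, 'r) toroidal set)" by (rule lie_subset_UNIV)
  show "vector_space C.fscale" by (rule C.vector_space_fscale)
  note [simp] = C.tfields_0 C.tfields_add C.tfields_fscale C.cur_act_in_tfields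
  show "0 \<in> C.tfields" "\<And>e e'. e \<in> C.tfields \<Longrightarrow> e' \<in> C.tfields \<Longrightarrow> e + e' \<in> C.tfields"
    "\<And>e c. e \<in> C.tfields \<Longrightarrow> C.fscale c e \<in> C.tfields" by simp_all
  show in_E [simp]: "cur_rep x e \<in> C.tfields" if "e \<in> C.tfields" for x e
  proof (induction x rule: toroidal_induct)
    case (add x y)
    then show ?case unfolding cur_rep_add_left[OF that] by (rule C.tfields_add)
  qed (simp_all add: that cur_rep_monomial cur_rep_scalar)
  show rep_add: "cur_rep x (e + e') = cur_rep x e + cur_rep x e'" if e: "e \<in> C.tfields" "e' \<in> C.tfields" for x e e'
  proof (induction x rule: toroidal_induct)
    case (monomial a k)
    show ?case by (simp only: cur_rep_monomial C.tfields_add e C.cur_act_add)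
  next
    case (central c)
    show ?case by (simp only: cur_rep_scalar F.scale_right_distrib)
  next
    case (add x y)
    then show ?case by (simp only: cur_rep_add_left e C.tfields_add add_ac)
  qed
  show scl: "cur_rep x (C.fscale c e) = C.fscale c (cur_rep x e)" if e: "e \<in> C.tfields" for x c e
  proof (induction x rule: toroidal_induct)
    case (monomial a k)
    show ?case by (simp only: cur_rep_monomial C.tfields_fscale e C.cur_act_fscale)
  next
    case (central d)
    show ?case by (simp only: cur_rep_scalar F.scale_scale mult.commute)
  next
    case (add x y)
    then show ?case by (simp only: cur_rep_add_left e C.tfields_fscale F.scale_right_distrib)
  qed
  show "cur_rep (x + y) e = cur_rep x e + cur_rep y e" if "e \<in> C.tfields" for x y e
    by (rule cur_rep_add_left[OF that])
  show "cur_rep (tscale c x) e = C.fscale c (cur_rep x e)" if e: "e \<in> C.tfields" for x c e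
  proof (induction x rule: toroidal_induct)
    case (monomial a k)
    show ?case by (simp only: tscale_monomial cur_rep_monomial e cur_act_left_scale)
  next
    case (central d)
    show ?case by (simp only: tscale_scalar cur_rep_scalar F.scale_scale mult.assoc)
  next
    case (add x y)
    then show ?case by (simp only: tscale_add cur_rep_add_left e F.scale_right_distrib)
  qed
  have zero: "cur_rep 0 e = 0" for e by (simp add: cur_rep_def)
  show "cur_rep (tbracket x y) e = cur_rep x (cur_rep y e) - cur_rep y (cur_rep x e)" if e: "e \<in> C.tfields" for x y e
  proof (induction x rule: toroidal_induct)
    case (monomial a k)
    show ?case
    proof (induction y rule: toroidal_induct)
      case (monomial b j)
      let ?c = "if fst k + fst j = 0 \<and> snd k + snd j = 0 then of_int (fst k) * form a b else 0"
      have eq: "(- snd k + - snd j = 0) = (snd k + snd j = 0)"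
        by (metis minus_add_distrib add.commute neg_equal_0_iff_equal)
      have "cur_rep (tbracket (monomial a (fst k) (snd k)) (monomial b (fst j) (snd j))) e =
        C.cur_act (fst k + fst j) (- snd k + - snd j) (bracket a b) e + C.fscale (?c * level) e"
        unfolding toroidal_bracket_monomial[OF complex_lie_algebra_form_axioms]
        using e by (simp add: cur_rep_add_left cur_rep_monomial cur_rep_scalar)
      also have "\<dots> = C.cur_act (fst k) (- snd k) a (C.cur_act (fst j) (- snd j) b e) -
          C.cur_act (fst j) (- snd j) b (C.cur_act (fst k) (- snd k) a e)"
        unfolding C.cur_act_commutator[OF e] eq by (auto simp: mult.assoc)
      finally show ?case using e by (simp add: cur_rep_monomial)
    next
      case (central c)
      then show ?case using e by (simp add: zero cur_rep_monomial cur_rep_scalar C.cur_act_fscale)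
    next
      case (add y y')
      then show ?case
        by (simp only: tbracket_add_right cur_rep_add_left e in_E rep_add add_diff_add)
    qed
  next
    case (central c)
    then show ?case using e by (simp add: zero cur_rep_scalar scl)
  next
    case (add x x')
    then show ?case
      by (simp only: tbracket_add_left cur_rep_add_left e in_E rep_add add_diff_add)
  qed
qed

text \<open>
  The field of \<open>b + s1\<close>.
\<close>

definition base_field :: "'g \<times> complex \<Rightarrow> _" where
  "base_field m = cur (fst m) + C.fscale (snd m) C.unit_field"

lemma cur_fun: "cur (a + b) = cur a + cur b" "cur (scale c a) = C.fscale c (cur a)" "cur 0 = 0"
proof -
  show add: "cur (a + b) = cur a + cur b" for a b by (simp add: fun_eq_iff C.cur_add)
  show "cur (scale c a) = C.fscale c (cur a)" by (simp add: fun_eq_iff C.cur_gscale C.fscale_def)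
  show "cur 0 = 0" using add[of 0 0] by simp
qed

lemma base_field_act:
  assumes "x \<in> toroidal_plus"
  shows "cur_rep x (base_field m) = base_field (bact level x m)"
proof (induction x rule: toroidal_induct)
  case (monomial a k)
  then have k: "fst k \<ge> 0" using assms by (auto simp: toroidal_plus_def)
  have mem: "cur (fst m) \<in> C.tfields" "C.fscale (snd m) C.unit_field \<in> C.tfields"
    by (auto intro: C.cur_in_tfields C.tfields_fscale C.unit_field_in_tfields)
  have "cur_rep (monomial a (fst k) (snd k)) (base_field m) =
    C.cur_act (fst k) (- snd k) a (cur (fst m)) + C.fscale (snd m) (C.cur_act (fst k) (- snd k) a C.unit_field)"
    unfolding base_field_def
    by (simp add: cur_rep_monomial mem C.tfields_add C.cur_act_add C.cur_act_fscale C.unit_field_in_tfields)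
  also have "\<dots> = base_field (bact level (monomial a (fst k) (snd k)) m)"
    unfolding C.cur_act_cur[OF k] C.cur_act_unit_field[OF k] bact_monomial
    by (simp add: base_field_def cur_fun)
  finally show ?case .
next
  case (central c)
  show ?case
    unfolding cur_rep_scalar bact_scalar base_field_def
    by (intro ext) (simp add: base_scale_def cur_fun C.fscale_def X.scale_right_distrib)
next
  case (add x y)
  have "base_field m \<in> C.tfields" for m
    by (auto simp: base_field_def intro!: C.tfields_add C.cur_in_tfields C.tfields_fscale C.unit_field_in_tfields)
  then have "cur_rep (x + y) (base_field m) = base_field (bact level x m) + base_field (bact level y m)"
    using add by (simp only: cur_rep_add_left)
  also have "\<dots> = base_field (bact level (x + y) m)"
    unfolding bact_add_left base_field_def cur_fun fst_add snd_add F.scale_left_distrib by (simp only: add_ac)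
  finally show ?case .
qed

end

context induced_embedding
begin

definition vac :: "('g, 'r) induced" where "vac = tens 1 (0, 1)"
definition emb :: "'g \<Rightarrow> ('g, 'r) induced" where "emb a = tens 1 (a, 0)"

lemma vac_emb_closed [simp]: "vac \<in> carrier V" "emb a \<in> carrier V"
  by (simp_all add: vac_def emb_def)

lemma tens_one_split: "tens 1 m = emb (fst m) \<oplus>\<^bsub>V\<^esub> snd m \<odot>\<^bsub>V\<^esub> vac"
proof -
  have "tens 1 m = tens 1 ((fst m, 0) + bscale (snd m) (0, 1))" by (simp add: base_scale_def)
  then show ?thesis by (simp only: tens_add_right tens_one_scale emb_def vac_def)
qed

lemma generated:
  assumes vac: "P (i vac)" and emb: "\<And>a. P (i (emb a))" and diff: "\<And>x y c. P x \<Longrightarrow> P y \<Longrightarrow> P (x - pscale c y)"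
    and cur: "\<And>a \<alpha> n x. P x \<Longrightarrow> P (cur a \<alpha> n x)"
  shows "P (i (p x))"
proof -
  have zero: "P 0" using diff[OF vac vac, of 1] by simp
  have scale: "P (pscale c x)" if "P x" for c x using diff[OF zero that, of "- c"] by simp
  have add: "P (x + y)" if "P x" "P y" for x y using diff[OF that, of "- 1"] by simp
  have "P (i v)" if "v \<in> carrier V" for v
    using that
  proof (induction v rule: V_generated)
    case (tens m)
    then show ?case unfolding tens_one_split by (simp add: i_add i_scale add scale vac emb)
  next
    case (add x y)
    then show ?case using \<open>\<And>x y. P x \<Longrightarrow> P y \<Longrightarrow> P (x + y)\<close> by (simp add: i_add)
  next
    case (smult c x)
    then show ?case by (simp add: i_scale scale)
  next
    case (act y x)
    show ?case
    proof (induction y rule: toroidal_induct)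
      case (monomial a k)
      have "i (lie_act (monomial a (fst k) (snd k)) x) = cur a (- snd k) (fst k) (i x)"
        using act(1) by (simp add: cur_def)
      then show ?case using cur act by simp
    next
      case (central c)
      then show ?case using act by (simp add: lie_act_scalar i_scale scale)
    next
      case (add y y')
      then show ?case using act(1) \<open>\<And>x y. P x \<Longrightarrow> P y \<Longrightarrow> P (x + y)\<close> by (simp add: lie_act_add i_add)
    qed
  qed
  then show ?thesis by simp
qed

lemma state_field_exists:
  obtains Y where "state_field_map pscale scale bracket form level cur (\<lambda>x. i (p x)) Y (i vac) (\<lambda>a. i (emb a))"
proof -
  have mem: "base_field m \<in> C.tfields" for m
    by (auto simp: base_field_def intro!: C.tfields_add C.cur_in_tfields C.tfields_fscale C.unit_field_in_tfields)
  have add: "base_field (m + m') = base_field m + base_field m'" for m m'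
    unfolding base_field_def cur_fun fst_add snd_add F.scale_left_distrib by (simp only: add_ac)
  have scale: "base_field (bscale c m) = C.fscale c (base_field m)" for c m
    unfolding base_field_def by (intro ext) (simp add: base_scale_def cur_fun C.fscale_def X.scale_right_distrib)
  obtain \<Phi> where \<Phi>: "\<And>v. v \<in> carrier V \<Longrightarrow> \<Phi> v \<in> C.tfields"
    "\<And>v w. v \<in> carrier V \<Longrightarrow> w \<in> carrier V \<Longrightarrow> \<Phi> (v \<oplus>\<^bsub>V\<^esub> w) = \<Phi> v + \<Phi> w"
    "\<And>c v. v \<in> carrier V \<Longrightarrow> \<Phi> (c \<odot>\<^bsub>V\<^esub> v) = C.fscale c (\<Phi> v)"
    "\<And>x v. v \<in> carrier V \<Longrightarrow> \<Phi> (lie_act x v) = cur_rep x (\<Phi> v)"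
    "\<And>m. \<Phi> (tens 1 m) = base_field m"
    by (rule universal[OF lie_representation_fields mem add scale base_field_act]) (assumption, rule that)
  show ?thesis
  proof (rule that[of "\<lambda>x. \<Phi> (p x)"], unfold_locales)
    show "X.lin (\<lambda>x. \<Phi> (p x) \<gamma> n w)" for \<gamma> n w
      by (simp add: X.lin_def p_add p_scale \<Phi> C.fscale_def)
    show "\<Phi> (p (i vac)) = C.unit_field"
      by (simp add: vac_def \<Phi> base_field_def cur_fun)
    show "\<Phi> (p (i (emb a))) = cur a" for a
      by (simp add: emb_def \<Phi> base_field_def)
    show "\<Phi> (p (cur a \<alpha> n x)) = C.cur_act n \<alpha> a (\<Phi> (p x))" for a \<alpha> n x
      by (simp add: cur_def \<Phi> cur_rep_monomial)
    show "P (i (p x))" if "P (i vac)" "\<And>a. P (i (emb a))" "\<And>x y c. P x \<Longrightarrow> P y \<Longrightarrow> P (x - pscale c y)"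
      "\<And>a \<alpha> n x. P x \<Longrightarrow> P (cur a \<alpha> n x)" for P x
      by (rule generated) (use that in auto)
  qed (simp_all add: \<Phi>(1))
qed

end

text \<open>
  The sum that defines a coefficient of a product of series runs over the nonzero terms. It is compared with a sum
  over an initial segment of the naturals that covers these terms.
\<close>

lemma (in Module.module) finsum_reindexed:
  fixes d :: "nat \<Rightarrow> 'i"
  assumes "inj_on d {..<S}" and sub: "D \<subseteq> d ` {..<S}" and g: "\<And>s. s < S \<Longrightarrow> h (d s) \<in> carrier M"
    and zero: "\<And>s. s < S \<Longrightarrow> d s \<notin> D \<Longrightarrow> h (d s) = \<zero>\<^bsub>M\<^esub>"
  shows "(\<Oplus>\<^bsub>M\<^esub>x\<in>D. h x) = (\<Oplus>\<^bsub>M\<^esub>s\<in>{..<S}. h (d s))"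
proof -
  have "(\<Oplus>\<^bsub>M\<^esub>x\<in>D. h x) = (\<Oplus>\<^bsub>M\<^esub>x\<in>d ` {..<S}. h x)"
    by (rule M.add.finprod_mono_neutral_cong_left) (use assms in auto)
  also have "\<dots> = (\<Oplus>\<^bsub>M\<^esub>s\<in>{..<S}. h (d s))"
    by (rule M.finsum_reindex) (use assms in auto)
  finally show ?thesis .
qed

section \<open>Existence\<close>

context induced_embedding
begin

lemma p_sum: "p (\<Sum>s<S. g s) = (\<Oplus>\<^bsub>V\<^esub>s\<in>{..<S}. p (g s))" for S :: nat
proof (induction S)
  case 0
  show ?case by (simp add: p_zero)
next
  case (Suc S)
  have "(\<Oplus>\<^bsub>V\<^esub>s\<in>{..<Suc S}. p (g s)) = p (g S) \<oplus>\<^bsub>V\<^esub> (\<Oplus>\<^bsub>V\<^esub>s\<in>{..<S}. p (g s))"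
    unfolding lessThan_Suc by (rule VG.finsum_insert) auto
  then show ?case by (simp add: Suc p_add VG.a_comm)
qed

lemma p_diff: "p (x - y) = p x \<ominus>\<^bsub>V\<^esub> p y"
proof -
  have "p x = p (x - y) \<oplus>\<^bsub>V\<^esub> p y" using p_add[of "x - y" y] by simp
  then show ?thesis by (simp add: VG.minus_eq VG.a_assoc VG.r_neg)
qed

text \<open>
  The kernels of the Jacobi identity are delta functions, so only a line of exponents \<open>d 0, d 1, \<dots>\<close> contributes
  to the coefficient at \<open>e\<close>.
\<close>

lemma series_mult_eq:
  fixes d :: "nat \<Rightarrow> int \<times> int \<times> int"
  assumes "inj d" and cover: "\<And>x. K x \<noteq> 0 \<Longrightarrow> F (e - x) \<noteq> \<zero>\<^bsub>V\<^esub> \<Longrightarrow> \<exists>s<S. x = d s"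
    and F: "\<And>s. F (e - d s) = p (g s)" and K: "\<And>s. K (d s) = c s"
  shows "series_mult V K F e = p (\<Sum>s<S. pscale (c s) (g s))"
proof -
  have "series_mult V K F e = (\<Oplus>\<^bsub>V\<^esub>s\<in>{..<S}. K (d s) \<odot>\<^bsub>V\<^esub> F (e - d s))"
    unfolding series_mult_def
  proof (rule V.finsum_reindexed[where h = "\<lambda>x. K x \<odot>\<^bsub>V\<^esub> F (e - x)"])
    show "inj_on d {..<S}" using assms(1) by (rule inj_on_subset) simp
    show "{x. K x \<noteq> 0 \<and> F (e - x) \<noteq> \<zero>\<^bsub>V\<^esub>} \<subseteq> d ` {..<S}" using cover by blast
    show "K (d s) \<odot>\<^bsub>V\<^esub> F (e - d s) = \<zero>\<^bsub>V\<^esub>" if "d s \<notin> {x. K x \<noteq> 0 \<and> F (e - x) \<noteq> \<zero>\<^bsub>V\<^esub>}" for s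
      using that by (cases "K (d s) = 0") (auto simp: F zero_smult smult_zero)
  qed (simp add: F)
  then show ?thesis by (simp add: F K p_sum p_scale)
qed

lemma binomial_coeff_binom: "binomial_coeff n (n - int s) (int s) = binom (- 1) n s"
  by (simp add: binomial_coeff_def binom_def)

lemma binomial_coeff_binom_neg: "binomial_coeff (j + int s) j (int s) = binom 1 (- j - 1) s"
  using gbinomial_negated_upper[of "- of_int j - 1 :: complex" s]
  by (simp add: binomial_coeff_def binom_def algebra_simps)

lemma binomial_coeff_nonzero: "binomial_coeff n j k \<noteq> 0 \<Longrightarrow> 0 \<le> k \<and> j = n - k"
  by (auto simp: binomial_coeff_def split: if_splits)

text \<open>
  At \<open>z\<^sub>0\<^sup>e\<^sup>1 x\<^sub>0\<^sup>e\<^sup>2 y\<^sub>0\<^sup>e\<^sup>3 z\<^sup>a y\<^sup>b\<close> the three terms of the Jacobi identity are those of the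
  Borcherds identity with \<open>n = - e1 - 1\<close>, \<open>P = - e2 - 1\<close> and \<open>Q = - e3 - 1\<close>.
\<close>

theorem toroidal_vertex_algebra_exists:
  "\<exists>Y :: ('g, 'r) induced \<Rightarrow> ('g, 'r) induced \<Rightarrow> int \<Rightarrow> int ^ 'r \<Rightarrow> ('g, 'r) induced.
     toroidal_vertex_algebra V Y vac \<and> (\<forall>a. \<forall>v\<in>carrier V. Y (emb a) v = current_series scale bracket form level a v)"
proof -
  obtain YX where "state_field_map pscale scale bracket form level cur (\<lambda>x. i (p x)) YX (i vac) (\<lambda>a. i (emb a))"
    by (rule state_field_exists)
  then interpret S: state_field_map pscale scale bracket form level cur "\<lambda>x. i (p x)" YX "i vac" "\<lambda>a. i (emb a)" .
  \<comment> \<open>The mode \<open>n\<close> belongs to \<open>x\<^sub>0\<^sup>-\<^sup>n\<^sup>-\<^sup>1\<close>.\<close>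
  define Y where "Y u v k m = p (YX (i u) m (- k - 1) (i v))" for u v k m
  have one: "i (p (YX x \<gamma> n w)) = YX x \<gamma> n w" for x \<gamma> n w
    using S.Y_field[of x] by (simp add: C.tfields_def)
  have Y_right: "Y u (Y v w k m) k' m' = p (YX (i u) m' (- k' - 1) (YX (i v) m (- k - 1) (i w)))" for u v w k m k' m'
    by (simp add: Y_def one)
  have Y_left: "Y (Y u v k m) w k' m' = p (YX (YX (i u) m (- k - 1) (i v)) m' (- k' - 1) (i w))" for u v w k m k' m'
    by (simp add: Y_def one)
  have YX_zero: "YX x \<gamma> n 0 = 0" "YX 0 \<gamma> n w = 0" for x \<gamma> n w
    using X.lin_0[OF X.vfield_lin[OF S.vfield_Y]] X.lin_0[OF S.Y_lin] by auto
  have Y_closed: "Y u v k m \<in> carrier V" for u v k m by (simp add: Y_def)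
  have "toroidal_vertex_algebra V Y vac"
  proof (intro toroidal_vertex_algebra.intro module_V toroidal_vertex_algebra_axioms.intro)
    fix u u' v v' w :: "('g, 'r) induced" and k m c
    show "vac \<in> carrier V" by simp
    show "Y u v k m \<in> carrier V" by (rule Y_closed)
    show "Y (u \<oplus>\<^bsub>V\<^esub> u') v k m = Y u v k m \<oplus>\<^bsub>V\<^esub> Y u' v k m" if "u \<in> carrier V" "u' \<in> carrier V"
      using that by (simp add: Y_def i_add p_add X.lin_add[OF S.Y_lin])
    show "Y (c \<odot>\<^bsub>V\<^esub> u) v k m = c \<odot>\<^bsub>V\<^esub> Y u v k m" if "u \<in> carrier V"
      using that by (simp add: Y_def i_scale p_scale X.lin_scale[OF S.Y_lin])
    show "Y u (v \<oplus>\<^bsub>V\<^esub> v') k m = Y u v k m \<oplus>\<^bsub>V\<^esub> Y u v' k m" if "v \<in> carrier V" "v' \<in> carrier V"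
      using that by (simp add: Y_def i_add p_add X.lin_add[OF X.vfield_lin[OF S.vfield_Y]])
    show "Y u (c \<odot>\<^bsub>V\<^esub> v) k m = c \<odot>\<^bsub>V\<^esub> Y u v k m" if "v \<in> carrier V"
      using that by (simp add: Y_def i_scale p_scale X.lin_scale[OF X.vfield_lin[OF S.vfield_Y]])
    show "\<exists>N. \<forall>k<N. \<forall>m. Y u v k m = \<zero>\<^bsub>V\<^esub>"
    proof -
      have "YX (i u) \<in> C.tfields" by (rule S.Y_field)
      then obtain N where "\<forall>n\<ge>N. \<forall>\<gamma>. YX (i u) \<gamma> n (i v) = 0" unfolding C.tfields_def mem_Collect_eq by meson
      then show ?thesis by (intro exI[of _ "- N"]) (simp add: Y_def p_zero)
    qed
    show "Y vac v k m = (if k = 0 \<and> m = 0 then v else \<zero>\<^bsub>V\<^esub>)" if "v \<in> carrier V"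
      using that by (auto simp: Y_def S.Y_vac C.unit_field_def p_zero)
    show "Y v vac k m = \<zero>\<^bsub>V\<^esub>" if "k < 0"
    proof -
      have "cur a \<alpha> n (i vac) = 0" if "n \<ge> 0" for a \<alpha> n
      proof -
        have "monomial a n (- \<alpha>) \<in> (toroidal_plus :: ('g, 'r) toroidal set)"
          using that by (simp add: toroidal_plus_def monomial_def)
        then have "lie_act (monomial a n (- \<alpha>)) vac = tens 1 0"
          by (auto simp: vac_def tens_one_base bact_monomial simp flip: zero_prod_def)
        then show ?thesis by (simp add: cur_def tens_one_zero i_zero)
      qed
      then have "YX (i v) m (- k - 1) (i vac) = 0" using that by (intro S.creation_Y) auto
      then show ?thesis by (simp add: Y_def p_zero)
    qed
    fix a b and e :: "int \<times> int \<times> int"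
    obtain e1 e2 e3 where e: "e = (e1, e2, e3)" by (cases e)
    let ?A = "YX (i u) a" and ?B = "YX (i v) (b - a)" and ?y = "\<lambda>x. YX x b" and ?w = "i w"
    define n P Q where "n = - e1 - 1" and "P = - e2 - 1" and "Q = - e3 - 1"
    have xy: "series_mult V delta_xy (\<lambda>(i, j, k). if i = 0 then Y u (Y v w k (b - a)) j a else \<zero>\<^bsub>V\<^esub>) e =
        p (X.ord_prod n ?A ?B P Q ?w)"
      unfolding X.ord_prod_def X.expand_def
    proof (rule series_mult_eq[where d = "\<lambda>s. (e1, n - int s, int s)"])
      show "inj (\<lambda>s. (e1, n - int s, int s))" by (auto simp: inj_def)
      fix x :: "int \<times> int \<times> int"
      obtain x1 x2 x3 where x: "x = (x1, x2, x3)" by (cases x)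
      assume K: "delta_xy x \<noteq> 0"
        and F: "(case e - x of (i, j, k) \<Rightarrow> if i = 0 then Y u (Y v w k (b - a)) j a else \<zero>\<^bsub>V\<^esub>) \<noteq> \<zero>\<^bsub>V\<^esub>"
      have x1: "x1 = e1" and F': "Y u (Y v w (e3 - x3) (b - a)) (e2 - x2) a \<noteq> \<zero>\<^bsub>V\<^esub>"
        using F by (auto simp: e x split: if_splits)
      from K x1 have s: "0 \<le> x3" "x2 = n - x3"
        using binomial_coeff_nonzero[of "- x1 - 1" x2 x3] by (auto simp: delta_xy_def x n_def)
      have "?B (Q + x3) ?w \<noteq> 0"
        using F' by (auto simp: Y_right Q_def YX_zero p_zero algebra_simps)
      then have "Q + x3 < X.cutoff ?B ?w" using X.cutoff[OF S.vfield_Y] by (meson not_less)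
      then show "\<exists>s<nat (X.cutoff ?B ?w - Q). x = (e1, n - int s, int s)"
        using s x1 by (intro exI[of _ "nat x3"]) (auto simp: x)
    next
      fix s
      show "(case e - (e1, n - int s, int s) of (i, j, k) \<Rightarrow> if i = 0 then Y u (Y v w k (b - a)) j a else \<zero>\<^bsub>V\<^esub>) =
         p (?A (P + n - int s) (?B (Q + int s) ?w))"
        by (simp add: e Y_right P_def Q_def algebra_simps)
      show "delta_xy (e1, n - int s, int s) = binom (- 1) n s"
        using binomial_coeff_binom[of n s] by (simp add: delta_xy_def n_def)
    qed
    have yx: "series_mult V delta_yx (\<lambda>(i, j, k). if i = 0 then Y v (Y u w j a) k (b - a) else \<zero>\<^bsub>V\<^esub>) e =
        p (\<Sum>s<nat (X.cutoff ?A ?w - P). pscale ((-1) powi n * binom (- 1) n s) (?B (Q + n - int s) (?A (P + int s) ?w)))"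
    proof (rule series_mult_eq[where d = "\<lambda>s. (e1, int s, n - int s)"])
      show "inj (\<lambda>s. (e1, int s, n - int s))" by (auto simp: inj_def)
      fix x :: "int \<times> int \<times> int"
      obtain x1 x2 x3 where x: "x = (x1, x2, x3)" by (cases x)
      assume K: "delta_yx x \<noteq> 0"
        and F: "(case e - x of (i, j, k) \<Rightarrow> if i = 0 then Y v (Y u w j a) k (b - a) else \<zero>\<^bsub>V\<^esub>) \<noteq> \<zero>\<^bsub>V\<^esub>"
      have x1: "x1 = e1" and F': "Y v (Y u w (e2 - x2) a) (e3 - x3) (b - a) \<noteq> \<zero>\<^bsub>V\<^esub>"
        using F by (auto simp: e x split: if_splits)
      from K x1 have s: "0 \<le> x2" "x3 = n - x2"
        using binomial_coeff_nonzero[of "- x1 - 1" x3 x2] by (auto simp: delta_yx_def x n_def)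
      have "?A (P + x2) ?w \<noteq> 0"
        using F' by (auto simp: Y_right P_def YX_zero p_zero algebra_simps)
      then have "P + x2 < X.cutoff ?A ?w" using X.cutoff[OF S.vfield_Y] by (meson not_less)
      then show "\<exists>s<nat (X.cutoff ?A ?w - P). x = (e1, int s, n - int s)"
        using s x1 by (intro exI[of _ "nat x2"]) (auto simp: x)
    next
      fix s
      show "(case e - (e1, int s, n - int s) of (i, j, k) \<Rightarrow> if i = 0 then Y v (Y u w j a) k (b - a) else \<zero>\<^bsub>V\<^esub>) =
         p (?B (Q + n - int s) (?A (P + int s) ?w))"
        by (simp add: e Y_right P_def Q_def algebra_simps)
      show "delta_yx (e1, int s, n - int s) = (-1) powi n * binom (- 1) n s"
        using binomial_coeff_binom[of n s] by (simp add: delta_yx_def n_def)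
    qed
    have xz: "series_mult V delta_xz (\<lambda>(i, j, k). if j = 0 then Y (Y u v i a) w k b else \<zero>\<^bsub>V\<^esub>) e =
        p (X.expand 1 (X.cutoff ?A (i v)) P (\<lambda>q n. ?y (?A n (i v)) q ?w) Q n)"
      unfolding X.expand_def
    proof (rule series_mult_eq[where d = "\<lambda>s. (int s, e2, - e2 - 1 - int s)"])
      show "inj (\<lambda>s. (int s, e2, - e2 - 1 - int s))" by (auto simp: inj_def)
      fix x :: "int \<times> int \<times> int"
      obtain x1 x2 x3 where x: "x = (x1, x2, x3)" by (cases x)
      assume K: "delta_xz x \<noteq> 0"
        and F: "(case e - x of (i, j, k) \<Rightarrow> if j = 0 then Y (Y u v i a) w k b else \<zero>\<^bsub>V\<^esub>) \<noteq> \<zero>\<^bsub>V\<^esub>"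
      have x2: "x2 = e2" and F': "Y (Y u v (e1 - x1) a) w (e3 - x3) b \<noteq> \<zero>\<^bsub>V\<^esub>"
        using F by (auto simp: e x split: if_splits)
      from K x2 have s: "0 \<le> x1" "x3 = - e2 - 1 - x1"
        using binomial_coeff_nonzero[of "- x3 - 1" x2 x1] by (auto simp: delta_xz_def x)
      have "?A (n + x1) (i v) \<noteq> 0"
        using F' by (auto simp: Y_left n_def YX_zero p_zero algebra_simps)
      then have "n + x1 < X.cutoff ?A (i v)" using X.cutoff[OF S.vfield_Y] by (meson not_less)
      then show "\<exists>s<nat (X.cutoff ?A (i v) - n). x = (int s, e2, - e2 - 1 - int s)"
        using s x2 by (intro exI[of _ "nat x1"]) (auto simp: x)
    next
      fix s
      show "(case e - (int s, e2, - e2 - 1 - int s) of (i, j, k) \<Rightarrow> if j = 0 then Y (Y u v i a) w k b else \<zero>\<^bsub>V\<^esub>) =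
         p (?y (?A (n + int s) (i v)) (Q + P - int s) ?w)"
        by (simp add: e Y_left P_def Q_def n_def algebra_simps)
      show "delta_xz (int s, e2, - e2 - 1 - int s) = binom 1 P s"
        using binomial_coeff_binom_neg[of e2 s] by (simp add: delta_xz_def P_def algebra_simps)
    qed
    have yx': "(\<Sum>s<nat (X.cutoff ?A ?w - P). pscale ((-1) powi n * binom (- 1) n s) (?B (Q + n - int s) (?A (P + int s) ?w)))
       = pscale ((-1) powi n) (X.ord_prod n ?B ?A Q P ?w)"
      by (simp add: X.ord_prod_def X.expand_def X.scale_sum_right)
    show "series_mult V delta_xy (\<lambda>(i, j, k). if i = 0 then Y u (Y v w k (b - a)) j a else \<zero>\<^bsub>V\<^esub>) e
      \<ominus>\<^bsub>V\<^esub> series_mult V delta_yx (\<lambda>(i, j, k). if i = 0 then Y v (Y u w j a) k (b - a) else \<zero>\<^bsub>V\<^esub>) e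
      = series_mult V delta_xz (\<lambda>(i, j, k). if j = 0 then Y (Y u v i a) w k b else \<zero>\<^bsub>V\<^esub>) e"
      using S.Borcherds_Y[of "i u" a "i v" "b - a"]
      unfolding xy yx xz yx' p_diff[symmetric] X.Borcherds_def X.comm_def by simp
  qed
  moreover have "Y (emb a) v = current_series scale bracket form level a v" if "v \<in> carrier V" for a v
    using that by (intro ext) (simp add: Y_def S.Y_emb cur_def current_series_def induced_action_eq)
  ultimately show ?thesis by blast
qed

end

section \<open>Uniqueness\<close>

context induced_representation
begin

text \<open>
  At \<open>x\<^sub>0\<^sup>-\<^sup>1\<close> the third kernel has the single nonzero coefficient of \<open>z\<^sub>0\<^sup>0 y\<^sub>0\<^sup>0\<close>, because
  \<open>(x\<^sub>0 - z\<^sub>0)\<^sup>s\<close> has no negative powers of \<open>x\<^sub>0\<close> if \<open>s \<ge> 0\<close>, and only powers up to the \<open>s\<close>-th if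
  \<open>s < 0\<close>.
\<close>

lemma series_mult_delta_xz:
  assumes G: "\<And>i k. G i k \<in> carrier V"
  shows "series_mult V delta_xz (\<lambda>(i, j, k). if j = 0 then G i k else \<zero>\<^bsub>V\<^esub>) (i, - 1, k) = G i k"
proof -
  let ?F = "\<lambda>(i, j, k). if j = 0 then G i k else \<zero>\<^bsub>V\<^esub>"
  let ?D = "{d. delta_xz d \<noteq> 0 \<and> ?F ((i, - 1, k) - d) \<noteq> \<zero>\<^bsub>V\<^esub>}"
  have sub: "?D \<subseteq> {(0, - 1, 0)}"
  proof
    fix d assume d: "d \<in> ?D"
    obtain d1 d2 d3 where [simp]: "d = (d1, d2, d3)" by (cases d)
    have d2: "d2 = - 1" using d by (auto split: if_splits)
    have K: "binomial_coeff (- d3 - 1) d2 d1 \<noteq> 0" using d by (simp add: delta_xz_def)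
    then have d1: "d1 \<ge> 0" "d2 + d1 = - d3 - 1" by (auto simp: binomial_coeff_def split: if_splits)
    have "d1 = 0"
    proof (rule ccontr)
      assume "d1 \<noteq> 0"
      then obtain s where s: "d1 = int (Suc s)" using d1(1) by (metis int_nat_eq nat_eq_iff2 not0_implies_Suc of_nat_0)
      have "(of_nat s gchoose Suc s :: complex) = 0"
        using binomial_gbinomial[of s "Suc s", where 'a = complex] by (metis binomial_eq_0 lessI of_nat_0)
      moreover have "- d3 - 1 = int s" "nat (1 + int s) = Suc s" using d1 d2 s by simp_all
      ultimately show False using K s by (simp add: binomial_coeff_def split: if_splits)
    qed
    then show "d \<in> {(0, - 1, 0)}" using d1 d2 by simp
  qed
  have K1: "delta_xz (0, - 1, 0) = 1" by (simp add: delta_xz_def binomial_coeff_def)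
  have one: "1 \<odot>\<^bsub>V\<^esub> G i k = G i k" using V.smult_one[OF G] by (simp add: ring_of_type_algebra_def)
  show ?thesis
  proof (cases "G i k = \<zero>\<^bsub>V\<^esub>")
    case True
    then have D: "?D = {}" using sub by auto
    show ?thesis unfolding series_mult_def D using True by simp
  next
    case False
    then have D: "?D = {(0, - 1, 0)}" using sub K1 by auto
    show ?thesis
      unfolding series_mult_def D using G one K1 by (simp add: VG.finsum_insert)
  qed
qed

text \<open>
  By the coefficient at \<open>x\<^sub>0\<^sup>-\<^sup>1\<close> of the Jacobi identity, the fields of \<open>a\<close> and of \<open>x\<close> determine the field of
  the action of a current of \<open>a\<close> on \<open>x\<close>; such vectors generate the module.
\<close>

theorem toroidal_vertex_algebra_unique:
  fixes Y\<^sub>1 Y\<^sub>2 :: "('g, 'r) induced \<Rightarrow> ('g, 'r) induced \<Rightarrow> int \<Rightarrow> int ^ 'r \<Rightarrow> ('g, 'r) induced"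
  assumes T: "toroidal_vertex_algebra V Y\<^sub>1 (tens 1 (0, 1))" "toroidal_vertex_algebra V Y\<^sub>2 (tens 1 (0, 1))"
    and cs1: "\<And>a v. v \<in> carrier V \<Longrightarrow> Y\<^sub>1 (tens 1 (a, 0)) v = current_series scale bracket form level a v"
    and cs2: "\<And>a v. v \<in> carrier V \<Longrightarrow> Y\<^sub>2 (tens 1 (a, 0)) v = current_series scale bracket form level a v"
    and "x \<in> carrier V" "v \<in> carrier V"
  shows "Y\<^sub>1 x v = Y\<^sub>2 x v"
proof -
  interpret Y1: toroidal_vertex_algebra V Y\<^sub>1 "tens 1 (0, 1)" by fact
  interpret Y2: toroidal_vertex_algebra V Y\<^sub>2 "tens 1 (0, 1)" by fact
  have split: "tens 1 m = tens 1 (fst m, 0) \<oplus>\<^bsub>V\<^esub> snd m \<odot>\<^bsub>V\<^esub> tens 1 (0, 1)" for m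
  proof -
    have "tens 1 m = tens 1 ((fst m, 0) + bscale (snd m) (0, 1))" by (simp add: base_scale_def)
    then show ?thesis by (simp only: tens_add_right tens_one_scale)
  qed
  have add: "\<forall>w\<in>carrier V. Y\<^sub>1 (x \<oplus>\<^bsub>V\<^esub> y) w = Y\<^sub>2 (x \<oplus>\<^bsub>V\<^esub> y) w"
    if "x \<in> carrier V" "y \<in> carrier V" "\<forall>w\<in>carrier V. Y\<^sub>1 x w = Y\<^sub>2 x w" "\<forall>w\<in>carrier V. Y\<^sub>1 y w = Y\<^sub>2 y w" for x y
    using that by (simp add: fun_eq_iff Y1.Y_add_left Y2.Y_add_left)
  have smult: "\<forall>w\<in>carrier V. Y\<^sub>1 (c \<odot>\<^bsub>V\<^esub> x) w = Y\<^sub>2 (c \<odot>\<^bsub>V\<^esub> x) w"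
    if "x \<in> carrier V" "\<forall>w\<in>carrier V. Y\<^sub>1 x w = Y\<^sub>2 x w" for c x
    using that by (simp add: fun_eq_iff Y1.Y_smult_left Y2.Y_smult_left)
  have "\<forall>w\<in>carrier V. Y\<^sub>1 x w = Y\<^sub>2 x w"
    using \<open>x \<in> carrier V\<close>
  proof (induction x rule: V_generated)
    case (tens m)
    have "\<forall>w\<in>carrier V. Y\<^sub>1 (tens 1 (0, 1)) w = Y\<^sub>2 (tens 1 (0, 1)) w"
      by (simp add: fun_eq_iff Y1.vacuum Y2.vacuum)
    then show ?case
      unfolding split[of m] by (intro add smult tens_closed smult_closed) (simp_all add: cs1 cs2)
  next
    case (act y x)
    show ?case
    proof (induction y rule: toroidal_induct)
      case (monomial a k)
      \<comment> \<open>The exponents of \<open>x\<^sub>0, x\<close> at which \<open>a \<otimes> t\<^sub>0\<^sup>i t\<^sup>m\<close> occurs in \<open>a(x\<^sub>0, x)\<close>, where \<open>k = (i, m)\<close>.\<close>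
      let ?a = "tens 1 (a, 0)" and ?\<alpha> = "- snd k" and ?n = "- fst k - 1"
      have x: "lie_act (monomial a (fst k) (snd k)) x = current_series scale bracket form level a x ?n ?\<alpha>"
        by (simp add: current_series_def induced_action_eq)
      show ?case
      proof (intro ballI ext)
        fix w j b assume w: "w \<in> carrier V"
        let ?e = "(?n, - 1, j) :: int \<times> int \<times> int"
        have agree: "Y\<^sub>1 x z = Y\<^sub>2 x z" if "z \<in> carrier V" for z using act that by simp
        have cs_closed: "current_series scale bracket form level a w k m \<in> carrier V" for k m
          using w by (simp add: current_series_def induced_action_eq)
        have F: "Y\<^sub>1 ?a (Y\<^sub>1 x w k m) = Y\<^sub>2 ?a (Y\<^sub>2 x w k m)" for k m
          using w act(1) agree[OF w] by (simp add: cs1 cs2 Y2.Y_closed)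
        have G: "Y\<^sub>1 x (Y\<^sub>1 ?a w k m) = Y\<^sub>2 x (Y\<^sub>2 ?a w k m)" for k m
          using w cs_closed agree by (simp add: cs1 cs2)
        have "Y\<^sub>1 (Y\<^sub>1 ?a x ?n ?\<alpha>) w j b =
          series_mult V delta_xz (\<lambda>(i, j, k). if j = 0 then Y\<^sub>1 (Y\<^sub>1 ?a x i ?\<alpha>) w k b else \<zero>\<^bsub>V\<^esub>) ?e"
          by (rule series_mult_delta_xz[symmetric]) (use w act(1) in \<open>simp add: Y1.Y_closed\<close>)
        also have "\<dots> = series_mult V delta_xy (\<lambda>(i, j, k). if i = 0 then Y\<^sub>1 ?a (Y\<^sub>1 x w k (b - ?\<alpha>)) j ?\<alpha> else \<zero>\<^bsub>V\<^esub>) ?e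
          \<ominus>\<^bsub>V\<^esub> series_mult V delta_yx (\<lambda>(i, j, k). if i = 0 then Y\<^sub>1 x (Y\<^sub>1 ?a w j ?\<alpha>) k (b - ?\<alpha>) else \<zero>\<^bsub>V\<^esub>) ?e"
          by (rule Y1.jacobi[symmetric]) (use w act(1) in simp_all)
        also have "\<dots> = series_mult V delta_xy (\<lambda>(i, j, k). if i = 0 then Y\<^sub>2 ?a (Y\<^sub>2 x w k (b - ?\<alpha>)) j ?\<alpha> else \<zero>\<^bsub>V\<^esub>) ?e
          \<ominus>\<^bsub>V\<^esub> series_mult V delta_yx (\<lambda>(i, j, k). if i = 0 then Y\<^sub>2 x (Y\<^sub>2 ?a w j ?\<alpha>) k (b - ?\<alpha>) else \<zero>\<^bsub>V\<^esub>) ?e"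
          unfolding F G ..
        also have "\<dots> = series_mult V delta_xz (\<lambda>(i, j, k). if j = 0 then Y\<^sub>2 (Y\<^sub>2 ?a x i ?\<alpha>) w k b else \<zero>\<^bsub>V\<^esub>) ?e"
          by (rule Y2.jacobi) (use w act(1) in simp_all)
        also have "\<dots> = Y\<^sub>2 (Y\<^sub>2 ?a x ?n ?\<alpha>) w j b"
          by (rule series_mult_delta_xz) (use w act(1) in \<open>simp add: Y2.Y_closed\<close>)
        finally show "Y\<^sub>1 (lie_act (monomial a (fst k) (snd k)) x) w j b = Y\<^sub>2 (lie_act (monomial a (fst k) (snd k)) x) w j b"
          unfolding x by (simp only: cs1[OF act(1)] cs2[OF act(1)])
      qed
    next
      case (central c)
      then show ?case using act by (simp add: lie_act_scalar smult)
    next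
      case (add y y')
      then show ?case
        using act(1) \<open>\<And>x y. x \<in> carrier V \<Longrightarrow> y \<in> carrier V \<Longrightarrow> \<forall>w\<in>carrier V. Y\<^sub>1 x w = Y\<^sub>2 x w \<Longrightarrow>
          \<forall>w\<in>carrier V. Y\<^sub>1 y w = Y\<^sub>2 y w \<Longrightarrow> \<forall>w\<in>carrier V. Y\<^sub>1 (x \<oplus>\<^bsub>V\<^esub> y) w = Y\<^sub>2 (x \<oplus>\<^bsub>V\<^esub> y) w\<close>
        by (simp add: lie_act_add)
    qed
  qed (use add smult in auto)
  then show ?thesis using \<open>v \<in> carrier V\<close> by simp
qed

end

theorem theorem4p2:
  fixes scale :: "complex \<Rightarrow> 'g::ab_group_add \<Rightarrow> 'g"
    and bracket :: "'g \<Rightarrow> 'g \<Rightarrow> 'g"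
    and form :: "'g \<Rightarrow> 'g \<Rightarrow> complex"
    and level :: complex
  assumes "complex_lie_algebra_form scale bracket form"
  defines "V \<equiv> induced_module scale bracket form level :: (complex, ('g, 'r::finite) induced) module"
    and "vac \<equiv> induced_vacuum scale bracket form level :: ('g, 'r) induced"
  shows "\<exists>Y :: ('g, 'r) induced \<Rightarrow> ('g, 'r) induced \<Rightarrow> int \<Rightarrow> int ^ 'r \<Rightarrow> ('g, 'r) induced.
    (toroidal_vertex_algebra V Y vac \<and>
     (\<forall>a. \<forall>v\<in>carrier V.
        Y (induced_embed scale bracket form level a) v = current_series scale bracket form level a v)) \<and>
    (\<forall>Y'. toroidal_vertex_algebra V Y' vac \<and>
       (\<forall>a. \<forall>v\<in>carrier V.
          Y' (induced_embed scale bracket form level a) v = current_series scale bracket form level a v) \<longrightarrow>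
       (\<forall>u\<in>carrier V. \<forall>v\<in>carrier V. Y' u v = Y u v))"
proof -
  interpret R: induced_representation scale bracket form level V
    unfolding V_def by (intro induced_representation.intro assms(1))
  show ?thesis
  proof (rule complex_module_embedding[OF R.module_V])
    fix i :: "('g, 'r) induced \<Rightarrow> (('g, 'r) induced \<Rightarrow>\<^sub>0 complex)" and p
    assume "\<And>x. p x \<in> carrier V" "\<And>x y. p (x + y) = p x \<oplus>\<^bsub>V\<^esub> p y" "\<And>c x. p (pscale c x) = c \<odot>\<^bsub>V\<^esub> p x"
        "\<And>v. v \<in> carrier V \<Longrightarrow> p (i v) = v"
        "\<And>v w. v \<in> carrier V \<Longrightarrow> w \<in> carrier V \<Longrightarrow> i (v \<oplus>\<^bsub>V\<^esub> w) = i v + i w"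
        "\<And>c v. v \<in> carrier V \<Longrightarrow> i (c \<odot>\<^bsub>V\<^esub> v) = pscale c (i v)"
    then interpret E: induced_embedding scale bracket form level V i p
      by unfold_locales (simp_all add: V_def)
    have vac: "vac = R.tens 1 (0, 1)" unfolding vac_def by (rule R.vacuum_eq)
    obtain Y where Y: "toroidal_vertex_algebra V Y vac"
      "\<forall>a. \<forall>v\<in>carrier V. Y (induced_embed scale bracket form level a) v = current_series scale bracket form level a v"
      using E.toroidal_vertex_algebra_exists by (auto simp: E.vac_def E.emb_def vac R.embed_eq)
    show ?thesis
    proof (intro exI[of _ Y] conjI allI impI ballI)
      fix Y' :: "('g, 'r) induced \<Rightarrow> ('g, 'r) induced \<Rightarrow> int \<Rightarrow> int ^ 'r \<Rightarrow> ('g, 'r) induced" and u v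
      assume "toroidal_vertex_algebra V Y' vac \<and> (\<forall>a. \<forall>v\<in>carrier V.
        Y' (induced_embed scale bracket form level a) v = current_series scale bracket form level a v)"
        and "u \<in> carrier V" "v \<in> carrier V"
      then show "Y' u v = Y u v"
        using Y R.toroidal_vertex_algebra_unique[of Y' Y u v] by (simp add: vac R.embed_eq)
    qed (use Y in auto)
  qed
qed

end
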